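(* Let $\ell\ge0$, $m_0\in\mathcal P_\ell(\mathbb R^d)$ and, for $N\ge1$, $m^N=\frac1N\sum_{i=1}^N\delta_{\zeta_i}$, where $\zeta_1,\zeta_2,\ldots$ are i.i.d. $\mathbb R^d$-valued random variables with law $m_0$. Suppose that $U\in\mathcal S_{1,\ell/2}(\mathcal P_\ell(\mathbb R^d))\cap\mathcal S_{2,\ell}(\mathcal P_\ell(\mathbb R^d))$ is such that $\mathbb R^d\ni y\mapsto\frac{\delta^2U}{\delta m^2}(\mu,x,y)/(1+|x|^{\ell/2})$ is globally Hölder continuous with exponent $\alpha\in(0,\,1_{\{\ell=0\}}+\ell\wedge1]$, uniformly in $(\mu,x)\in\mathcal P_\ell(\mathbb R^d)\times\mathbb R^d$. Then, as $N\to\infty$, $$\sqrt N\left(U(m^N)-U(m_0)\right)\Longrightarrow\mathcal N\left(0,\ \mathrm{Var}\left(\frac{\delta U}{\delta m}(m_0,\zeta_1)\right)\right)$$ in distribution. Furthermore, $$\sup_{N\in\mathbb N}\sqrt N\,\mathbb E\left|U(m^N)-U(m_0)\right|<\infty.$$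
   Context: For $\ell\ge0$, $\mathcal P_\ell(\mathbb R^d)$ is the set of Borel probability measures $m$ on $\mathbb R^d$ with $\int|x|^\ell m(dx)<\infty$. For $\ell>0$, $W_\ell(\mu_1,\mu_2)=\inf_\rho\left(\int|x-y|^\ell\rho(dx,dy)\right)^{1/(\ell\vee1)}$ and $W_0(\mu_1,\mu_2)=\inf_\rho\int1_{\{x\ne y\}}\rho(dx,dy)$, infima over couplings $\rho$ of $\mu_1,\mu_2\in\mathcal P_\ell(\mathbb R^d)$. Linear functional derivatives: $U:\mathcal P_\ell(\mathbb R^d)\to\mathbb R$ admits a linear functional derivative at $\mu$ if there is a measurable $y\mapsto\frac{\delta U}{\delta m}(\mu,y)\in\mathbb R$ with $\sup_y\left|\frac{\delta U}{\delta m}(\mu,y)\right|/(1+|y|^\ell)<\infty$ and $\frac{d}{d\varepsilon}\big|_{\varepsilon=0^+}U(\mu+\varepsilon(\nu-\mu))=\int\frac{\delta U}{\delta m}(\mu,y)(\nu-\mu)(dy)$ for all $\nu\in\mathcal P_\ell(\mathbb R^d)$. Inductively, for $j\ge2$, if $U$ admits a $(j-1)$-th order derivative $\frac{\delta^{j-1}U}{\delta m^{j-1}}(m,\mathbf y)$, $\mathbf y\in(\mathbb R^d)^{j-1}$, for $m$ in a $W_\ell$-neighbourhood of $\mu$, then $U$ admits a $j$-th order linear functional derivative at $\mu$ if for each $\mathbf y$ the map $m\mapsto\frac{\delta^{j-1}U}{\delta m^{j-1}}(m,\mathbf y)$ admits a linear functional derivative at $\mu$, denoted $y\mapsto\frac{\delta^jU}{\delta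 m^j}(\mu,\mathbf y,y)$. The derivatives are normalised by $\frac{\delta^jU}{\delta m^j}(m,y_1,\ldots,y_j)=0$ whenever $y_i=0$ for some $i$. Class $\mathcal S_{j,k}(\mathcal P_\ell(\mathbb R^d))$ ($j\in\mathbb N$, $j\ge 1$, $k,\ell\ge0$): the set of $U:\mathcal P_\ell(\mathbb R^d)\to\mathbb R$ such that for each $1\le i\le j$, $\frac{\delta^iU}{\delta m^i}$ exists on $\mathcal P_\ell(\mathbb R^d)\times(\mathbb R^d)^i$, is measurable in $(x_1,\ldots,x_i)$, and for some $C<\infty$, for all $x_1,\ldots,x_i\in\mathbb R^d$ and $\mu\in\mathcal P_\ell(\mathbb R^d)$, $\left|\frac{\delta^iU}{\delta m^i}(\mu,x_1,\ldots,x_i)\right|\le C\left(1+|x_1|^k+\cdots+|x_i|^k+1_{\{\ell>0\}}\left(\int|x|^\ell\mu(dx)\right)^{k/\ell}\right)$. *)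

theory Defs
  imports "HOL-Probability.Probability"
begin

text \<open>
  The power \<open>|x|^l\<close> for \<open>l \<ge> 0\<close> with the usual convention \<open>|0|^0 = 1\<close>; Isabelle's
  \<open>powr\<close> has \<open>0 powr 0 = 0\<close>.
\<close>

definition npow :: "real \<Rightarrow> 'a::real_normed_vector \<Rightarrow> real" where
  "npow l x = (if l = 0 then 1 else norm x powr l)"

definition prob_moment :: "real \<Rightarrow> 'a::euclidean_space measure set" where
  "prob_moment l = {m. prob_space m \<and> sets m = sets borel \<and> integrable m (npow l)}"

definition couplings ::
    "'a::euclidean_space measure \<Rightarrow> 'a measure \<Rightarrow> ('a \<times> 'a) measure set" where
  "couplings \<mu> \<nu> =
     {\<rho>. sets \<rho> = sets borel \<and> distr \<rho> borel fst = \<mu> \<and> distr \<rho> borel snd = \<nu>}"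

definition wasserstein ::
    "real \<Rightarrow> 'a::euclidean_space measure \<Rightarrow> 'a measure \<Rightarrow> real" where
  "wasserstein l \<mu> \<nu> =
     (if l = 0
      then (INF \<rho>\<in>couplings \<mu> \<nu>. LINT (x, y)|\<rho>. indicator {(x, y). x \<noteq> y} (x, y))
      else (INF \<rho>\<in>couplings \<mu> \<nu>. (LINT (x, y)|\<rho>. norm (x - y) powr l) powr (1 / max l 1)))"

text \<open>The measure \<open>\<mu> + \<epsilon> (\<nu> - \<mu>)\<close>, meant for \<open>\<epsilon>\<close> in the unit interval.\<close>

definition mix :: "real \<Rightarrow> 'a::topological_space measure \<Rightarrow> 'a measure \<Rightarrow> 'a measure" where
  "mix \<epsilon> \<mu> \<nu> =
     measure_of UNIV (sets borel)
       (\<lambda>A. ennreal (1 - \<epsilon>) * emeasure \<mu> A + ennreal \<epsilon> * emeasure \<nu> A)"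

text \<open>
  \<open>D\<close> is a linear functional derivative of \<open>U\<close> at \<open>\<mu>\<close>, not necessarily normalised.
  Functionals on \<^term>\<open>prob_moment l\<close> are total functions on \<open>'a measure\<close> whose values elsewhere
  play no role.
\<close>

definition has_lfd ::
    "real \<Rightarrow> ('a::euclidean_space measure \<Rightarrow> real) \<Rightarrow> 'a measure \<Rightarrow> ('a \<Rightarrow> real) \<Rightarrow> bool" where
  "has_lfd l U \<mu> D \<longleftrightarrow>
     D \<in> borel_measurable borel \<and>
     (\<exists>C. \<forall>y. \<bar>D y\<bar> / (1 + npow l y) \<le> C) \<and>
     (\<forall>\<nu>\<in>prob_moment l.
        ((\<lambda>\<epsilon>. U (mix \<epsilon> \<mu> \<nu>)) has_real_derivative
           (integral\<^sup>L \<nu> D - integral\<^sup>L \<mu> D)) (at_right 0))"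

definition normalised_lfd ::
    "real \<Rightarrow> ('a::euclidean_space measure \<Rightarrow> real) \<Rightarrow> 'a measure \<Rightarrow> 'a \<Rightarrow> real" where
  "normalised_lfd l U \<mu> = (THE D. has_lfd l U \<mu> D \<and> D 0 = 0)"

text \<open>
  \<open>lfd l j U \<mu> [y\<^sub>1, \<dots>, y\<^sub>j]\<close> is the normalised \<open>j\<close>-th order derivative
  at \<open>(\<mu>, y\<^sub>1, \<dots>, y\<^sub>j)\<close>. Only the last variable is normalised explicitly at each order;
  the vanishing in the earlier variables follows, see \<open>lfd_eq_0\<close> below.
\<close>

primrec lfd ::
    "real \<Rightarrow> nat \<Rightarrow> ('a::euclidean_space measure \<Rightarrow> real) \<Rightarrow> 'a measure \<Rightarrow> 'a list \<Rightarrow> real" where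
  "lfd l 0 U \<mu> ys = U \<mu>"
| "lfd l (Suc j) U \<mu> ys = normalised_lfd l (\<lambda>m. lfd l j U m (butlast ys)) \<mu> (last ys)"

primrec admits_lfd ::
    "real \<Rightarrow> nat \<Rightarrow> ('a::euclidean_space measure \<Rightarrow> real) \<Rightarrow> 'a measure \<Rightarrow> bool" where
  "admits_lfd l 0 U \<mu> \<longleftrightarrow> True"
| "admits_lfd l (Suc j) U \<mu> \<longleftrightarrow>
     (\<exists>r>0. \<forall>m\<in>prob_moment l. wasserstein l m \<mu> < r \<longrightarrow> admits_lfd l j U m) \<and>
     (\<forall>ys. length ys = j \<longrightarrow> (\<exists>D. has_lfd l (\<lambda>m. lfd l j U m ys) \<mu> D))"

definition class_S ::
    "real \<Rightarrow> nat \<Rightarrow> real \<Rightarrow> ('a::euclidean_space measure \<Rightarrow> real) set" where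
  "class_S l j k =
     {U. \<forall>i\<in>{1..j}.
        (\<forall>\<mu>\<in>prob_moment l. admits_lfd l i U \<mu>) \<and>
        (\<forall>\<mu>\<in>prob_moment l.
           (\<lambda>x. lfd l i U \<mu> (map x [0..<i])) \<in> borel_measurable (\<Pi>\<^sub>M _\<in>{..<i}. borel)) \<and>
        (\<exists>C. \<forall>\<mu>\<in>prob_moment l. \<forall>xs. length xs = i \<longrightarrow>
           \<bar>lfd l i U \<mu> xs\<bar> \<le>
             C * (1 + (\<Sum>x\<leftarrow>xs. npow k x) +
                  (if l > 0 then npow (k / l) (integral\<^sup>L \<mu> (npow l)) else 0)))}"

definition empirical_measure :: "nat \<Rightarrow> (nat \<Rightarrow> 'a::topological_space) \<Rightarrow> 'a measure" where
  "empirical_measure N x = distr (uniform_count_measure {..<N}) borel x"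

text \<open>The centred Gaussian law of variance \<open>v \<ge> 0\<close>; it is the Dirac mass at \<open>0\<close> if \<open>v = 0\<close>.\<close>

definition centred_normal :: "real \<Rightarrow> real measure" where
  "centred_normal v =
     (if v = 0 then return borel 0 else density lborel (normal_density 0 (sqrt v)))"


lemma npow_nonneg [simp]: "0 \<le> npow l x"
  by (simp add: npow_def)

lemma borel_measurable_npow [measurable]:
  "npow l \<in> borel_measurable (borel :: 'a::euclidean_space measure)"
  unfolding npow_def[abs_def] by measurable

lemma sets_mix [simp]: "sets (mix \<epsilon> \<mu> \<nu>) = sets borel"
  unfolding mix_def by (metis sets.sets_measure_of_eq space_borel)

lemma space_mix [simp]: "space (mix \<epsilon> \<mu> \<nu>) = UNIV"
  unfolding mix_def by (metis sets.space_measure_of_eq space_borel)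

lemma emeasure_mix:
  fixes \<mu> \<nu> :: "'a::topological_space measure"
  assumes "sets \<mu> = sets borel" "sets \<nu> = sets borel" "A \<in> sets borel"
  shows "emeasure (mix \<epsilon> \<mu> \<nu>) A = ennreal (1 - \<epsilon>) * emeasure \<mu> A + ennreal \<epsilon> * emeasure \<nu> A"
  unfolding mix_def
proof (rule emeasure_measure_of_sigma)
  show "sigma_algebra UNIV (sets borel)"
    by (metis sets.sigma_algebra_axioms space_borel)
  show "positive (sets borel) (\<lambda>A. ennreal (1 - \<epsilon>) * emeasure \<mu> A + ennreal \<epsilon> * emeasure \<nu> A)"
    by (simp add: positive_def)
  show "countably_additive (sets borel)
      (\<lambda>A. ennreal (1 - \<epsilon>) * emeasure \<mu> A + ennreal \<epsilon> * emeasure \<nu> A)"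
    unfolding countably_additive_def
  proof safe
    fix F :: "nat \<Rightarrow> 'a set" assume F: "range F \<subseteq> sets borel" "disjoint_family F"
    have "(\<Sum>i. ennreal (1 - \<epsilon>) * emeasure \<mu> (F i) + ennreal \<epsilon> * emeasure \<nu> (F i))
        = (\<Sum>i. ennreal (1 - \<epsilon>) * emeasure \<mu> (F i)) + (\<Sum>i. ennreal \<epsilon> * emeasure \<nu> (F i))"
      by (rule suminf_add[symmetric]) auto
    also have "\<dots> = ennreal (1 - \<epsilon>) * emeasure \<mu> (\<Union>i. F i) + ennreal \<epsilon> * emeasure \<nu> (\<Union>i. F i)"
      using F assms by (simp add: ennreal_suminf_cmult suminf_emeasure)
    finally show "(\<Sum>i. ennreal (1 - \<epsilon>) * emeasure \<mu> (F i) + ennreal \<epsilon> * emeasure \<nu> (F i))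
        = ennreal (1 - \<epsilon>) * emeasure \<mu> (\<Union>i. F i) + ennreal \<epsilon> * emeasure \<nu> (\<Union>i. F i)" .
  qed
qed (use assms in auto)

lemma emeasure_empirical_measure:
  fixes x :: "nat \<Rightarrow> 'a::topological_space"
  assumes "N \<ge> 1" "A \<in> sets borel"
  shows "emeasure (empirical_measure N x) A
    = ennreal (1 / real N) * (\<Sum>i<N. emeasure (return borel (x i)) A)"
proof -
  have m: "x \<in> measurable (uniform_count_measure {..<N}) borel"
    by (auto simp: measurable_def sets_uniform_count_measure space_uniform_count_measure)
  have "emeasure (empirical_measure N x) A
      = emeasure (uniform_count_measure {..<N}) (x -` A \<inter> {..<N})"
    unfolding empirical_measure_def using m assms
    by (simp add: emeasure_distr space_uniform_count_measure)
  also have "\<dots> = ennreal (real (card (x -` A \<inter> {..<N})) / real N)"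
    by (subst emeasure_uniform_count_measure) auto
  also have "real (card (x -` A \<inter> {..<N})) = (\<Sum>i<N. indicator A (x i))"
    by (auto simp: indicator_def of_bool_def sum.If_cases intro!: arg_cong[where f=card])
  also have "ennreal ((\<Sum>i<N. indicator A (x i)) / real N)
      = ennreal (1 / real N) * ennreal (\<Sum>i<N. indicator A (x i))"
    by (subst ennreal_mult[symmetric]) (auto intro!: sum_nonneg)
  also have "ennreal (\<Sum>i<N. indicator A (x i)) = (\<Sum>i<N. emeasure (return borel (x i)) A)"
    using assms by (subst sum_ennreal[symmetric]) (auto simp: ennreal_indicator)
  finally show ?thesis .
qed

lemma return_in_prob_moment: "return borel y \<in> prob_moment l"
proof -
  have "integrable (return borel y) (npow l)"
    by (rule integrableI_bounded) (auto simp: nn_integral_return)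
  then show ?thesis
    by (auto simp: prob_moment_def prob_space_return)
qed

lemma has_lfd_integrable:
  assumes "has_lfd l U \<mu> D" "\<nu> \<in> prob_moment l"
  shows "integrable \<nu> D"
proof -
  from assms obtain C where C: "\<And>y. \<bar>D y\<bar> / (1 + npow l y) \<le> C"
    and m: "D \<in> borel_measurable borel"
    unfolding has_lfd_def by blast
  interpret prob_space \<nu> using assms by (simp add: prob_moment_def)
  have s: "sets \<nu> = sets borel" and i: "integrable \<nu> (npow l)"
    using assms by (auto simp: prob_moment_def)
  have pos: "0 < 1 + npow l y" for y :: 'a
    using npow_nonneg[of l y] by linarith
  have "\<bar>D y\<bar> \<le> C * (1 + npow l y)" for y
    using C[of y] pos[of y] by (simp add: pos_divide_le_eq)
  then have b: "norm (D y) \<le> norm (C * (1 + npow l y))" for y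
    by (metis abs_ge_self order_trans real_norm_def)
  have "D \<in> borel_measurable \<nu>"
    using m s by (simp cong: measurable_cong_sets)
  moreover have "integrable \<nu> (\<lambda>y. C * (1 + npow l y))"
    using i by simp
  moreover have "AE y in \<nu>. norm (D y) \<le> norm (C * (1 + npow l y))"
    by (rule AE_I2) (rule b)
  ultimately show ?thesis
    by (metis Bochner_Integration.integrable_bound)
qed

lemma has_lfd_normalise:
  assumes "has_lfd l U \<mu> D" "\<mu> \<in> prob_moment l"
  shows "has_lfd l U \<mu> (\<lambda>y. D y - D 0)"
  unfolding has_lfd_def
proof (intro conjI ballI)
  from assms have m: "D \<in> borel_measurable borel"
    unfolding has_lfd_def by blast
  then show "(\<lambda>y. D y - D 0) \<in> borel_measurable borel" by simp
  from assms obtain C where C: "\<And>y. \<bar>D y\<bar> / (1 + npow l y) \<le> C"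
    unfolding has_lfd_def by blast
  have "\<bar>D y - D 0\<bar> / (1 + npow l y) \<le> C + \<bar>D 0\<bar>" for y
  proof -
    have n: "1 \<le> 1 + npow l y" "0 < 1 + npow l y"
      using npow_nonneg[of l y] by linarith+
    have "\<bar>D y - D 0\<bar> / (1 + npow l y) \<le> (\<bar>D y\<bar> + \<bar>D 0\<bar>) / (1 + npow l y)"
      using n by (intro divide_right_mono) auto
    also have "\<dots> = \<bar>D y\<bar> / (1 + npow l y) + \<bar>D 0\<bar> / (1 + npow l y)"
      by (simp add: add_divide_distrib)
    also have "\<bar>D 0\<bar> / (1 + npow l y) \<le> \<bar>D 0\<bar> / 1"
      using n by (intro divide_left_mono) auto
    finally show ?thesis using C[of y] by simp
  qed
  then show "\<exists>C. \<forall>y. \<bar>D y - D 0\<bar> / (1 + npow l y) \<le> C" by blast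
next
  fix \<nu> :: "'a measure" assume \<nu>: "\<nu> \<in> prob_moment l"
  have *: "integral\<^sup>L \<kappa> (\<lambda>y. D y - D 0) = integral\<^sup>L \<kappa> D - D 0" if "\<kappa> \<in> prob_moment l" for \<kappa>
  proof -
    interpret prob_space \<kappa> using that by (simp add: prob_moment_def)
    show ?thesis using has_lfd_integrable[OF assms(1) that] by (simp add: prob_space)
  qed
  show "((\<lambda>\<epsilon>. U (mix \<epsilon> \<mu> \<nu>)) has_real_derivative
      (integral\<^sup>L \<nu> (\<lambda>y. D y - D 0) - integral\<^sup>L \<mu> (\<lambda>y. D y - D 0))) (at_right 0)"
    using assms(1) \<nu> by (simp add: *[OF \<nu>] *[OF assms(2)] has_lfd_def)
qed

lemma has_lfd_unique:
  assumes "has_lfd l U \<mu> D" "has_lfd l U \<mu> E" "D 0 = 0" "E 0 = 0"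
  shows "D = E"
proof -
  have *: "integral\<^sup>L (return borel y) D - integral\<^sup>L \<mu> D
      = integral\<^sup>L (return borel y) E - integral\<^sup>L \<mu> E" for y
  proof (rule has_field_derivative_unique)
    show "((\<lambda>\<epsilon>. U (mix \<epsilon> \<mu> (return borel y))) has_real_derivative
        integral\<^sup>L (return borel y) D - integral\<^sup>L \<mu> D) (at_right 0)"
      using assms(1) return_in_prob_moment unfolding has_lfd_def by blast
    show "((\<lambda>\<epsilon>. U (mix \<epsilon> \<mu> (return borel y))) has_real_derivative
        integral\<^sup>L (return borel y) E - integral\<^sup>L \<mu> E) (at_right 0)"
      using assms(2) return_in_prob_moment unfolding has_lfd_def by blast
  qed simp
  have m: "D \<in> borel_measurable borel" "E \<in> borel_measurable borel"
    using assms by (auto simp: has_lfd_def)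
  have **: "D y - integral\<^sup>L \<mu> D = E y - integral\<^sup>L \<mu> E" for y
    using *[of y] m by (simp add: integral_return)
  show ?thesis
    proof
    fix y
    show "D y = E y" using **[of 0] **[of y] assms(3,4) by linarith
  qed
qed

lemma normalised_lfd_eqI:
  assumes "has_lfd l U \<mu> D" "D 0 = 0"
  shows "normalised_lfd l U \<mu> = D"
  unfolding normalised_lfd_def
  by (rule the_equality) (use assms in \<open>auto intro: has_lfd_unique\<close>)

lemma normalised_lfd:
  assumes "has_lfd l U \<mu> D" "\<mu> \<in> prob_moment l"
  shows "has_lfd l U \<mu> (normalised_lfd l U \<mu>)" "normalised_lfd l U \<mu> 0 = 0"
proof -
  have "normalised_lfd l U \<mu> = (\<lambda>y. D y - D 0)"
    using has_lfd_normalise[OF assms] by (rule normalised_lfd_eqI) simp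
  then show "has_lfd l U \<mu> (normalised_lfd l U \<mu>)" "normalised_lfd l U \<mu> 0 = 0"
    using has_lfd_normalise[OF assms] by simp_all
qed

lemma nn_integral_mix:
  assumes "sets \<mu> = sets borel" "sets \<nu> = sets borel" "f \<in> borel_measurable borel"
  shows "(\<integral>\<^sup>+x. f x \<partial>mix \<epsilon> \<mu> \<nu>)
    = ennreal (1 - \<epsilon>) * (\<integral>\<^sup>+x. f x \<partial>\<mu>) + ennreal \<epsilon> * (\<integral>\<^sup>+x. f x \<partial>\<nu>)"
  using assms(3)
proof (induction f rule: borel_measurable_induct)
  case (cong f g)
  have "space \<mu> = UNIV" "space \<nu> = UNIV"
    using assms(1,2)[THEN sets_eq_imp_space_eq] by simp_all
  with cong have "f = g" by auto
  with cong show ?case by simp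
next
  case (set A)
  then show ?case using assms by (simp add: emeasure_mix)
next
  case (mult u c)
  then show ?case using assms
    by (simp add: nn_integral_cmult distrib_left mult.left_commute cong: measurable_cong_sets)
next
  case (add u v)
  then show ?case using assms
    by (simp add: nn_integral_add distrib_left ac_simps cong: measurable_cong_sets)
next
  case (seq F)
  have [measurable_cong]: "sets \<mu> = sets borel" "sets \<nu> = sets borel" "sets (mix \<epsilon> \<mu> \<nu>) = sets borel"
    using assms by auto
  have [measurable]: "F i \<in> borel_measurable borel" for i using seq by simp
  have lim: "(\<integral>\<^sup>+x. (SUP i. F i) x \<partial>\<kappa>) = (SUP i. \<integral>\<^sup>+x. F i x \<partial>\<kappa>)" if "sets \<kappa> = sets borel" for \<kappa>
  proof -
    have "F i \<in> borel_measurable \<kappa>" for i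
      using that by (simp cong: measurable_cong_sets)
    with seq show ?thesis
      using nn_integral_monotone_convergence_SUP[of F \<kappa>] by (simp add: image_comp)
  qed
  have inc: "incseq (\<lambda>i. \<integral>\<^sup>+x. F i x \<partial>\<kappa>)" for \<kappa>
    using seq by (intro incseq_nn_integral)
  have inc': "incseq (\<lambda>i. c * (\<integral>\<^sup>+x. F i x \<partial>\<kappa>))" for c \<kappa>
    using inc[of \<kappa>] by (auto simp: incseq_def intro!: mult_left_mono)
  have "(\<integral>\<^sup>+x. (SUP i. F i) x \<partial>mix \<epsilon> \<mu> \<nu>)
      = (SUP i. ennreal (1 - \<epsilon>) * (\<integral>\<^sup>+x. F i x \<partial>\<mu>) + ennreal \<epsilon> * (\<integral>\<^sup>+x. F i x \<partial>\<nu>))"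
    unfolding lim[OF sets_mix] using seq by simp
  also have "\<dots> = ennreal (1 - \<epsilon>) * (SUP i. \<integral>\<^sup>+x. F i x \<partial>\<mu>)
      + ennreal \<epsilon> * (SUP i. \<integral>\<^sup>+x. F i x \<partial>\<nu>)"
    by (simp add: SUP_mult_left_ennreal ennreal_SUP_add[OF inc' inc'])
  finally show ?case
    unfolding lim[OF assms(1)] lim[OF assms(2)] seq(4) .
qed

lemma mix_in_prob_moment:
  assumes "\<mu> \<in> prob_moment l" "\<nu> \<in> prob_moment l" "0 \<le> \<epsilon>" "\<epsilon> \<le> 1"
  shows "mix \<epsilon> \<mu> \<nu> \<in> prob_moment l"
proof -
  have s: "sets \<mu> = sets borel" "sets \<nu> = sets borel"
    and p: "prob_space \<mu>" "prob_space \<nu>"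
    and i: "integrable \<mu> (npow l)" "integrable \<nu> (npow l)"
    using assms by (auto simp: prob_moment_def)
  have u: "space \<mu> = UNIV" "space \<nu> = UNIV"
    using s[THEN sets_eq_imp_space_eq] by simp_all
  have "emeasure (mix \<epsilon> \<mu> \<nu>) UNIV = ennreal (1 - \<epsilon>) + ennreal \<epsilon>"
    using prob_space.emeasure_space_1[OF p(1)] prob_space.emeasure_space_1[OF p(2)] s u
    by (simp add: emeasure_mix)
  also have "\<dots> = 1"
    using assms by (subst ennreal_plus[symmetric]) auto
  finally have "prob_space (mix \<epsilon> \<mu> \<nu>)"
    by (intro prob_spaceI) simp
  moreover have "integrable (mix \<epsilon> \<mu> \<nu>) (npow l)"
  proof (rule integrableI_bounded)
    show "npow l \<in> borel_measurable (mix \<epsilon> \<mu> \<nu>)"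
      by (simp cong: measurable_cong_sets)
    show "(\<integral>\<^sup>+x. ennreal (norm (npow l x)) \<partial>mix \<epsilon> \<mu> \<nu>) < \<infinity>"
      using i s by (auto simp: nn_integral_mix integrable_iff_bounded ennreal_mult_less_top)
  qed
  ultimately show ?thesis by (simp add: prob_moment_def)
qed

lemma has_lfd_of_zero:
  assumes "\<And>m. m \<in> prob_moment l \<Longrightarrow> U m = 0" "\<mu> \<in> prob_moment l"
  shows "has_lfd l U \<mu> (\<lambda>_. 0)"
  unfolding has_lfd_def
proof (intro conjI ballI)
  show "\<exists>C. \<forall>y::'a. \<bar>0\<bar> / (1 + npow l y) \<le> C" by auto
  fix \<nu> :: "'a measure" assume \<nu>: "\<nu> \<in> prob_moment l"
  have 0: "U (mix \<epsilon> \<mu> \<nu>) = 0" if "0 \<le> \<epsilon>" "\<epsilon> \<le> 1" for \<epsilon>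
    using assms mix_in_prob_moment[OF assms(2) \<nu> that] by simp
  have "((\<lambda>\<epsilon>. U (mix \<epsilon> \<mu> \<nu>)) has_real_derivative 0) (at_right 0)"
    unfolding has_field_derivative_iff
  proof (rule tendsto_eventually)
    show "\<forall>\<^sub>F \<epsilon> in at_right 0. (U (mix \<epsilon> \<mu> \<nu>) - U (mix 0 \<mu> \<nu>)) / (\<epsilon> - 0) = 0"
      by (intro eventually_mono[OF eventually_at_right_real[of 0 1]]) (auto simp: 0)
  qed
  then show "((\<lambda>\<epsilon>. U (mix \<epsilon> \<mu> \<nu>)) has_real_derivative
      (integral\<^sup>L \<nu> (\<lambda>_. 0::real) - integral\<^sup>L \<mu> (\<lambda>_. 0))) (at_right 0)" by simp
qed simp

lemma lfd_eq_0:
  assumes "\<And>i m. i \<le> j \<Longrightarrow> m \<in> prob_moment l \<Longrightarrow> admits_lfd l i U m"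
    and "\<mu> \<in> prob_moment l" "length ys = j" "0 \<in> set ys"
  shows "lfd l j U \<mu> ys = 0"
  using assms
proof (induction j arbitrary: \<mu> ys)
  case 0
  then show ?case by simp
next
  case (Suc j)
  then have "ys \<noteq> []" and lb: "length (butlast ys) = j"
    by auto
  then have ys: "ys = butlast ys @ [last ys]"
    by simp
  show ?case
  proof (cases "0 \<in> set (butlast ys)")
    case True
    have "has_lfd l (\<lambda>m. lfd l j U m (butlast ys)) \<mu> (\<lambda>_. 0)"
      using Suc True lb by (intro has_lfd_of_zero) auto
    from normalised_lfd_eqI[OF this] show ?thesis by simp
  next
    case False
    with Suc.prems(4) ys have "last ys = 0"
      by (metis Un_iff empty_iff insert_iff list.set(1) list.set(2) set_append)
    moreover obtain D where "has_lfd l (\<lambda>m. lfd l j U m (butlast ys)) \<mu> D"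
      using Suc.prems(1)[of "Suc j" \<mu>] Suc.prems(2) lb
      unfolding admits_lfd.simps by blast
    ultimately show ?thesis
      using normalised_lfd(2) Suc.prems(2) by simp
  qed
qed

end

theory Submission
  imports Defs
begin

text \<open>
  Write \<open>V\<close> for the first derivative of \<open>U\<close> and let \<open>m\<^sub>i\<close> be the measure with mass \<open>1/N\<close> at
  each of the first \<open>i\<close> sample points and the remaining mass \<open>1 - i/N\<close> distributed according to the
  law \<open>m\<^sub>0\<close>. Along a segment of measures \<open>U\<close> is differentiable, so by the mean value theorem
  \<open>N (U m\<^sub>i\<^sub>+\<^sub>1 - U m\<^sub>i)\<close> equals the centred value of \<open>V m\<^sub>i\<close> at the next sample point up to a
  remainder, which the Hoelder condition makes negligible. Replacing \<open>V m\<^sub>i\<close> by \<open>V m\<^sub>0\<close> costs a sum of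
  martingale differences whose variances tend to \<open>0\<close> because \<open>m\<^sub>i\<close> is close to \<open>m\<^sub>0\<close> on all functions
  satisfying the Hoelder condition. This law of large numbers is uniform over such functions since,
  up to a small error, they depend only on a finitely valued quantisation of the sample. What
  remains is the classical central limit theorem for \<open>V m\<^sub>0\<close> at the sample points.
\<close>

section \<open>Mixtures\<close>

text \<open>A single expansion of \<open>U\<close> at \<open>m\<^sub>0\<close> does not suffice: the
  error bound available for it, \<open>U_taylor\<close>, is proportional to the dual distance
  between the empirical measure and \<open>m\<^sub>0\<close>, which need not be of smaller order
  than \<open>1 / sqrt N\<close>. Exchanging mass \<open>1/N\<close> at a time removes this
  obstacle. Each exchange moves the measure by order \<open>1/N\<close>, so the N rescaled
  remainders add up to less than order \<open>sqrt N\<close>. The distance of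
  \<open>m\<^sub>i\<close> from \<open>m\<^sub>0\<close> enters only through the martingale
  differences; these are orthogonal, so it is enough that their variances tend to 0, at whatever
  rate. The second obstacle is integrability. A finite moment of order \<open>l\<close> makes the
  weight \<open>1 + |x|\<close> to the power \<open>l / 2\<close> square integrable and no more,
  whereas the Hoelder condition produces higher powers. Differences of \<open>V\<close> are
  therefore estimated twice, by the Hoelder condition and by growth, and the minimum of the two
  bounds is carried along.\<close>

lemma prob_momentD:
  assumes "m \<in> prob_moment l"
  shows "prob_space m" "sets m = sets borel" "space m = UNIV" "integrable m (npow l)"
  using assms sets_eq_imp_space_eq[of m borel] by (auto simp: prob_moment_def)

lemma borel_measurable_prob_moment:
  assumes "m \<in> prob_moment l"
  shows "f \<in> borel_measurable m \<longleftrightarrow> f \<in> borel_measurable borel"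
  using prob_momentD(2)[OF assms] by (simp cong: measurable_cong_sets)

text \<open>
  The identity for nonnegative functions is used as a characterisation of the mixture, so that the same
  lemma serves both \<^const>\<open>mix\<close> and the measures interpolating between the law and the sample.
\<close>

lemma has_bochner_integral_mixture:
  fixes h :: "'a::topological_space \<Rightarrow> real"
  assumes "finite F" "\<And>k. k \<in> F \<Longrightarrow> 0 \<le> w k"
    and sets: "sets m = sets borel" "\<And>k. k \<in> F \<Longrightarrow> sets (\<kappa> k) = sets borel"
    and nn: "\<And>f. f \<in> borel_measurable borel \<Longrightarrow>
        (\<integral>\<^sup>+x. f x \<partial>m) = (\<Sum>k\<in>F. ennreal (w k) * (\<integral>\<^sup>+x. f x \<partial>\<kappa> k))"
    and h: "h \<in> borel_measurable borel" "\<And>k. k \<in> F \<Longrightarrow> integrable (\<kappa> k) h"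
  shows "has_bochner_integral m h (\<Sum>k\<in>F. w k * integral\<^sup>L (\<kappa> k) h)"
proof -
  have part: "(\<integral>\<^sup>+x. ennreal (g x) \<partial>m) = ennreal (\<Sum>k\<in>F. w k * (\<integral>x. g x \<partial>\<kappa> k))"
    if "\<And>k. k \<in> F \<Longrightarrow> integrable (\<kappa> k) g" "\<And>x. 0 \<le> g x" "g \<in> borel_measurable borel" for g
  proof -
    have "(\<integral>\<^sup>+x. ennreal (g x) \<partial>m) = (\<Sum>k\<in>F. ennreal (w k) * (\<integral>\<^sup>+x. g x \<partial>\<kappa> k))"
      using that by (intro nn) auto
    also have "\<dots> = (\<Sum>k\<in>F. ennreal (w k * (\<integral>x. g x \<partial>\<kappa> k)))"
      using that assms by (intro sum.cong) (auto simp: nn_integral_eq_integral ennreal_mult)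
    also have "\<dots> = ennreal (\<Sum>k\<in>F. w k * (\<integral>x. g x \<partial>\<kappa> k))"
      using that assms by (intro sum_ennreal) auto
    finally show ?thesis .
  qed
  have pos: "0 \<le> (\<Sum>k\<in>F. w k * (\<integral>x. max 0 (g x) \<partial>\<kappa> k))" for g
    using assms by (intro sum_nonneg mult_nonneg_nonneg) auto
  have intg: "has_bochner_integral m (\<lambda>x. max 0 (g x)) (\<Sum>k\<in>F. w k * (\<integral>x. max 0 (g x) \<partial>\<kappa> k))"
    if "\<And>k. k \<in> F \<Longrightarrow> integrable (\<kappa> k) g" "g \<in> borel_measurable borel" for g
    using that sets pos[of g]
    by (intro has_bochner_integral_nn_integral part) (auto cong: measurable_cong_sets)
  have "has_bochner_integral m (\<lambda>x. max 0 (h x) - max 0 (- h x))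
    ((\<Sum>k\<in>F. w k * (\<integral>x. max 0 (h x) \<partial>\<kappa> k)) - (\<Sum>k\<in>F. w k * (\<integral>x. max 0 (- h x) \<partial>\<kappa> k)))"
    using h by (intro has_bochner_integral_diff intg) auto
  also have "(\<lambda>x. max 0 (h x) - max 0 (- h x)) = h"
    by auto
  also have "(\<Sum>k\<in>F. w k * (\<integral>x. max 0 (h x) \<partial>\<kappa> k)) - (\<Sum>k\<in>F. w k * (\<integral>x. max 0 (- h x) \<partial>\<kappa> k))
      = (\<Sum>k\<in>F. w k * integral\<^sup>L (\<kappa> k) h)"
    unfolding sum_subtractf[symmetric]
  proof (intro sum.cong refl)
    fix k assume k: "k \<in> F"
    have "(\<integral>x. h x \<partial>\<kappa> k) = (\<integral>x. max 0 (h x) - max 0 (- h x) \<partial>\<kappa> k)"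
      by (intro Bochner_Integration.integral_cong) auto
    also have "\<dots> = (\<integral>x. max 0 (h x) \<partial>\<kappa> k) - (\<integral>x. max 0 (- h x) \<partial>\<kappa> k)"
      using h k by (intro Bochner_Integration.integral_diff) auto
    finally show "w k * (\<integral>x. max 0 (h x) \<partial>\<kappa> k) - w k * (\<integral>x. max 0 (- h x) \<partial>\<kappa> k)
        = w k * integral\<^sup>L (\<kappa> k) h" by (simp add: right_diff_distrib)
  qed
  finally show ?thesis .
qed

lemma integral_mix:
  fixes h :: "'a::topological_space \<Rightarrow> real"
  assumes "sets \<mu> = sets borel" "sets \<nu> = sets borel" "h \<in> borel_measurable borel"
    "integrable \<mu> h" "integrable \<nu> h" "0 \<le> s" "s \<le> 1"
  shows "integral\<^sup>L (mix s \<mu> \<nu>) h = (1 - s) * integral\<^sup>L \<mu> h + s * integral\<^sup>L \<nu> h"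
proof -
  have "has_bochner_integral (mix s \<mu> \<nu>) h
      (\<Sum>b\<in>UNIV. (if b then s else 1 - s) * integral\<^sup>L (if b then \<nu> else \<mu>) h)"
    using assms
    by (intro has_bochner_integral_mixture) (auto simp: UNIV_bool nn_integral_mix add.commute)
  then show ?thesis
    by (simp add: has_bochner_integral_iff UNIV_bool)
qed

lemma mix_0:
  assumes "sets \<mu> = sets borel" "sets \<nu> = sets borel"
  shows "mix 0 \<mu> \<nu> = \<mu>"
  by (rule measure_eqI) (use assms in \<open>auto simp: emeasure_mix\<close>)

lemma mix_1:
  assumes "sets \<mu> = sets borel" "sets \<nu> = sets borel"
  shows "mix 1 \<mu> \<nu> = \<nu>"
  by (rule measure_eqI) (use assms in \<open>auto simp: emeasure_mix\<close>)

lemma mix_commute: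
  assumes "sets \<mu> = sets borel" "sets \<nu> = sets borel"
  shows "mix s \<mu> \<nu> = mix (1 - s) \<nu> \<mu>"
  by (rule measure_eqI) (use assms in \<open>auto simp: emeasure_mix add.commute\<close>)

text \<open>\<open>has_lfd\<close> differentiates only at the start of a segment. This identity lets
  the segment start afresh at an interior point and still run inside the original one.\<close>

lemma mix_mix:
  assumes "sets \<mu> = sets borel" "sets \<nu> = sets borel" "0 \<le> s" "s \<le> 1" "0 \<le> t" "t \<le> 1"
  shows "mix t (mix s \<mu> \<nu>) \<nu> = mix (s + t * (1 - s)) \<mu> \<nu>"
proof (rule measure_eqI)
  fix A assume "A \<in> sets (mix t (mix s \<mu> \<nu>) \<nu>)"
  then have A: "A \<in> sets borel" by simp
  have "emeasure (mix t (mix s \<mu> \<nu>) \<nu>) A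
      = (ennreal (1 - t) * ennreal (1 - s)) * emeasure \<mu> A
        + (ennreal (1 - t) * ennreal s + ennreal t) * emeasure \<nu> A"
    using assms A by (simp add: emeasure_mix distrib_left distrib_right ac_simps)
  also have "ennreal (1 - t) * ennreal (1 - s) = ennreal (1 - (s + t * (1 - s)))"
    using assms by (simp add: ennreal_mult[symmetric] algebra_simps)
  also have "ennreal (1 - t) * ennreal s + ennreal t = ennreal (s + t * (1 - s))"
  proof -
    have "0 \<le> (1 - t) * s" using assms by simp
    then have "ennreal (1 - t) * ennreal s + ennreal t = ennreal ((1 - t) * s + t)"
      using assms by (simp add: ennreal_mult)
    then show ?thesis by (simp add: algebra_simps)
  qed
  finally show "emeasure (mix t (mix s \<mu> \<nu>) \<nu>) A = emeasure (mix (s + t * (1 - s)) \<mu> \<nu>) A"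
    using assms A by (simp add: emeasure_mix)
qed simp

section \<open>The mean value theorem along segments of measures\<close>

text \<open>The segment restarted at \<open>mix s \<mu> \<nu>\<close> is the old one after the time
  change \<open>(t - s) / (1 - s)\<close>. The factor \<open>1 - s\<close> produced by integrating
  \<open>D\<close> against the mixture cancels the derivative of that time change.\<close>

lemma has_lfd_mix_right_deriv:
  assumes \<mu>: "\<mu> \<in> prob_moment l" and \<nu>: "\<nu> \<in> prob_moment l" and s: "0 \<le> s" "s < 1"
    and D: "has_lfd l \<Phi> (mix s \<mu> \<nu>) D"
  shows "((\<lambda>t. \<Phi> (mix t \<mu> \<nu>)) has_real_derivative (integral\<^sup>L \<nu> D - integral\<^sup>L \<mu> D)) (at_right s)"
proof -
  note pm = prob_momentD[OF \<mu>] and pn = prob_momentD[OF \<nu>]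
  have Dm: "D \<in> borel_measurable borel" using D by (simp add: has_lfd_def)
  let ?F = "\<lambda>\<epsilon>. \<Phi> (mix \<epsilon> (mix s \<mu> \<nu>) \<nu>)"
  have "(?F has_real_derivative (integral\<^sup>L \<nu> D - integral\<^sup>L (mix s \<mu> \<nu>) D)) (at_right 0)"
    using D \<nu> by (simp add: has_lfd_def)
  also have "integral\<^sup>L \<nu> D - integral\<^sup>L (mix s \<mu> \<nu>) D = (integral\<^sup>L \<nu> D - integral\<^sup>L \<mu> D) * (1 - s)"
    using has_lfd_integrable[OF D \<mu>] has_lfd_integrable[OF D \<nu>] pm pn Dm s
    by (simp add: integral_mix algebra_simps)
  finally have F: "(?F has_real_derivative (integral\<^sup>L \<nu> D - integral\<^sup>L \<mu> D) * (1 - s)) (at_right 0)" .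
  have eq: "?F ((t - s) / (1 - s)) = \<Phi> (mix t \<mu> \<nu>)" if "s \<le> t" "t < 1" for t
    using that s pm pn by (simp add: mix_mix)
  have "((\<lambda>t. ?F ((t - s) / (1 - s))) has_real_derivative
      ((integral\<^sup>L \<nu> D - integral\<^sup>L \<mu> D) * (1 - s)) * (1 / (1 - s))) (at_right s)"
  proof (rule DERIV_image_chain[of ?F _ "\<lambda>t. (t - s) / (1 - s)", unfolded o_def])
    show "(?F has_real_derivative (integral\<^sup>L \<nu> D - integral\<^sup>L \<mu> D) * (1 - s))
        (at ((s - s) / (1 - s)) within (\<lambda>t. (t - s) / (1 - s)) ` {s<..})"
      using s by (auto intro!: has_field_derivative_subset[OF F])
    show "((\<lambda>t. (t - s) / (1 - s)) has_real_derivative 1 / (1 - s)) (at_right s)"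
      using s by (auto intro!: derivative_eq_intros)
  qed
  then have "((\<lambda>t. ?F ((t - s) / (1 - s))) has_real_derivative
      (integral\<^sup>L \<nu> D - integral\<^sup>L \<mu> D)) (at_right s)"
    using s by simp
  then show ?thesis
  proof (rule iffD1[OF has_field_derivative_cong_eventually, rotated 2])
    show "\<forall>\<^sub>F t in at_right s. ?F ((t - s) / (1 - s)) = \<Phi> (mix t \<mu> \<nu>)"
      using eventually_at_right_real[OF s(2)] by eventually_elim (auto intro: eq)
  qed (use s in \<open>intro eq, auto\<close>)
qed

text \<open>Reversing the segment turns the right derivative into a left one. The same
  \<open>D\<close> serves both directions, so the two one-sided derivatives agree.\<close>

lemma has_lfd_mix_deriv:
  assumes \<mu>: "\<mu> \<in> prob_moment l" and \<nu>: "\<nu> \<in> prob_moment l" and s: "0 < s" "s < 1"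
    and D: "has_lfd l \<Phi> (mix s \<mu> \<nu>) D"
  shows "((\<lambda>t. \<Phi> (mix t \<mu> \<nu>)) has_real_derivative (integral\<^sup>L \<nu> D - integral\<^sup>L \<mu> D)) (at s)"
proof -
  have com: "mix t \<mu> \<nu> = mix (1 - t) \<nu> \<mu>" for t
    using prob_momentD[OF \<mu>] prob_momentD[OF \<nu>] by (intro mix_commute)
  have "((\<lambda>t. \<Phi> (mix t \<nu> \<mu>)) has_real_derivative (integral\<^sup>L \<mu> D - integral\<^sup>L \<nu> D)) (at_right (1 - s))"
    using D s by (intro has_lfd_mix_right_deriv[OF \<nu> \<mu>]) (auto simp: com)
  then have "((\<lambda>t. \<Phi> (mix (1 - t) \<nu> \<mu>)) has_real_derivative
      (integral\<^sup>L \<mu> D - integral\<^sup>L \<nu> D) * (- 1)) (at_left s)"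
  proof (rule DERIV_image_chain[of "\<lambda>t. \<Phi> (mix t \<nu> \<mu>)" _ "\<lambda>t. 1 - t", unfolded o_def,
        OF has_field_derivative_subset])
    show "(\<lambda>t. 1 - t) ` {..<s} \<subseteq> {1 - s<..}"
      by auto
    show "((\<lambda>t. 1 - t) has_real_derivative - 1) (at_left s)"
      by (auto intro!: derivative_eq_intros)
  qed
  then have "((\<lambda>t. \<Phi> (mix t \<mu> \<nu>)) has_real_derivative
      (integral\<^sup>L \<nu> D - integral\<^sup>L \<mu> D)) (at_left s)"
    by (simp add: com[symmetric])
  moreover have "((\<lambda>t. \<Phi> (mix t \<mu> \<nu>)) has_real_derivative (integral\<^sup>L \<nu> D - integral\<^sup>L \<mu> D)) (at_right s)"
    using D s by (intro has_lfd_mix_right_deriv[OF \<mu> \<nu>]) auto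
  ultimately show ?thesis
    by (simp add: has_field_derivative_iff filterlim_at_split)
qed

lemma has_lfd_mix_tendsto_0:
  assumes "\<mu> \<in> prob_moment l" "\<nu> \<in> prob_moment l" "has_lfd l \<Phi> \<mu> D"
  shows "((\<lambda>t. \<Phi> (mix t \<mu> \<nu>)) \<longlongrightarrow> \<Phi> \<mu>) (at_right 0)"
proof -
  have "continuous (at_right 0) (\<lambda>t. \<Phi> (mix t \<mu> \<nu>))"
    using assms has_field_derivative_imp_has_derivative has_derivative_continuous
    unfolding has_lfd_def by metis
  then show ?thesis
    using prob_momentD[OF assms(1)] prob_momentD[OF assms(2)]
    by (simp add: continuous_within mix_0)
qed

text \<open>Nothing is known about how \<open>D m\<close> varies with \<open>m\<close>, so the
  derivative along the segment cannot simply be integrated. The mean value theorem asks only for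
  differentiability inside and continuity at the ends, and both follow from one-sided
  derivatives.\<close>

lemma has_lfd_mean_value:
  assumes \<mu>: "\<mu> \<in> prob_moment l" and \<nu>: "\<nu> \<in> prob_moment l"
    and D: "\<And>m. m \<in> prob_moment l \<Longrightarrow> has_lfd l \<Phi> m (D m)"
  shows "\<exists>s\<in>{0<..<1}. \<Phi> \<nu> - \<Phi> \<mu> = integral\<^sup>L \<nu> (D (mix s \<mu> \<nu>)) - integral\<^sup>L \<mu> (D (mix s \<mu> \<nu>))"
proof -
  note pm = prob_momentD[OF \<mu>] and pn = prob_momentD[OF \<nu>]
  let ?f = "\<lambda>t. \<Phi> (mix t \<mu> \<nu>)"
  let ?g = "\<lambda>t. integral\<^sup>L \<nu> (D (mix t \<mu> \<nu>)) - integral\<^sup>L \<mu> (D (mix t \<mu> \<nu>))"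
  have der: "(?f has_real_derivative ?g s) (at s)" if "0 < s" "s < 1" for s
    using that by (intro has_lfd_mix_deriv[OF \<mu> \<nu>] D mix_in_prob_moment \<mu> \<nu>) auto
  \<comment> \<open>Continuity at 1 is continuity at 0 of the reversed segment.\<close>
  have "((\<lambda>t. \<Phi> (mix t \<nu> \<mu>)) \<longlongrightarrow> \<Phi> \<nu>) (at_right 0)"
    by (rule has_lfd_mix_tendsto_0[OF \<nu> \<mu> D[OF \<nu>]])
  then have "((\<lambda>t. \<Phi> (mix (1 - t) \<nu> \<mu>)) \<longlongrightarrow> \<Phi> \<nu>) (at_left 1)"
    by (simp add: filterlim_at_left_to_right at_right_to_0[of "-1"] filterlim_filtermap)
  then have right: "(?f \<longlongrightarrow> \<Phi> \<nu>) (at_left 1)"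
    using mix_commute[OF pm(2) pn(2)] by simp
  have left: "(?f \<longlongrightarrow> \<Phi> \<mu>) (at_right 0)"
    by (rule has_lfd_mix_tendsto_0[OF \<mu> \<nu> D[OF \<mu>]])
  have cont: "continuous_on {0..1} ?f"
  proof (rule continuous_on_IccI)
    show "(?f \<longlongrightarrow> ?f 0) (at_right 0)" "(?f \<longlongrightarrow> ?f 1) (at_left 1)"
      using left right pm pn by (simp_all add: mix_0 mix_1)
    show "?f \<midarrow>s\<rightarrow> ?f s" if "0 < s" "s < 1" for s
      using DERIV_isCont[OF der[OF that]] by (simp add: isCont_def)
  qed simp
  have dd: "(?f has_derivative (\<lambda>h. h * ?g s)) (at s)" if "0 < s" "s < 1" for s
    using der[OF that] by (rule has_derivative_eq_rhs[OF has_field_derivative_imp_has_derivative]) (simp add: fun_eq_iff)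
  obtain s where s: "0 < s" "s < 1" "?f 1 - ?f 0 = (1 - 0) * ?g s"
    by (rule mvt[of 0 1 ?f "\<lambda>s h. h * ?g s", OF _ cont dd]) simp_all
  have "\<Phi> \<nu> - \<Phi> \<mu> = ?g s"
    using s(3) by (simp only: mix_0[OF pm(2) pn(2)] mix_1[OF pm(2) pn(2)] diff_zero mult_1)
  with s(1,2) show ?thesis
    by (intro bexI[of _ s]) simp_all
qed

section \<open>The Hoelder cost\<close>

lemma npow_half_sq:
  assumes "0 \<le> l"
  shows "(npow (l / 2) x)\<^sup>2 = npow l x"
  using assms by (auto simp: npow_def power2_eq_square powr_add[symmetric])

lemma npow_mono:
  assumes "0 \<le> l" "norm x \<le> norm y"
  shows "npow l x \<le> npow l y"
  using assms by (auto simp: npow_def intro: powr_mono2)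

text \<open>
  For \<open>l = 0\<close> the law need not have any moments; the second derivative is then bounded, so the Hoelder
  modulus may be capped at \<open>1\<close>.
\<close>

definition hcost :: "real \<Rightarrow> real \<Rightarrow> 'a::euclidean_space \<Rightarrow> 'a \<Rightarrow> real" where
  "hcost l \<alpha> x y = (if l = 0 then min 1 (norm (x - y) powr \<alpha>) else norm (x - y) powr \<alpha>)"

lemma hcost_nonneg [simp]: "0 \<le> hcost l \<alpha> x y"
  by (simp add: hcost_def)

lemma borel_measurable_hcost [measurable]:
  assumes [measurable]: "f \<in> borel_measurable M" "g \<in> borel_measurable M"
  shows "(\<lambda>x. hcost l \<alpha> (f x) (g x)) \<in> borel_measurable M"
  unfolding hcost_def by measurable

text \<open>This is where the range of \<open>\<alpha>\<close> is used: for \<open>l > 0\<close> it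
  gives \<open>|y|\<close> to the power \<open>\<alpha>\<close> at most \<open>1 + npow l y\<close>,
  so a finite moment of order \<open>l\<close> makes the cost integrable. The factor 3 in the
  hypothesis is adapted to \<open>x = y\<close> and an approximation \<open>x'\<close> of norm at
  most \<open>2 * norm y\<close>.\<close>

lemma hcost_le:
  fixes x x' y :: "'a::euclidean_space"
  assumes "0 \<le> l" "0 < \<alpha>" "\<alpha> \<le> (if l = 0 then 1 else 0) + min l 1" "norm (x - x') \<le> 3 * norm y"
  shows "hcost l \<alpha> x x' \<le> 3 * (1 + npow l y)"
proof (cases "l = 0")
  case True
  then show ?thesis by (simp add: hcost_def npow_def)
next
  case False
  have "norm (x - x') powr \<alpha> \<le> (3 * norm y) powr \<alpha>"
    using assms by (intro powr_mono2) auto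
  also have "\<dots> = 3 powr \<alpha> * norm y powr \<alpha>"
    by (simp add: powr_mult)
  also have "\<dots> \<le> 3 powr 1 * (1 + norm y powr l)"
  proof (intro mult_mono)
    show "3 powr \<alpha> \<le> 3 powr (1::real)"
      using assms False by (intro powr_mono) auto
    show "norm y powr \<alpha> \<le> 1 + norm y powr l"
    proof (cases "norm y \<le> 1")
      case True
      then have "norm y powr \<alpha> \<le> 1" using assms by (intro powr_le1) auto
      then show ?thesis by (smt (verit) powr_ge_zero)
    next
      case outer: False
      then have "norm y powr \<alpha> \<le> norm y powr l"
        using assms False by (intro powr_mono) auto
      then show ?thesis by simp
    qed
  qed auto
  finally show ?thesis using False by (simp add: hcost_def npow_def)
qed

lemma hcost_tendsto_0:
  assumes "0 < \<alpha>" "(f \<longlongrightarrow> y) F"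
  shows "((\<lambda>n. hcost l \<alpha> y (f n)) \<longlongrightarrow> 0) F"
proof -
  have "((\<lambda>n. norm (y - f n) powr \<alpha>) \<longlongrightarrow> norm (y - y) powr \<alpha>) F"
    using assms by (intro tendsto_powr' tendsto_intros) auto
  then have *: "((\<lambda>n. norm (y - f n) powr \<alpha>) \<longlongrightarrow> 0) F"
    using assms by simp
  then show ?thesis
    using tendsto_min[OF tendsto_const[of 1] *] by (cases "l = 0") (simp_all add: hcost_def)
qed

text \<open>
  \<open>w\<close> bounds the distance dual to the functions that are Lipschitz for the cost. It replaces
  the Wasserstein distance and avoids couplings.
\<close>

definition hcost_close ::
    "real \<Rightarrow> real \<Rightarrow> real \<Rightarrow> 'a::euclidean_space measure \<Rightarrow> 'a measure \<Rightarrow> bool" where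
  "hcost_close l \<alpha> w \<mu> \<nu> \<longleftrightarrow>
     (\<forall>h\<in>borel_measurable borel.
        (\<forall>y y'. \<bar>h y - h y'\<bar> \<le> hcost l \<alpha> y y') \<longrightarrow> \<bar>integral\<^sup>L \<nu> h - integral\<^sup>L \<mu> h\<bar> \<le> w)"

lemma hcost_close_nonneg:
  assumes "hcost_close l \<alpha> w \<mu> \<nu>"
  shows "0 \<le> w"
  using assms unfolding hcost_close_def by (auto dest: bspec[of _ _ "\<lambda>_. 0"])

text \<open>Simple function approximation of the identity with base point 0. The bound by
  \<open>2 * norm y\<close> dominates the cost of replacing \<open>y\<close> by
  \<open>q n y\<close>, through \<open>hcost_le\<close>.\<close>

lemma discretisation_seq:
  obtains q :: "nat \<Rightarrow> 'a::euclidean_space \<Rightarrow> 'a"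
  where "\<And>n. simple_function borel (q n)" "\<And>y. (\<lambda>n. q n y) \<longlonglongrightarrow> y"
    "\<And>n y. norm (q n y) \<le> 2 * norm y"
proof -
  from borel_measurable_implies_sequence_metric[of "\<lambda>x::'a. x" borel 0]
  show ?thesis using that by auto
qed

section \<open>Partially resampled empirical measures\<close>

text \<open>
  The measure \<open>1/N (\<Sum>j<i. \<delta>(z j)) + (N - i)/N m\<close>: a uniformly chosen index \<open>j\<close> returns the sample
  point \<open>z j\<close> if \<open>j < i\<close> and a fresh draw from \<open>m\<close> otherwise.
\<close>

definition partial_empirical ::
    "'a::euclidean_space measure \<Rightarrow> nat \<Rightarrow> nat \<Rightarrow> (nat \<Rightarrow> 'a) \<Rightarrow> 'a measure" where
  "partial_empirical m N i z =
     distr (uniform_count_measure {..<N} \<Otimes>\<^sub>M m) borel (\<lambda>(j, x). if j < i then z j else x)"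

lemma sets_partial_empirical [simp, measurable_cong]: "sets (partial_empirical m N i z) = sets borel"
  by (simp add: partial_empirical_def)

lemma partial_empirical_cong:
  assumes "\<And>j. j < i \<Longrightarrow> z j = z' j"
  shows "partial_empirical m N i z = partial_empirical m N i z'"
proof -
  have "(\<lambda>(j, x). if j < i then z j else x) = (\<lambda>(j, x). if j < i then z' j else x)"
    using assms by auto
  then show ?thesis by (simp add: partial_empirical_def)
qed

lemma partial_empirical_measurable [measurable]:
  assumes [measurable_cong]: "sets m = sets borel"
  shows "(\<lambda>(j, x). if j < i then z j else x) \<in> uniform_count_measure {..<N} \<Otimes>\<^sub>M m \<rightarrow>\<^sub>M borel"
proof -
  have [measurable]: "z \<in> uniform_count_measure {..<N} \<rightarrow>\<^sub>M borel"
    "(\<lambda>j. j < i) \<in> uniform_count_measure {..<N} \<rightarrow>\<^sub>M count_space UNIV"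
    by (auto simp: measurable_def sets_uniform_count_measure space_uniform_count_measure)
  show ?thesis by measurable
qed

lemma nn_integral_partial_empirical:
  assumes "prob_space m" and m[measurable_cong]: "sets m = sets borel" and "0 < N"
    and [measurable]: "f \<in> borel_measurable borel"
  shows "(\<integral>\<^sup>+x. f x \<partial>partial_empirical m N i z)
    = (\<Sum>j<N. ennreal (1 / N) * (\<integral>\<^sup>+x. f x \<partial>(if j < i then return borel (z j) else m)))"
proof -
  interpret prob_space m by fact
  have sp: "space m = UNIV" using m sets_eq_imp_space_eq[of m borel] by simp
  note [measurable] = partial_empirical_measurable[OF m]
  have "(\<integral>\<^sup>+x. f x \<partial>partial_empirical m N i z)
      = (\<integral>\<^sup>+p. f (case p of (j, x) \<Rightarrow> if j < i then z j else x)
          \<partial>(uniform_count_measure {..<N} \<Otimes>\<^sub>M m))"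
    unfolding partial_empirical_def by (subst nn_integral_distr) measurable
  also have "\<dots> = (\<integral>\<^sup>+j. \<integral>\<^sup>+x. f (if j < i then z j else x) \<partial>m \<partial>uniform_count_measure {..<N})"
    by (subst nn_integral_fst[symmetric])
      (auto intro!: measurable_compose[OF partial_empirical_measurable[OF m]])
  also have "\<dots> = (\<Sum>j<N. ennreal (1 / N) * (\<integral>\<^sup>+x. f (if j < i then z j else x) \<partial>m))"
    using assms by (simp add: uniform_count_measure_def nn_integral_point_measure_finite)
  also have "\<dots> = (\<Sum>j<N. ennreal (1 / N) * (\<integral>\<^sup>+x. f x \<partial>(if j < i then return borel (z j) else m)))"
    using emeasure_space_1 sp by (intro sum.cong) (auto simp: nn_integral_return)
  finally show ?thesis .
qed

lemma partial_empirical_0: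
  assumes "prob_space m" "sets m = sets borel" "0 < N"
  shows "partial_empirical m N 0 z = m"
proof (rule measure_eqI)
  fix A assume "A \<in> sets (partial_empirical m N 0 z)"
  then have A: "A \<in> sets borel" by simp
  have "emeasure (partial_empirical m N 0 z) A = (\<Sum>j<N. ennreal (1 / N) * emeasure m A)"
    using nn_integral_partial_empirical[OF assms, of "indicator A" 0 z] A assms by simp
  also have "\<dots> = (of_nat N * ennreal (1 / N)) * emeasure m A"
    by (simp add: mult.assoc)
  also have "of_nat N * ennreal (1 / N) = 1"
    using assms by (simp add: ennreal_of_nat_eq_real_of_nat ennreal_mult[symmetric])
  finally show "emeasure (partial_empirical m N 0 z) A = emeasure m A" by simp
qed (use assms in simp)

lemma partial_empirical_full:
  assumes "prob_space m" "sets m = sets borel" "0 < N"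
  shows "partial_empirical m N N z = empirical_measure N z"
proof (rule measure_eqI)
  fix A assume "A \<in> sets (partial_empirical m N N z)"
  then have A: "A \<in> sets borel" by simp
  have "emeasure (partial_empirical m N N z) A
      = (\<Sum>j<N. ennreal (1 / N) * emeasure (return borel (z j)) A)"
    using nn_integral_partial_empirical[OF assms, of "indicator A" N z] A
    by (simp add: nn_integral_return)
  then show "emeasure (partial_empirical m N N z) A = emeasure (empirical_measure N z) A"
    using emeasure_empirical_measure[of N A z] A assms by (simp add: sum_distrib_left)
qed (simp add: empirical_measure_def)

text \<open>Written as the mean under \<open>m\<close> plus centred fluctuations, so that passing
  from \<open>i\<close> to \<open>Suc i\<close> adds exactly one centred term.\<close>

lemma has_bochner_integral_partial_empirical:
  fixes h :: "'a::euclidean_space \<Rightarrow> real"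
  assumes m: "prob_space m" "sets m = sets borel" and "0 < N" "i \<le> N"
    and h: "h \<in> borel_measurable borel" "integrable m h"
  shows "has_bochner_integral (partial_empirical m N i z) h
    (integral\<^sup>L m h + (\<Sum>j<i. h (z j) - integral\<^sup>L m h) / N)"
proof -
  have "has_bochner_integral (partial_empirical m N i z) h
      (\<Sum>j<N. 1 / N * integral\<^sup>L (if j < i then return borel (z j) else m) h)"
  proof (intro has_bochner_integral_mixture nn_integral_partial_empirical m)
    show "integrable (if j < i then return borel (z j) else m) h" for j
      using h by (auto intro!: integrableI_bounded simp: nn_integral_return)
  qed (use assms in auto)
  also have "(\<Sum>j<N. 1 / N * integral\<^sup>L (if j < i then return borel (z j) else m) h)
      = (\<Sum>j<N. (integral\<^sup>L m h + (if j < i then h (z j) - integral\<^sup>L m h else 0)) / N)"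
    using h by (intro sum.cong) (auto simp: integral_return)
  also have "\<dots> = integral\<^sup>L m h + (\<Sum>j<N. if j < i then h (z j) - integral\<^sup>L m h else 0) / N"
    using assms by (simp add: sum_divide_distrib[symmetric] sum.distrib add_divide_distrib)
  also have "(\<Sum>j<N. if j < i then h (z j) - integral\<^sup>L m h else 0) = (\<Sum>j<i. h (z j) - integral\<^sup>L m h)"
    using assms by (intro sum.mono_neutral_cong_right) auto
  finally show ?thesis .
qed

lemmas integral_partial_empirical =
  has_bochner_integral_integral_eq[OF has_bochner_integral_partial_empirical]

lemma partial_empirical_in_prob_moment:
  assumes m: "m \<in> prob_moment l" and "0 < N" "i \<le> N"
  shows "partial_empirical m N i z \<in> prob_moment l"
proof -
  note pm = prob_momentD[OF m]
  interpret prob_space m by (rule pm)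
  interpret u: prob_space "uniform_count_measure {..<N}"
    using assms by (intro prob_space_uniform_count_measure) auto
  interpret pair_prob_space "uniform_count_measure {..<N}" m ..
  have "prob_space (partial_empirical m N i z)"
    unfolding partial_empirical_def
    using partial_empirical_measurable[OF pm(2)] by (intro P.prob_space_distr)
  moreover have "integrable (partial_empirical m N i z) (npow l)"
    using has_bochner_integral_partial_empirical[OF pm(1,2) assms(2,3) _ pm(4)]
    by (auto simp: has_bochner_integral_iff)
  ultimately show ?thesis by (simp add: prob_moment_def)
qed

text \<open>
  Joint measurability is not among the assumptions on \<open>U\<close> and its derivatives. It follows from
  continuity in the sample points, which are replaced by finitely valued approximations.
\<close>

lemma measurable_via_discretisation:
  fixes Z :: "nat \<Rightarrow> 's \<Rightarrow> 'a::euclidean_space" and F :: "'s \<Rightarrow> real"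
  assumes Z[measurable]: "\<And>j. j < i \<Longrightarrow> Z j \<in> S \<rightarrow>\<^sub>M borel"
    and G: "\<And>z. G z \<in> borel_measurable S"
    and lim: "\<And>\<omega> z. \<omega> \<in> space S \<Longrightarrow> (\<And>j. j < i \<Longrightarrow> (\<lambda>n. z n j) \<longlonglongrightarrow> Z j \<omega>) \<Longrightarrow>
        (\<And>j n. j < i \<Longrightarrow> norm (z n j) \<le> 2 * norm (Z j \<omega>)) \<Longrightarrow> (\<lambda>n. G (z n) \<omega>) \<longlonglongrightarrow> F \<omega>"
  shows "F \<in> borel_measurable S"
proof -
  obtain q :: "nat \<Rightarrow> 'a \<Rightarrow> 'a" where q: "\<And>n. simple_function borel (q n)"
    "\<And>y. (\<lambda>n. q n y) \<longlonglongrightarrow> y" "\<And>n y. norm (q n y) \<le> 2 * norm y"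
    using discretisation_seq by blast
  \<comment> \<open>The restriction makes the discretised sample range over the finite set
    \<open>{..<i} \<rightarrow>\<^sub>E range (q n)\<close>. Measurability of \<open>G z\<close> for
    each fixed \<open>z\<close> then suffices.\<close>
  let ?z = "\<lambda>n \<omega>. \<lambda>j\<in>{..<i}. q n (Z j \<omega>)"
  show ?thesis
  proof (rule borel_measurable_LIMSEQ_real)
    show "(\<lambda>n. G (?z n \<omega>) \<omega>) \<longlonglongrightarrow> F \<omega>" if "\<omega> \<in> space S" for \<omega>
      using that q by (intro lim) auto
    show "(\<lambda>\<omega>. G (?z n \<omega>) \<omega>) \<in> borel_measurable S" for n
    proof (rule measurable_compose_countable'[where I="{..<i} \<rightarrow>\<^sub>E range (q n)"])
      have fin: "finite (range (q n))"
        using q(1)[of n] by (simp add: simple_function_def)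
      have "q n \<in> borel \<rightarrow>\<^sub>M count_space (range (q n))"
        using measurable_simple_function[OF q(1)] fin
        by (auto simp: measurable_count_space_eq2_countable simple_function_def measurable_def)
      then have "?z n \<in> S \<rightarrow>\<^sub>M (\<Pi>\<^sub>M j\<in>{..<i}. count_space (range (q n)))"
        by (intro measurable_restrict measurable_compose[OF Z]) auto
      then show "?z n \<in> S \<rightarrow>\<^sub>M count_space ({..<i} \<rightarrow>\<^sub>E range (q n))"
        using fin by (subst (asm) count_space_PiM_finite) (auto intro: countable_finite)
      show "countable ({..<i} \<rightarrow>\<^sub>E range (q n))"
        using fin by (intro countable_finite finite_PiE) auto
    qed (rule G)
  qed
qed

section \<open>Functionals with a Hoelder continuous second derivative\<close>

text \<open>The normalising weight of the Hoelder hypothesis. Its square is comparable to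
  \<open>1 + npow l\<close>, so it is square integrable under every measure in
  \<open>prob_moment l\<close>.\<close>

definition wt :: "real \<Rightarrow> 'a::euclidean_space \<Rightarrow> real" where
  "wt l x = 1 + npow (l / 2) x"

lemma wt_ge_1: "1 \<le> wt l x" and wt_pos: "0 < wt l x"
  using npow_nonneg[of "l / 2" x] by (auto simp: wt_def simp del: npow_nonneg)

lemma borel_measurable_wt [measurable]: "wt l \<in> borel_measurable borel"
  unfolding wt_def[abs_def] by measurable

lemma wt_sq_le:
  assumes "0 \<le> l"
  shows "(wt l x)\<^sup>2 \<le> 2 * (1 + npow l x)"
proof -
  have "(wt l x)\<^sup>2 = 1 + 2 * npow (l / 2) x + npow l x"
    using npow_half_sq[OF assms, of x] by (simp add: wt_def power2_eq_square algebra_simps)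
  moreover have "2 * npow (l / 2) x \<le> 1 + npow l x"
    using npow_half_sq[OF assms, of x] sum_squares_bound[of 1 "npow (l / 2) x"] by simp
  ultimately show ?thesis by simp
qed

lemma one_plus_npow_le_wt_sq:
  assumes "0 \<le> l"
  shows "1 + npow l x \<le> (wt l x)\<^sup>2"
proof -
  have "(wt l x)\<^sup>2 = 1 + 2 * npow (l / 2) x + npow l x"
    using npow_half_sq[OF assms, of x] by (simp add: wt_def power2_eq_square algebra_simps)
  then show ?thesis by simp
qed

lemma wt_integrable:
  assumes "0 \<le> l" "m \<in> prob_moment l"
  shows "integrable m (\<lambda>x. (wt l x)\<^sup>2)" "integrable m (wt l)"
proof -
  note pm = prob_momentD[OF assms(2)]
  note [measurable_cong] = pm(2)
  interpret prob_space m by (rule pm)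
  show i: "integrable m (\<lambda>x. (wt l x)\<^sup>2)"
  proof (rule Bochner_Integration.integrable_bound)
    show "integrable m (\<lambda>x. 2 * (1 + npow l x))"
      using pm(4) by simp
    show "AE x in m. norm ((wt l x)\<^sup>2) \<le> norm (2 * (1 + npow l x))"
    proof (rule AE_I2)
      fix x
      show "norm ((wt l x)\<^sup>2) \<le> norm (2 * (1 + npow l x))"
        using wt_sq_le[OF assms(1), of x] by simp
    qed
  qed simp
  show "integrable m (wt l)"
  proof (rule Bochner_Integration.integrable_bound[OF i])
    show "AE x in m. norm (wt l x) \<le> norm ((wt l x)\<^sup>2)"
    proof (rule AE_I2)
      fix x
      show "norm (wt l x) \<le> norm ((wt l x)\<^sup>2)"
        using wt_ge_1[of l x] by (simp add: power2_eq_square)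
    qed
  qed simp
qed

text \<open>The second derivative is eliminated here: \<open>V_close\<close> is its Hoelder
  condition integrated along segments, and the analysis of \<open>U\<close> rests on this bound and
  on \<open>V_growth\<close>. The root in \<open>V_growth\<close> is the moment to the power
  \<open>k / l\<close> for \<open>k = l / 2\<close>.\<close>

locale hoelder_functional =
  fixes l \<alpha> C :: real
    and m\<^sub>0 :: "'a::euclidean_space measure"
    and U :: "'a measure \<Rightarrow> real"
    and V :: "'a measure \<Rightarrow> 'a \<Rightarrow> real"
  assumes l: "0 \<le> l" and \<alpha>: "0 < \<alpha>" "\<alpha> \<le> (if l = 0 then 1 else 0) + min l 1"
    and C: "1 \<le> C"
    and m0: "m\<^sub>0 \<in> prob_moment l"
    and lfd: "m \<in> prob_moment l \<Longrightarrow> has_lfd l U m (V m)"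
    and V_growth: "m \<in> prob_moment l \<Longrightarrow> \<bar>V m x\<bar> \<le> C * (wt l x + sqrt (integral\<^sup>L m (npow l)))"
    and V_close: "\<mu> \<in> prob_moment l \<Longrightarrow> \<nu> \<in> prob_moment l \<Longrightarrow> hcost_close l \<alpha> w \<mu> \<nu> \<Longrightarrow>
      \<bar>V \<nu> x - V \<mu> x\<bar> \<le> C * wt l x * w"

text \<open>\<open>V_close\<close> comes from the mean value theorem for \<open>V m x\<close> as a
  functional of \<open>m\<close>: the increment is a difference of integrals of the second
  derivative in its last variable, and that function divided by \<open>C * wt l x\<close> is an
  admissible test function in \<open>hcost_close\<close>.\<close>

lemma class_S_imp_hoelder_functional:
  fixes l \<alpha> :: real
    and m\<^sub>0 :: "'a::euclidean_space measure"
    and U :: "'a measure \<Rightarrow> real"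
  assumes l: "l \<ge> 0"
    and m0: "m\<^sub>0 \<in> prob_moment l"
    and U: "U \<in> class_S l 1 (l / 2) \<inter> class_S l 2 l"
    and \<alpha>: "0 < \<alpha>" "\<alpha> \<le> (if l = 0 then 1 else 0) + min l 1"
    and hoelder: "\<exists>C. \<forall>\<mu>\<in>prob_moment l. \<forall>x y y'.
           \<bar>lfd l 2 U \<mu> [x, y] / (1 + npow (l / 2) x) -
             lfd l 2 U \<mu> [x, y'] / (1 + npow (l / 2) x)\<bar> \<le> C * norm (y - y') powr \<alpha>"
  shows "\<exists>C. hoelder_functional l \<alpha> C m\<^sub>0 U (\<lambda>m x. lfd l 1 U m [x])"
proof -
  define V where "V = (\<lambda>m x. lfd l 1 U m [x])"
  define V2 where "V2 = (\<lambda>m x y. lfd l 2 U m [x, y])"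
  have V_eq: "V m = normalised_lfd l U m" for m
    by (simp add: V_def fun_eq_iff)
  have V2_eq: "V2 m x = normalised_lfd l (\<lambda>m. V m x) m" for m x
    by (simp add: V2_def V_def fun_eq_iff numeral_2_eq_2)
  have V: "has_lfd l U m (V m)" if m: "m \<in> prob_moment l" for m
  proof -
    have "admits_lfd l 1 U m" using U m by (auto simp: class_S_def)
    then obtain D where "has_lfd l U m D" by auto
    from normalised_lfd(1)[OF this m] show ?thesis by (simp add: V_eq)
  qed
  have V2: "has_lfd l (\<lambda>m. V m x) m (V2 m x)" if m: "m \<in> prob_moment l" for m x
  proof -
    have "admits_lfd l 2 U m" using U m unfolding class_S_def by auto
    then have "admits_lfd l (Suc (Suc 0)) U m" by (simp only: numeral_2_eq_2)
    then obtain D where "has_lfd l (\<lambda>m. lfd l (Suc 0) U m [x]) m D"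
      by (auto simp del: lfd.simps dest: spec[of _ "[x]"])
    then have "has_lfd l (\<lambda>m. V m x) m D" by (simp add: V_def)
    from normalised_lfd(1)[OF this m] show ?thesis by (simp add: V2_eq)
  qed
  have "\<exists>C. \<forall>\<mu>\<in>prob_moment l. \<forall>xs. length xs = 1 \<longrightarrow> \<bar>lfd l 1 U \<mu> xs\<bar> \<le>
             C * (1 + (\<Sum>x\<leftarrow>xs. npow (l / 2) x) +
                  (if l > 0 then npow (l / 2 / l) (integral\<^sup>L \<mu> (npow l)) else 0))"
    using U unfolding class_S_def by auto
  then obtain C1 where C1: "\<And>\<mu> xs. \<mu> \<in> prob_moment l \<Longrightarrow> length xs = 1 \<Longrightarrow> \<bar>lfd l 1 U \<mu> xs\<bar> \<le>
             C1 * (1 + (\<Sum>x\<leftarrow>xs. npow (l / 2) x) +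
                  (if l > 0 then npow (l / 2 / l) (integral\<^sup>L \<mu> (npow l)) else 0))"
    by blast
  have "\<exists>C. \<forall>\<mu>\<in>prob_moment l. \<forall>xs. length xs = 2 \<longrightarrow> \<bar>lfd l 2 U \<mu> xs\<bar> \<le>
             C * (1 + (\<Sum>x\<leftarrow>xs. npow l x) +
                  (if l > 0 then npow (l / l) (integral\<^sup>L \<mu> (npow l)) else 0))"
    using U unfolding class_S_def by auto
  then obtain C2 where C2: "\<And>\<mu> xs. \<mu> \<in> prob_moment l \<Longrightarrow> length xs = 2 \<Longrightarrow> \<bar>lfd l 2 U \<mu> xs\<bar> \<le>
             C2 * (1 + (\<Sum>x\<leftarrow>xs. npow l x) +
                  (if l > 0 then npow (l / l) (integral\<^sup>L \<mu> (npow l)) else 0))"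
    by blast
  obtain C3 where C3: "\<And>\<mu> x y y'. \<mu> \<in> prob_moment l \<Longrightarrow>
      \<bar>V2 \<mu> x y / wt l x - V2 \<mu> x y' / wt l x\<bar> \<le> C3 * norm (y - y') powr \<alpha>"
    using hoelder unfolding V2_def wt_def by blast
  \<comment> \<open>The term \<open>6 * |C2|\<close> serves \<open>l = 0\<close>: growth then bounds
    the second derivative by \<open>3 * C2\<close> at each of the two points compared, and their
    difference must fit under the cap in \<open>hcost\<close>. The leading 1 makes division by
    \<open>C\<close> harmless.\<close>
  define C where "C = 1 + \<bar>C1\<bar> + 6 * \<bar>C2\<bar> + \<bar>C3\<bar>"
  have C: "1 \<le> C" "C1 \<le> C" "6 * \<bar>C2\<bar> \<le> C" "C3 \<le> C"
    unfolding C_def by linarith+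
  have growth: "\<bar>V m x\<bar> \<le> C * (wt l x + sqrt (integral\<^sup>L m (npow l)))"
    if m: "m \<in> prob_moment l" for m x
  proof -
    have A: "0 \<le> integral\<^sup>L m (npow l)" by (rule Bochner_Integration.integral_nonneg) simp
    have "\<bar>V m x\<bar> \<le> C1 * (wt l x + (if l > 0 then npow (l / 2 / l) (integral\<^sup>L m (npow l)) else 0))"
      using C1[OF m, of "[x]"] by (simp add: V_def wt_def del: lfd.simps)
    also have "\<dots> \<le> C * (wt l x + (if l > 0 then npow (l / 2 / l) (integral\<^sup>L m (npow l)) else 0))"
      using C(2) wt_pos[of l x] by (intro mult_right_mono) (auto intro!: add_nonneg_nonneg)
    \<comment> \<open>For \<open>l > 0\<close> the exponent \<open>l / 2 / l\<close> is one half;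
      for \<open>l = 0\<close> the root is only an additional nonnegative term.\<close>
    also have "\<dots> \<le> C * (wt l x + sqrt (integral\<^sup>L m (npow l)))"
      using C(1) A by (intro mult_left_mono) (auto simp: npow_def powr_half_sqrt)
    finally show ?thesis .
  qed
  have lip: "\<bar>V2 m x y / (C * wt l x) - V2 m x y' / (C * wt l x)\<bar> \<le> hcost l \<alpha> y y'"
    if m: "m \<in> prob_moment l" for m x y y'
  proof -
    have "\<bar>V2 m x y / wt l x - V2 m x y' / wt l x\<bar> \<le> C3 * norm (y - y') powr \<alpha>"
      by (rule C3[OF m])
    also have "\<dots> \<le> C * norm (y - y') powr \<alpha>"
      using C(4) by (intro mult_right_mono) auto
    finally have 1: "\<bar>V2 m x y / wt l x - V2 m x y' / wt l x\<bar> \<le> C * norm (y - y') powr \<alpha>" .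
    have 2: "\<bar>V2 m x y / wt l x - V2 m x y' / wt l x\<bar> \<le> C" if "l = 0"
    proof -
      have *: "\<bar>V2 m x y / wt l x\<bar> \<le> 3 * \<bar>C2\<bar>" for y
      proof -
        have "\<bar>V2 m x y\<bar> \<le> C2 * 3"
          using C2[OF m, of "[x, y]"] \<open>l = 0\<close> by (simp add: V2_def npow_def del: lfd.simps)
        moreover have "\<bar>V2 m x y\<bar> / wt l x \<le> \<bar>V2 m x y\<bar> / 1"
          using wt_ge_1[of l x] by (intro divide_left_mono) auto
        ultimately show ?thesis using wt_pos[of l x] by simp
      qed
      show ?thesis using *[of y] *[of y'] C(3) by linarith
    qed
    have "\<bar>V2 m x y / wt l x - V2 m x y' / wt l x\<bar> \<le> C * hcost l \<alpha> y y'"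
      using 1 2 C(1) by (auto simp: hcost_def min_def)
    moreover have "\<bar>V2 m x y / (C * wt l x) - V2 m x y' / (C * wt l x)\<bar>
        = \<bar>V2 m x y / wt l x - V2 m x y' / wt l x\<bar> / C"
      using C(1) by (simp add: diff_divide_distrib[symmetric] abs_mult mult.commute)
    ultimately show ?thesis
      using C(1) by (simp add: pos_divide_le_eq mult.commute)
  qed
  have close: "\<bar>V \<nu> x - V \<mu> x\<bar> \<le> C * wt l x * w"
    if \<mu>: "\<mu> \<in> prob_moment l" and \<nu>: "\<nu> \<in> prob_moment l" and w: "hcost_close l \<alpha> w \<mu> \<nu>" for \<mu> \<nu> x w
  proof -
    obtain s where s: "s \<in> {0<..<1}"
      "V \<nu> x - V \<mu> x = integral\<^sup>L \<nu> (V2 (mix s \<mu> \<nu>) x) - integral\<^sup>L \<mu> (V2 (mix s \<mu> \<nu>) x)"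
      using has_lfd_mean_value[OF \<mu> \<nu>, of "\<lambda>m. V m x" "\<lambda>m. V2 m x"] V2 by blast
    define t where "t = mix s \<mu> \<nu>"
    have t: "t \<in> prob_moment l"
      unfolding t_def using s \<mu> \<nu> by (intro mix_in_prob_moment) auto
    let ?h = "\<lambda>y. V2 t x y / (C * wt l x)"
    have p: "0 < C * wt l x" using C(1) wt_pos[of l x] by simp
    have "?h \<in> borel_measurable borel"
      using V2[OF t, of x] by (auto simp: has_lfd_def intro!: borel_measurable_divide)
    with w have "\<bar>integral\<^sup>L \<nu> ?h - integral\<^sup>L \<mu> ?h\<bar> \<le> w"
      unfolding hcost_close_def by (elim ballE[of _ _ ?h] mp) (auto intro: lip[OF t])
    also have "integral\<^sup>L \<nu> ?h - integral\<^sup>L \<mu> ?h = (V \<nu> x - V \<mu> x) / (C * wt l x)"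
      using s(2) by (simp add: t_def diff_divide_distrib)
    finally show ?thesis
      by (simp only: abs_divide abs_of_pos[OF p] pos_divide_le_eq[OF p] mult.commute[of w])
  qed
  have "hoelder_functional l \<alpha> C m\<^sub>0 U V"
    by (unfold_locales; fact l \<alpha> C m0 V growth close)
  then show ?thesis unfolding V_def by blast
qed

section \<open>Closeness estimates, quantisation and measurability\<close>

context hoelder_functional
begin

abbreviation emp :: "nat \<Rightarrow> nat \<Rightarrow> (nat \<Rightarrow> 'a) \<Rightarrow> 'a measure" where
  "emp \<equiv> partial_empirical m\<^sub>0"

abbreviation moment :: "'a measure \<Rightarrow> real" where
  "moment m \<equiv> integral\<^sup>L m (npow l)"

text \<open>Centred under \<open>m\<^sub>0\<close> whatever \<open>m\<close> is: the next sample
  point has law \<open>m\<^sub>0\<close> even when the derivative is taken at an interpolating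
  measure.\<close>

abbreviation lin :: "'a measure \<Rightarrow> 'a \<Rightarrow> real" where
  "lin m x \<equiv> V m x - integral\<^sup>L m\<^sub>0 (V m)"

lemma C_nonneg: "0 \<le> C"
  using C by simp

lemma moment_nonneg: "0 \<le> moment m"
  by (rule Bochner_Integration.integral_nonneg) simp

lemma prob_m0: "prob_space m\<^sub>0" and sets_m0 [measurable_cong]: "sets m\<^sub>0 = sets borel"
  using prob_momentD[OF m0] by auto

lemma V_measurable: "m \<in> prob_moment l \<Longrightarrow> V m \<in> borel_measurable borel"
  using lfd by (auto simp: has_lfd_def)

lemma V_integrable: "m \<in> prob_moment l \<Longrightarrow> \<nu> \<in> prob_moment l \<Longrightarrow> integrable \<nu> (V m)"
  using has_lfd_integrable[OF lfd] .

lemma emp_in: "0 < N \<Longrightarrow> i \<le> N \<Longrightarrow> emp N i z \<in> prob_moment l"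
  by (rule partial_empirical_in_prob_moment[OF m0])

lemma integral_emp:
  fixes h :: "'a \<Rightarrow> real"
  assumes "0 < N" "i \<le> N" "h \<in> borel_measurable borel" "integrable m\<^sub>0 h"
  shows "integral\<^sup>L (emp N i z) h = integral\<^sup>L m\<^sub>0 h + (\<Sum>j<i. h (z j) - integral\<^sup>L m\<^sub>0 h) / N"
  by (rule integral_partial_empirical[OF prob_m0 sets_m0 assms])

lemma integral_emp_Suc:
  fixes h :: "'a \<Rightarrow> real"
  assumes "i < N" "h \<in> borel_measurable borel" "integrable m\<^sub>0 h"
  shows "integral\<^sup>L (emp N (Suc i) z) h = integral\<^sup>L (emp N i z) h + (h (z i) - integral\<^sup>L m\<^sub>0 h) / N"
  using assms by (simp add: integral_emp add_divide_distrib)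

lemma hcost_0_le: "hcost l \<alpha> y 0 \<le> 3 * (1 + npow l y)"
  by (rule hcost_le[OF l \<alpha>]) simp

lemma integrable_hcost_lipschitz:
  fixes h :: "'a \<Rightarrow> real"
  assumes m: "m \<in> prob_moment l" and h: "h \<in> borel_measurable borel"
    and lip: "\<And>y y'. \<bar>h y - h y'\<bar> \<le> hcost l \<alpha> y y'"
  shows "integrable m h"
proof -
  note pm = prob_momentD[OF m]
  interpret prob_space m by (rule pm)
  show ?thesis
  proof (rule Bochner_Integration.integrable_bound)
    show "integrable m (\<lambda>y. \<bar>h 0\<bar> + 3 * (1 + npow l y))" using pm(4) by simp
    show "h \<in> borel_measurable m" using h m borel_measurable_prob_moment by blast
    show "AE y in m. norm (h y) \<le> norm (\<bar>h 0\<bar> + 3 * (1 + npow l y))"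
    proof (rule AE_I2)
      fix y
      have "\<bar>h y\<bar> \<le> \<bar>h 0\<bar> + \<bar>h y - h 0\<bar>" by linarith
      also have "\<dots> \<le> \<bar>h 0\<bar> + 3 * (1 + npow l y)"
        using lip[of y 0] hcost_0_le[of y] by linarith
      finally show "norm (h y) \<le> norm (\<bar>h 0\<bar> + 3 * (1 + npow l y))" by simp
    qed
  qed
qed

lemma integrable_hcost_map:
  assumes m: "m \<in> prob_moment l" and [measurable]: "q \<in> borel_measurable borel"
    and q: "\<And>y. norm (q y) \<le> 2 * norm y"
  shows "integrable m (\<lambda>y. hcost l \<alpha> y (q y))"
proof -
  note pm = prob_momentD[OF m]
  note [measurable_cong] = pm(2)
  interpret prob_space m by (rule pm)
  show ?thesis
  proof (rule Bochner_Integration.integrable_bound)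
    show "integrable m (\<lambda>y. 3 * (1 + npow l y))" using pm(4) by simp
    show "AE y in m. norm (hcost l \<alpha> y (q y)) \<le> norm (3 * (1 + npow l y))"
    proof (rule AE_I2)
      fix y
      have "norm (y - q y) \<le> 3 * norm y"
        using norm_triangle_ineq4[of y "q y"] q[of y] by simp
      then show "norm (hcost l \<alpha> y (q y)) \<le> norm (3 * (1 + npow l y))"
        using hcost_le[OF l \<alpha>] by simp
    qed
  qed simp
qed

lemma integrable_hcost_0: "m \<in> prob_moment l \<Longrightarrow> integrable m (\<lambda>y. hcost l \<alpha> y 0)"
  using integrable_hcost_map[of m "\<lambda>_. 0"] by simp

text \<open>Integrals are affine along the segment, so the difference shrinks by the factor
  \<open>s\<close>. The unknown intermediate measure of the mean value theorem thus inherits the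
  closeness of the end points.\<close>

lemma hcost_close_mix:
  fixes \<mu> \<nu> :: "'a measure"
  assumes \<mu>: "\<mu> \<in> prob_moment l" and \<nu>: "\<nu> \<in> prob_moment l" and w: "hcost_close l \<alpha> w \<mu> \<nu>"
    and s: "0 \<le> s" "s \<le> 1"
  shows "hcost_close l \<alpha> w \<mu> (mix s \<mu> \<nu>)"
  unfolding hcost_close_def
proof (intro ballI impI)
  fix h :: "'a \<Rightarrow> real" assume h: "h \<in> borel_measurable borel" "\<forall>y y'. \<bar>h y - h y'\<bar> \<le> hcost l \<alpha> y y'"
  have i: "integrable \<mu> h" "integrable \<nu> h"
    using h \<mu> \<nu> by (auto intro: integrable_hcost_lipschitz)
  have "integral\<^sup>L (mix s \<mu> \<nu>) h - integral\<^sup>L \<mu> h = s * (integral\<^sup>L \<nu> h - integral\<^sup>L \<mu> h)"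
    using integral_mix[OF prob_momentD(2)[OF \<mu>] prob_momentD(2)[OF \<nu>] h(1) i s]
    by (simp add: algebra_simps)
  then have "\<bar>integral\<^sup>L (mix s \<mu> \<nu>) h - integral\<^sup>L \<mu> h\<bar> = s * \<bar>integral\<^sup>L \<nu> h - integral\<^sup>L \<mu> h\<bar>"
    using s by (simp add: abs_mult)
  also have "\<dots> \<le> 1 * w"
    using h w s unfolding hcost_close_def by (intro mult_mono) auto
  finally show "\<bar>integral\<^sup>L (mix s \<mu> \<nu>) h - integral\<^sup>L \<mu> h\<bar> \<le> w" by simp
qed

lemma hcost_close_emp:
  assumes N: "0 < N" "i \<le> N"
  shows "hcost_close l \<alpha> ((\<Sum>j<i. hcost l \<alpha> (z j) (z' j)) / N) (emp N i z') (emp N i z)"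
  unfolding hcost_close_def
proof (intro ballI impI)
  fix h :: "'a \<Rightarrow> real" assume h: "h \<in> borel_measurable borel" "\<forall>y y'. \<bar>h y - h y'\<bar> \<le> hcost l \<alpha> y y'"
  have i: "integrable m\<^sub>0 h"
    using h m0 by (auto intro: integrable_hcost_lipschitz)
  have "integral\<^sup>L (emp N i z) h - integral\<^sup>L (emp N i z') h = (\<Sum>j<i. h (z j) - h (z' j)) / N"
    using N h i by (simp add: integral_emp diff_divide_distrib[symmetric] sum_subtractf)
  also have "\<bar>\<dots>\<bar> \<le> (\<Sum>j<i. hcost l \<alpha> (z j) (z' j)) / N"
    using h(2) by (auto simp: abs_divide intro!: divide_right_mono order_trans[OF sum_abs] sum_mono)
  finally show "\<bar>integral\<^sup>L (emp N i z) h - integral\<^sup>L (emp N i z') h\<bar>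
      \<le> (\<Sum>j<i. hcost l \<alpha> (z j) (z' j)) / N" .
qed

text \<open>The step exchanges mass \<open>1/N\<close> of the law for a point mass. Both are
  compared with the point mass at 0, from which the cost is integrable.\<close>

lemma hcost_close_emp_Suc:
  assumes N: "i < N"
  shows "hcost_close l \<alpha> ((hcost l \<alpha> (z i) 0 + (\<integral>y. hcost l \<alpha> y 0 \<partial>m\<^sub>0)) / N) (emp N i z) (emp N (Suc i) z)"
  unfolding hcost_close_def
proof (intro ballI impI)
  interpret prob_space m\<^sub>0 by (rule prob_m0)
  fix h :: "'a \<Rightarrow> real" assume h: "h \<in> borel_measurable borel" "\<forall>y y'. \<bar>h y - h y'\<bar> \<le> hcost l \<alpha> y y'"
  have i: "integrable m\<^sub>0 h"
    using h m0 by (auto intro: integrable_hcost_lipschitz)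
  have "\<bar>integral\<^sup>L m\<^sub>0 h - h 0\<bar> = \<bar>\<integral>y. h y - h 0 \<partial>m\<^sub>0\<bar>"
    using i by (simp add: prob_space)
  also have "\<dots> \<le> (\<integral>y. hcost l \<alpha> y 0 \<partial>m\<^sub>0)"
    using h i integrable_hcost_0[OF m0]
    by (intro order_trans[OF integral_abs_bound] integral_mono) auto
  finally have "\<bar>h (z i) - integral\<^sup>L m\<^sub>0 h\<bar> \<le> hcost l \<alpha> (z i) 0 + (\<integral>y. hcost l \<alpha> y 0 \<partial>m\<^sub>0)"
    using h(2)[rule_format, of "z i" 0] by linarith
  then show "\<bar>integral\<^sup>L (emp N (Suc i) z) h - integral\<^sup>L (emp N i z) h\<bar>
      \<le> (hcost l \<alpha> (z i) 0 + (\<integral>y. hcost l \<alpha> y 0 \<partial>m\<^sub>0)) / N"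
    using N h i by (simp add: integral_emp_Suc abs_divide divide_right_mono)
qed

text \<open>Quantisation errors under both measures plus the differences of the cell probabilities.
  A supremum over test functions would be awkward as a random variable; this explicit finite
  expression has an expectation that can be estimated.\<close>

definition quantised_dist :: "('a \<Rightarrow> 'a) \<Rightarrow> 'a measure \<Rightarrow> 'a measure \<Rightarrow> real" where
  "quantised_dist q \<mu> \<nu> =
     (\<integral>y. hcost l \<alpha> y (q y) \<partial>\<nu>) + (\<integral>y. hcost l \<alpha> y (q y) \<partial>\<mu>) +
     (\<Sum>f\<in>range q. hcost l \<alpha> f 0 * \<bar>(\<integral>y. of_bool (q y = f) \<partial>\<nu>) - (\<integral>y. of_bool (q y = f) \<partial>\<mu>)\<bar>)"

text \<open>Split a test function \<open>h\<close> into \<open>h 0\<close>,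
  \<open>h y - h (q y)\<close> and \<open>h (q y) - h 0\<close>. The constant cancels, the second
  part is bounded by the quantisation error, and the third is a finite combination of cell
  indicators with coefficients at most \<open>hcost l \<alpha> f 0\<close>.\<close>

lemma hcost_close_quantised:
  fixes \<mu> \<nu> :: "'a measure" and q :: "'a \<Rightarrow> 'a"
  assumes \<mu>: "\<mu> \<in> prob_moment l" and \<nu>: "\<nu> \<in> prob_moment l"
    and q: "simple_function borel q" "\<And>y. norm (q y) \<le> 2 * norm y"
  shows "hcost_close l \<alpha> (quantised_dist q \<mu> \<nu>) \<mu> \<nu>"
  unfolding hcost_close_def quantised_dist_def
proof (intro ballI impI)
  fix h :: "'a \<Rightarrow> real" assume h: "h \<in> borel_measurable borel" "\<forall>y y'. \<bar>h y - h y'\<bar> \<le> hcost l \<alpha> y y'"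
  have fin: "finite (range q)" using q(1) by (simp add: simple_function_def)
  have qm[measurable]: "q \<in> borel_measurable borel"
    by (rule borel_measurable_simple_function[OF q(1)])
  have *: "integral\<^sup>L m h = h 0 + (\<integral>y. h y - h (q y) \<partial>m) +
        (\<Sum>f\<in>range q. (h f - h 0) * (\<integral>y. of_bool (q y = f) \<partial>m)) \<and>
      \<bar>\<integral>y. h y - h (q y) \<partial>m\<bar> \<le> (\<integral>y. hcost l \<alpha> y (q y) \<partial>m)" if m: "m \<in> prob_moment l" for m
  proof -
    note pm = prob_momentD[OF m]
    note [measurable_cong] = pm(2)
    note [measurable] = h(1)
    interpret prob_space m by (rule pm)
    have ih: "integrable m (\<lambda>y. hcost l \<alpha> y (q y))"
      by (rule integrable_hcost_map[OF m qm q(2)])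
    have i1: "integrable m h"
      using h m by (auto intro: integrable_hcost_lipschitz)
    have i2: "integrable m (\<lambda>y. h y - h (q y))"
      by (rule Bochner_Integration.integrable_bound[OF ih]) (use h in auto)
    have ib: "integrable m (\<lambda>y. of_bool (q y = f) :: real)" for f
      by (rule integrable_const_bound[of _ 1]) auto
    have "h = (\<lambda>y. h 0 + (h y - h (q y)) + (\<Sum>f\<in>range q. (h f - h 0) * of_bool (q y = f)))"
    proof
      fix y
      have "(\<Sum>f\<in>range q. (h f - h 0) * of_bool (q y = f)) = (\<Sum>f\<in>{q y}. h f - h 0)"
        using fin by (intro sum.mono_neutral_cong_right) auto
      then show "h y = h 0 + (h y - h (q y)) + (\<Sum>f\<in>range q. (h f - h 0) * of_bool (q y = f))"
        by simp
    qed
    then have "integral\<^sup>L m h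
        = (\<integral>y. h 0 + (h y - h (q y)) + (\<Sum>f\<in>range q. (h f - h 0) * of_bool (q y = f)) \<partial>m)"
      by (rule arg_cong)
    also have "\<dots> = h 0 + (\<integral>y. h y - h (q y) \<partial>m) +
        (\<Sum>f\<in>range q. (h f - h 0) * (\<integral>y. of_bool (q y = f) \<partial>m))"
      using i2 ib by (subst Bochner_Integration.integral_add) (auto simp: prob_space integral_sum
          Bochner_Integration.integral_add[where f="\<lambda>_. h 0"])
    finally have eq: "integral\<^sup>L m h = h 0 + (\<integral>y. h y - h (q y) \<partial>m) +
        (\<Sum>f\<in>range q. (h f - h 0) * (\<integral>y. of_bool (q y = f) \<partial>m))" .
    have "\<bar>\<integral>y. h y - h (q y) \<partial>m\<bar> \<le> (\<integral>y. hcost l \<alpha> y (q y) \<partial>m)"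
      using h i2 ih by (intro order_trans[OF integral_abs_bound] integral_mono) auto
    with eq show ?thesis by blast
  qed
  let ?p = "\<lambda>m f. \<integral>y. of_bool (q y = f) \<partial>m :: real"
  have "(\<Sum>f\<in>range q. (h f - h 0) * ?p \<nu> f) - (\<Sum>f\<in>range q. (h f - h 0) * ?p \<mu> f)
      = (\<Sum>f\<in>range q. (h f - h 0) * (?p \<nu> f - ?p \<mu> f))"
    by (simp add: sum_subtractf right_diff_distrib)
  moreover have "\<bar>\<Sum>f\<in>range q. (h f - h 0) * (?p \<nu> f - ?p \<mu> f)\<bar>
      \<le> (\<Sum>f\<in>range q. hcost l \<alpha> f 0 * \<bar>?p \<nu> f - ?p \<mu> f\<bar>)"
    using h(2) by (intro order_trans[OF sum_abs] sum_mono) (auto simp: abs_mult intro!: mult_right_mono)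
  ultimately show "\<bar>integral\<^sup>L \<nu> h - integral\<^sup>L \<mu> h\<bar> \<le> (\<integral>y. hcost l \<alpha> y (q y) \<partial>\<nu>) + (\<integral>y. hcost l \<alpha> y (q y) \<partial>\<mu>) +
      (\<Sum>f\<in>range q. hcost l \<alpha> f 0 * \<bar>?p \<nu> f - ?p \<mu> f\<bar>)"
    using *[OF \<mu>] *[OF \<nu>] by linarith
qed

lemma exists_quantisation:
  assumes "0 < \<eta>"
  obtains q :: "'a \<Rightarrow> 'a" where "simple_function borel q" "\<And>y. norm (q y) \<le> 2 * norm y"
    "(\<integral>y. hcost l \<alpha> y (q y) \<partial>m\<^sub>0) < \<eta>"
proof -
  obtain q :: "nat \<Rightarrow> 'a \<Rightarrow> 'a" where q: "\<And>n. simple_function borel (q n)"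
    "\<And>y. (\<lambda>n. q n y) \<longlonglongrightarrow> y" "\<And>n y. norm (q n y) \<le> 2 * norm y"
    using discretisation_seq by blast
  interpret prob_space m\<^sub>0 by (rule prob_m0)
  have [measurable]: "q n \<in> borel_measurable borel" for n
    by (rule borel_measurable_simple_function[OF q(1)])
  have "(\<lambda>n. \<integral>y. hcost l \<alpha> y (q n y) \<partial>m\<^sub>0) \<longlonglongrightarrow> (\<integral>y. 0 \<partial>m\<^sub>0)"
  proof (rule integral_dominated_convergence)
    show "integrable m\<^sub>0 (\<lambda>y. 3 * (1 + npow l y))" using prob_momentD(4)[OF m0] by simp
    show "AE y in m\<^sub>0. (\<lambda>n. hcost l \<alpha> y (q n y)) \<longlonglongrightarrow> 0"
      using q(2) \<alpha>(1) by (intro AE_I2 hcost_tendsto_0)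
    show "AE y in m\<^sub>0. norm (hcost l \<alpha> y (q n y)) \<le> 3 * (1 + npow l y)" for n
    proof (rule AE_I2)
      fix y
      have "norm (y - q n y) \<le> 3 * norm y"
        using norm_triangle_ineq4[of y "q n y"] q(3)[of n y] by simp
      then show "norm (hcost l \<alpha> y (q n y)) \<le> 3 * (1 + npow l y)"
        using hcost_le[OF l \<alpha>] by simp
    qed
  qed auto
  then have "\<forall>\<^sub>F n in sequentially. (\<integral>y. hcost l \<alpha> y (q n y) \<partial>m\<^sub>0) < \<eta>"
    using assms by (intro order_tendstoD(2)[where y=0]) auto
  then obtain n where "(\<integral>y. hcost l \<alpha> y (q n y) \<partial>m\<^sub>0) < \<eta>"
    by (auto simp: eventually_sequentially)
  then show ?thesis using that[of "q n"] q by blast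
qed

lemma U_mean_value:
  assumes "\<mu> \<in> prob_moment l" "\<nu> \<in> prob_moment l"
  obtains s where "0 < s" "s < 1" "mix s \<mu> \<nu> \<in> prob_moment l"
    "U \<nu> - U \<mu> = integral\<^sup>L \<nu> (V (mix s \<mu> \<nu>)) - integral\<^sup>L \<mu> (V (mix s \<mu> \<nu>))"
proof -
  obtain s where "s \<in> {0<..<1}"
    "U \<nu> - U \<mu> = integral\<^sup>L \<nu> (V (mix s \<mu> \<nu>)) - integral\<^sup>L \<mu> (V (mix s \<mu> \<nu>))"
    using has_lfd_mean_value[OF assms lfd] by blast
  then show ?thesis using mix_in_prob_moment[OF assms, of s] that[of s] by auto
qed

text \<open>The mean value theorem gives the derivative at an intermediate measure, and
  \<open>V_close\<close> moves it to \<open>\<mu>\<close>. The estimate controls \<open>U\<close>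
  under discretisation of the sample; the exchange steps use the finer
  \<open>remainder_bound\<close>.\<close>

lemma U_taylor:
  assumes \<mu>: "\<mu> \<in> prob_moment l" and \<nu>: "\<nu> \<in> prob_moment l" and w: "hcost_close l \<alpha> w \<mu> \<nu>"
  shows "\<bar>U \<nu> - U \<mu> - (integral\<^sup>L \<nu> (V \<mu>) - integral\<^sup>L \<mu> (V \<mu>))\<bar>
    \<le> C * w * (integral\<^sup>L \<nu> (wt l) + integral\<^sup>L \<mu> (wt l))"
proof -
  obtain s where s: "0 < s" "s < 1" and t: "mix s \<mu> \<nu> \<in> prob_moment l"
    and eq: "U \<nu> - U \<mu> = integral\<^sup>L \<nu> (V (mix s \<mu> \<nu>)) - integral\<^sup>L \<mu> (V (mix s \<mu> \<nu>))"
    by (rule U_mean_value[OF \<mu> \<nu>])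
  let ?t = "mix s \<mu> \<nu>"
  have bd: "\<bar>V ?t x - V \<mu> x\<bar> \<le> C * w * wt l x" for x
    using V_close[OF \<mu> t hcost_close_mix[OF \<mu> \<nu> w], of x] s by (simp add: ac_simps)
  have bi: "\<bar>\<integral>x. V ?t x - V \<mu> x \<partial>m\<bar> \<le> C * w * integral\<^sup>L m (wt l)" if m: "m \<in> prob_moment l" for m
  proof -
    have "\<bar>\<integral>x. V ?t x - V \<mu> x \<partial>m\<bar> \<le> (\<integral>x. C * w * wt l x \<partial>m)"
      using V_integrable[OF t m] V_integrable[OF \<mu> m] wt_integrable(2)[OF l m] bd
      by (intro order_trans[OF integral_abs_bound] integral_mono) auto
    then show ?thesis by simp
  qed
  have "U \<nu> - U \<mu> - (integral\<^sup>L \<nu> (V \<mu>) - integral\<^sup>L \<mu> (V \<mu>))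
      = (\<integral>x. V ?t x - V \<mu> x \<partial>\<nu>) - (\<integral>x. V ?t x - V \<mu> x \<partial>\<mu>)"
    using V_integrable t \<mu> \<nu> by (simp add: eq)
  then show ?thesis
    using bi[OF \<mu>] bi[OF \<nu>] unfolding distrib_left by linarith
qed

lemma V_emp_measurable:
  fixes Z :: "nat \<Rightarrow> 's \<Rightarrow> 'a"
  assumes N: "0 < N" "i \<le> N" and Z: "\<And>j. j < i \<Longrightarrow> Z j \<in> S \<rightarrow>\<^sub>M borel"
    and X[measurable]: "X \<in> S \<rightarrow>\<^sub>M borel"
  shows "(\<lambda>\<omega>. V (emp N i (\<lambda>j. Z j \<omega>)) (X \<omega>)) \<in> borel_measurable S"
proof (rule measurable_via_discretisation[where i=i and Z=Z and G="\<lambda>z \<omega>. V (emp N i z) (X \<omega>)"])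
  show "(\<lambda>\<omega>. V (emp N i z) (X \<omega>)) \<in> borel_measurable S" for z
    by (rule measurable_compose[OF X V_measurable[OF emp_in[OF N]]])
  fix \<omega> and z :: "nat \<Rightarrow> nat \<Rightarrow> 'a" assume lim: "\<And>j. j < i \<Longrightarrow> (\<lambda>n. z n j) \<longlonglongrightarrow> Z j \<omega>"
  let ?w = "\<lambda>n. (\<Sum>j<i. hcost l \<alpha> (Z j \<omega>) (z n j)) / N"
  have w: "(\<lambda>n. C * wt l (X \<omega>) * ?w n) \<longlonglongrightarrow> C * wt l (X \<omega>) * ((\<Sum>j<i. 0) / N)"
    using lim \<alpha>(1) N by (intro tendsto_intros hcost_tendsto_0) auto
  have bd: "norm (V (emp N i (z n)) (X \<omega>) - V (emp N i (\<lambda>j. Z j \<omega>)) (X \<omega>))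
      \<le> C * wt l (X \<omega>) * ?w n" for n
    using V_close[OF emp_in[OF N] emp_in[OF N] hcost_close_emp[OF N, of "\<lambda>j. Z j \<omega>" "z n"], of "X \<omega>"]
    by (simp add: abs_minus_commute)
  show "(\<lambda>n. V (emp N i (z n)) (X \<omega>)) \<longlonglongrightarrow> V (emp N i (\<lambda>j. Z j \<omega>)) (X \<omega>)"
    using w by (intro LIM_zero_cancel[OF Lim_null_comparison[OF always_eventually[OF allI[OF bd]]]]) simp
qed (rule Z)

text \<open>\<open>U\<close> need not be continuous in the sample points: integration of a
  discontinuous function is an example. What converges is the first-order expansion
  \<open>?G\<close> at the discretised sample, evaluated at the true one; its linear term absorbs
  the irregularity of \<open>V\<close> in the space variable.\<close>

lemma U_emp_measurable:
  fixes Z :: "nat \<Rightarrow> 's \<Rightarrow> 'a"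
  assumes N: "0 < N" "i \<le> N" and Z[measurable]: "\<And>j. j < i \<Longrightarrow> Z j \<in> S \<rightarrow>\<^sub>M borel"
  shows "(\<lambda>\<omega>. U (emp N i (\<lambda>j. Z j \<omega>))) \<in> borel_measurable S"
proof (rule measurable_via_discretisation[where i=i and Z=Z])
  let ?G = "\<lambda>z \<omega>. U (emp N i z) + (integral\<^sup>L (emp N i (\<lambda>j. Z j \<omega>)) (V (emp N i z)) -
      integral\<^sup>L (emp N i z) (V (emp N i z)))"
  show "?G z \<in> borel_measurable S" for z
  proof -
    note [measurable] = V_measurable[OF emp_in[OF N]]
    have "?G z = (\<lambda>\<omega>. U (emp N i z) + (integral\<^sup>L m\<^sub>0 (V (emp N i z)) +
        (\<Sum>j<i. V (emp N i z) (Z j \<omega>) - integral\<^sup>L m\<^sub>0 (V (emp N i z))) / N -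
        integral\<^sup>L (emp N i z) (V (emp N i z))))"
      using integral_emp[OF N V_measurable[OF emp_in[OF N]] V_integrable[OF emp_in[OF N] m0]]
      by presburger
    also have "\<dots> \<in> borel_measurable S"
      by measurable
    finally show ?thesis .
  qed
  fix \<omega> and z :: "nat \<Rightarrow> nat \<Rightarrow> 'a" assume lim: "\<And>j. j < i \<Longrightarrow> (\<lambda>n. z n j) \<longlonglongrightarrow> Z j \<omega>"
    and bd: "\<And>j n. j < i \<Longrightarrow> norm (z n j) \<le> 2 * norm (Z j \<omega>)"
  let ?Z = "\<lambda>j. Z j \<omega>"
  let ?w = "\<lambda>n. (\<Sum>j<i. hcost l \<alpha> (Z j \<omega>) (z n j)) / N"
  \<comment> \<open>The approximating points have at most twice the norm of the sample points and
    the weight increases with the norm, so \<open>B\<close> does not depend on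
    \<open>n\<close>.\<close>
  define B where "B = integral\<^sup>L (emp N i ?Z) (wt l) + integral\<^sup>L (emp N i (\<lambda>j. 2 *\<^sub>R Z j \<omega>)) (wt l)"
  have "integral\<^sup>L (emp N i (z n)) (wt l) \<le> integral\<^sup>L (emp N i (\<lambda>j. 2 *\<^sub>R Z j \<omega>)) (wt l)" for n
    using N wt_integrable(2)[OF l m0] l bd
    by (auto simp: integral_emp wt_def intro!: divide_right_mono sum_mono npow_mono)
  then have B: "integral\<^sup>L (emp N i ?Z) (wt l) + integral\<^sup>L (emp N i (z n)) (wt l) \<le> B" for n
    by (simp add: B_def)
  have w: "(\<lambda>n. C * ?w n * B) \<longlonglongrightarrow> C * ((\<Sum>j<i. 0) / N) * B"
    using lim \<alpha>(1) N by (intro tendsto_intros hcost_tendsto_0) auto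
  have err: "norm (?G (z n) \<omega> - U (emp N i ?Z)) \<le> C * ?w n * B" for n
  proof -
    have "norm (?G (z n) \<omega> - U (emp N i ?Z))
        = \<bar>U (emp N i ?Z) - U (emp N i (z n)) - (integral\<^sup>L (emp N i ?Z) (V (emp N i (z n))) -
            integral\<^sup>L (emp N i (z n)) (V (emp N i (z n))))\<bar>"
      unfolding real_norm_def by (subst abs_minus_commute) (simp add: algebra_simps)
    also have "\<dots> \<le> C * ?w n * (integral\<^sup>L (emp N i ?Z) (wt l) + integral\<^sup>L (emp N i (z n)) (wt l))"
      by (rule U_taylor[OF emp_in[OF N] emp_in[OF N] hcost_close_emp[OF N]])
    also have "\<dots> \<le> C * ?w n * B"
      using C_nonneg B by (intro mult_left_mono) (auto intro!: mult_nonneg_nonneg divide_nonneg_nonneg sum_nonneg)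
    finally show ?thesis .
  qed
  show "(\<lambda>n. ?G (z n) \<omega>) \<longlonglongrightarrow> U (emp N i ?Z)"
    using w by (intro LIM_zero_cancel[OF Lim_null_comparison[OF always_eventually[OF allI[OF err]]]]) simp
qed (rule Z)

end

lemma min_sq_le:
  fixes t b :: real
  assumes "0 \<le> t" "1 \<le> b"
  shows "min (t\<^sup>2) (b + t) \<le> 2 * b * (t * min t 1)"
proof (cases "t \<le> 1")
  case True
  have "t\<^sup>2 \<le> 2 * b * t\<^sup>2"
    using assms mult_right_mono[of 1 "2 * b" "t\<^sup>2"] by simp
  then show ?thesis using True by (simp add: min_def power2_eq_square)
next
  case False
  have "b * 1 \<le> b * t" "1 * t \<le> b * t"
    using False assms mult_left_mono[of 1 t b] mult_right_mono[of 1 b t] by auto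
  then have "b + t \<le> 2 * b * t" by simp
  then show ?thesis using False by (simp add: min_def)
qed

text \<open>Replaces a square by a linear term plus a tail. It is applied with \<open>w\<close> a
  quantised distance, of which only the first moment is controlled.\<close>

lemma min_sq_le_truncation:
  fixes w b s :: real
  assumes "0 \<le> w" "0 \<le> s"
  shows "min (w\<^sup>2) b \<le> s * w + max 0 (b - s\<^sup>2)"
proof (cases "w \<le> s")
  case True
  then have "w\<^sup>2 \<le> s * w" using assms mult_right_mono[of w s w] by (simp add: power2_eq_square)
  then show ?thesis by (simp add: min_def max_def)
next
  case False
  then have "s\<^sup>2 \<le> s * w" using assms mult_left_mono[of s w s] by (simp add: power2_eq_square)
  then show ?thesis by (simp add: min_def max_def)
qed

section \<open>The error of a single exchange and the deviation of the derivative from that at the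
  law\<close>

context hoelder_functional
begin

text \<open>
  The Hoelder bound alone would yield a term of order \<open>|x|\<close> to the power \<open>l / 2 + \<alpha>\<close>, which need
  not be integrable; the growth bound takes over for large sample points.
\<close>

lemma V_increment_bound:
  assumes iN: "i < N"
    and s: "0 \<le> s" "s \<le> 1"
    and \<mu>_def: "\<mu> = emp N i z" and t_def: "t = mix s \<mu> (emp N (Suc i) z)"
    and y_def: "y = wt l (z i)" and c_def: "c = (\<integral>y. hcost l \<alpha> y 0 \<partial>m\<^sub>0)"
  shows "\<bar>V t x - V \<mu> x\<bar> \<le> 2 * C * (5 + c) * (1 + sqrt (moment \<mu>)) *
      (y / sqrt (real N) * min (y / sqrt (real N)) 1) * wt l x"
proof -
  let ?\<nu> = "emp N (Suc i) z"
  \<comment> \<open>Up to constants, one exchange moves the measure by at most the square of this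
    quantity, both in the dual distance and in the moment.\<close>
  define \<tau> where "\<tau> = y / sqrt (real N)"
  define b where "b = 1 + sqrt (moment \<mu>)"
  have N: "0 < N" using iN by simp
  have \<mu>: "\<mu> \<in> prob_moment l" and \<nu>: "?\<nu> \<in> prob_moment l"
    using iN emp_in by (auto simp: \<mu>_def)
  have t: "t \<in> prob_moment l" unfolding t_def using \<mu> \<nu> s by (rule mix_in_prob_moment)
  have y: "1 \<le> y" "npow l (z i) \<le> y\<^sup>2" "1 + npow l (z i) \<le> y\<^sup>2"
    using wt_ge_1[of l "z i"] one_plus_npow_le_wt_sq[OF l, of "z i"] by (auto simp: y_def)
  have c: "0 \<le> c" unfolding c_def by (rule Bochner_Integration.integral_nonneg) simp
  have \<tau>: "0 \<le> \<tau>" using y by (simp add: \<tau>_def)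
  have \<tau>2: "\<tau>\<^sup>2 = y\<^sup>2 / real N" using N by (simp add: \<tau>_def power_divide)
  have b: "1 \<le> b" using moment_nonneg by (simp add: b_def)
  have x: "1 \<le> wt l x" by (rule wt_ge_1)
  have "\<bar>V t x - V \<mu> x\<bar> \<le> C * wt l x * ((hcost l \<alpha> (z i) 0 + c) / real N)"
    unfolding c_def
    by (rule V_close[OF \<mu> t], unfold t_def, rule hcost_close_mix[OF \<mu> \<nu> _ s], unfold \<mu>_def,
        rule hcost_close_emp_Suc[OF iN])
  also have "(hcost l \<alpha> (z i) 0 + c) / N \<le> (3 + c) * \<tau>\<^sup>2"
  proof -
    have "hcost l \<alpha> (z i) 0 + c \<le> 3 * y\<^sup>2 + c * y\<^sup>2"
      using hcost_0_le[of "z i"] y c mult_left_mono[of 1 "y\<^sup>2" c] by (simp add: power_mono)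
    then show ?thesis
      using N by (simp add: \<tau>2 divide_right_mono distrib_right)
  qed
  finally have 1: "\<bar>V t x - V \<mu> x\<bar> \<le> C * wt l x * ((3 + c) * \<tau>\<^sup>2)"
    using C_nonneg x by (simp add: mult_left_mono)
  have "moment t \<le> moment \<mu> + \<tau>\<^sup>2"
  proof -
    note pm = prob_momentD[OF \<mu>] and pn = prob_momentD[OF \<nu>]
    have "moment t = moment \<mu> + s * (moment ?\<nu> - moment \<mu>)"
      unfolding t_def using integral_mix[OF pm(2) pn(2) _ pm(4) pn(4) s] by (simp add: algebra_simps)
    also have "moment ?\<nu> - moment \<mu> = (npow l (z i) - moment m\<^sub>0) / real N"
      using prob_momentD(4)[OF m0] by (simp add: \<mu>_def integral_emp_Suc[OF iN])
    also have "s * \<dots> \<le> \<tau>\<^sup>2"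
    proof -
      have "(npow l (z i) - moment m\<^sub>0) / N \<le> \<tau>\<^sup>2"
        using y(2) moment_nonneg[of m\<^sub>0] unfolding \<tau>2 by (intro divide_right_mono) linarith+
      then have "s * ((npow l (z i) - moment m\<^sub>0) / real N) \<le> s * \<tau>\<^sup>2"
        using s by (intro mult_left_mono)
      also have "\<dots> \<le> \<tau>\<^sup>2" using s by (simp add: mult_left_le_one_le)
      finally show ?thesis .
    qed
    finally show ?thesis by simp
  qed
  then have "sqrt (moment t) \<le> sqrt (moment \<mu> + \<tau>\<^sup>2)" by simp
  also have "\<dots> \<le> sqrt (moment \<mu>) + \<tau>"
    using sqrt_add_le_add_sqrt[of "moment \<mu>" "\<tau>\<^sup>2"] moment_nonneg \<tau> by simp
  finally have st: "sqrt (moment t) \<le> sqrt (moment \<mu>) + \<tau>" .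
  \<comment> \<open>The competing bound, from growth. It is linear in \<open>\<tau>\<close>, because
    the root of the moment increases by at most \<open>\<tau>\<close>.\<close>
  have "\<bar>V t x - V \<mu> x\<bar> \<le> \<bar>V t x\<bar> + \<bar>V \<mu> x\<bar>" by linarith
  also have "\<dots> \<le> C * (wt l x + sqrt (moment t)) + C * (wt l x + sqrt (moment \<mu>))"
    by (intro add_mono V_growth t \<mu>)
  also have "\<dots> = C * (2 * wt l x + sqrt (moment t) + sqrt (moment \<mu>))"
    by (simp add: algebra_simps)
  also have "\<dots> \<le> C * (2 * wt l x * (b + \<tau>))"
  proof (intro mult_left_mono C_nonneg)
    have "1 * (sqrt (moment \<mu>) + \<tau>) \<le> wt l x * (sqrt (moment \<mu>) + \<tau>)"
      using x \<tau> moment_nonneg by (intro mult_right_mono) auto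
    then show "2 * wt l x + sqrt (moment t) + sqrt (moment \<mu>) \<le> 2 * wt l x * (b + \<tau>)"
      using st \<tau> by (simp add: b_def algebra_simps) 
  qed
  finally have 2: "\<bar>V t x - V \<mu> x\<bar> \<le> C * wt l x * (2 * (b + \<tau>))" by (simp add: algebra_simps)
  \<comment> \<open>The constant \<open>5 + c\<close> exceeds both \<open>3 + c\<close> from the
    Hoelder bound and 2 from the growth bound.\<close>
  have "\<bar>V t x - V \<mu> x\<bar> \<le> C * wt l x * ((5 + c) * min (\<tau>\<^sup>2) (b + \<tau>))"
  proof -
    have "(3 + c) * \<tau>\<^sup>2 \<le> (5 + c) * \<tau>\<^sup>2" "2 * (b + \<tau>) \<le> (5 + c) * (b + \<tau>)"
      using c b \<tau> by (intro mult_right_mono; simp)+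
    then have "C * wt l x * ((3 + c) * \<tau>\<^sup>2) \<le> C * wt l x * ((5 + c) * \<tau>\<^sup>2)"
      "C * wt l x * (2 * (b + \<tau>)) \<le> C * wt l x * ((5 + c) * (b + \<tau>))"
      using C_nonneg x by (auto intro!: mult_left_mono)
    with 1 2 show ?thesis by (auto simp: min_def)
  qed
  also have "\<dots> \<le> C * wt l x * ((5 + c) * (2 * b * (\<tau> * min \<tau> 1)))"
    using C_nonneg x c \<tau> b by (intro mult_left_mono min_sq_le) auto
  finally show ?thesis unfolding b_def \<tau>_def by (simp only: ac_simps)
qed

definition rem_const :: real where
  "rem_const = 2 * C * (5 + (\<integral>y. hcost l \<alpha> y 0 \<partial>m\<^sub>0)) * (1 + integral\<^sup>L m\<^sub>0 (wt l))"

lemma rem_const_nonneg: "0 \<le> rem_const"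
proof -
  have "0 \<le> (\<integral>y. hcost l \<alpha> y 0 \<partial>m\<^sub>0)" "0 \<le> integral\<^sup>L m\<^sub>0 (wt l)"
    by (auto intro!: Bochner_Integration.integral_nonneg simp: less_imp_le[OF wt_pos])
  then show ?thesis using C_nonneg unfolding rem_const_def by simp
qed

text \<open>The cube of the weight divided by \<open>sqrt N\<close>, capped at its square. The cube
  need not be integrable; the capped version is dominated by the integrable square and tends to 0
  pointwise.\<close>

definition trunc :: "nat \<Rightarrow> 'a \<Rightarrow> real" where
  "trunc N x = (wt l x)\<^sup>2 * min (wt l x / sqrt (real N)) 1"

text \<open>Neighbouring measures differ by mass \<open>1/N\<close>, so the mean value theorem gives
  exactly \<open>lin\<close> at an intermediate measure. Replacing that measure by
  \<open>emp N i z\<close> costs \<open>V_increment_bound\<close> at the new point and, through the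
  centring, its integral under \<open>m\<^sub>0\<close>.\<close>

lemma remainder_bound:
  assumes iN: "i < N"
  shows "\<bar>real N * (U (emp N (Suc i) z) - U (emp N i z)) - lin (emp N i z) (z i)\<bar>
    \<le> rem_const * (1 + sqrt (moment (emp N i z))) * trunc N (z i) / sqrt (real N)"
proof -
  let ?\<mu> = "emp N i z" and ?\<nu> = "emp N (Suc i) z"
  define c where "c = (\<integral>y. hcost l \<alpha> y 0 \<partial>m\<^sub>0)"
  define y where "y = wt l (z i)"
  define \<tau> where "\<tau> = y / sqrt (real N)"
  define b where "b = 1 + sqrt (moment ?\<mu>)"
  have N: "0 < N" using iN by simp
  have \<mu>: "?\<mu> \<in> prob_moment l" and \<nu>: "?\<nu> \<in> prob_moment l"
    using iN emp_in by auto
  obtain s where s: "0 < s" "s < 1" and t: "mix s ?\<mu> ?\<nu> \<in> prob_moment l"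
    and eq: "U ?\<nu> - U ?\<mu> = integral\<^sup>L ?\<nu> (V (mix s ?\<mu> ?\<nu>)) - integral\<^sup>L ?\<mu> (V (mix s ?\<mu> ?\<nu>))"
    by (rule U_mean_value[OF \<mu> \<nu>])
  let ?t = "mix s ?\<mu> ?\<nu>"
  define B where "B = 2 * C * (5 + c) * b * (\<tau> * min \<tau> 1)"
  have bd: "\<bar>V ?t x - V ?\<mu> x\<bar> \<le> B * wt l x" for x
    using V_increment_bound[OF iN less_imp_le[OF s(1)] less_imp_le[OF s(2)] refl refl refl refl, of z x] by (simp add: B_def c_def y_def \<tau>_def b_def)
  have B: "0 \<le> B"
    using order_trans[OF abs_ge_zero bd[of 0]] wt_pos[of l "0 :: 'a"]
    by (auto simp: zero_le_mult_iff)
  have "real N * (U ?\<nu> - U ?\<mu>) = lin ?t (z i)"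
    using N by (simp add: eq integral_emp_Suc[OF iN] V_measurable[OF t] V_integrable[OF t m0])
  then have "\<bar>real N * (U ?\<nu> - U ?\<mu>) - lin ?\<mu> (z i)\<bar>
      = \<bar>(V ?t (z i) - V ?\<mu> (z i)) - (\<integral>x. V ?t x - V ?\<mu> x \<partial>m\<^sub>0)\<bar>"
    by (simp add: V_integrable[OF t m0] V_integrable[OF \<mu> m0])
  also have "\<dots> \<le> B * y + B * integral\<^sup>L m\<^sub>0 (wt l)"
  proof -
    have "\<bar>\<integral>x. V ?t x - V ?\<mu> x \<partial>m\<^sub>0\<bar> \<le> (\<integral>x. B * wt l x \<partial>m\<^sub>0)"
      using V_integrable[OF t m0] V_integrable[OF \<mu> m0] wt_integrable(2)[OF l m0] bd
      by (intro order_trans[OF integral_abs_bound] integral_mono) auto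
    then show ?thesis using bd[of "z i"] by (simp add: y_def)
  qed
  \<comment> \<open>The extra factor \<open>y\<close>, which is at least 1, makes both terms
    multiples of \<open>B * y\<close>, that is, of \<open>trunc\<close> divided by
    \<open>sqrt N\<close>.\<close>
  also have "\<dots> \<le> B * y + B * integral\<^sup>L m\<^sub>0 (wt l) * y"
  proof -
    have "0 \<le> B * integral\<^sup>L m\<^sub>0 (wt l)"
      using B by (intro mult_nonneg_nonneg Bochner_Integration.integral_nonneg)
        (auto simp: less_imp_le[OF wt_pos])
    then show ?thesis using wt_ge_1[of l "z i"] mult_left_mono[of 1 y] by (simp add: y_def)
  qed
  also have "\<dots> = rem_const * b * trunc N (z i) / sqrt (real N)"
    by (simp add: B_def rem_const_def c_def \<tau>_def trunc_def y_def power2_eq_square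
        add_divide_distrib algebra_simps)
  finally show ?thesis by (simp add: b_def)
qed

definition sq_const :: real where
  "sq_const = 2 * C\<^sup>2 * (2 + sqrt (moment m\<^sub>0))\<^sup>2"

text \<open>Growth caps the square of \<open>w\<close>, whose expectation is not controlled; the cap
  \<open>1 + moment m\<close> has a computable expectation.\<close>

lemma V_diff_sq_bound:
  assumes m: "m \<in> prob_moment l" and w: "hcost_close l \<alpha> w m\<^sub>0 m"
  shows "(V m x - V m\<^sub>0 x)\<^sup>2 \<le> sq_const * (wt l x)\<^sup>2 * min (w\<^sup>2) (1 + moment m)"
proof -
  let ?a = "2 + sqrt (moment m\<^sub>0)"
  have a: "1 \<le> ?a\<^sup>2" "0 \<le> ?a" 
    using moment_nonneg[of m\<^sub>0] power_mono[of 1 ?a 2] by (auto intro: add_nonneg_nonneg)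
  have x: "1 \<le> wt l x" by (rule wt_ge_1)
  have "(V m x - V m\<^sub>0 x)\<^sup>2 \<le> (C * wt l x * w)\<^sup>2"
    using V_close[OF m0 m w, of x] by (metis abs_ge_zero power2_abs power_mono)
  also have "\<dots> = C\<^sup>2 * (wt l x)\<^sup>2 * w\<^sup>2" by (simp add: power_mult_distrib)
  also have "\<dots> \<le> (2 * C\<^sup>2 * ?a\<^sup>2) * (wt l x)\<^sup>2 * w\<^sup>2"
  proof (intro mult_right_mono)
    have "1 \<le> 2 * ?a\<^sup>2" using a(1) by linarith
    then have "C\<^sup>2 * 1 \<le> C\<^sup>2 * (2 * ?a\<^sup>2)" by (intro mult_left_mono) auto
    then show "C\<^sup>2 \<le> 2 * C\<^sup>2 * ?a\<^sup>2" by (simp only: mult_1_right mult.left_commute mult.assoc)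
  qed auto
  finally have 1: "(V m x - V m\<^sub>0 x)\<^sup>2 \<le> sq_const * (wt l x)\<^sup>2 * w\<^sup>2" by (simp add: sq_const_def)
  have "\<bar>V m x - V m\<^sub>0 x\<bar> \<le> \<bar>V m x\<bar> + \<bar>V m\<^sub>0 x\<bar>" by linarith
  also have "\<dots> \<le> C * (wt l x + sqrt (moment m)) + C * (wt l x + sqrt (moment m\<^sub>0))"
    by (intro add_mono V_growth m m0)
  also have "\<dots> = C * (2 * wt l x + sqrt (moment m\<^sub>0) + sqrt (moment m))"
    by (simp add: algebra_simps)
  also have "\<dots> \<le> C * (?a * wt l x * (1 + sqrt (moment m)))"
  proof (intro mult_left_mono C_nonneg)
    have "1 * sqrt (moment m\<^sub>0) \<le> wt l x * sqrt (moment m\<^sub>0)"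
      using x moment_nonneg by (intro mult_right_mono) auto
    moreover have "1 * 1 * sqrt (moment m) \<le> ?a * wt l x * sqrt (moment m)"
      using x moment_nonneg by (intro mult_right_mono mult_mono) auto
    ultimately show "2 * wt l x + sqrt (moment m\<^sub>0) + sqrt (moment m)
        \<le> ?a * wt l x * (1 + sqrt (moment m))"
      by (simp add: algebra_simps)
  qed
  finally have "(V m x - V m\<^sub>0 x)\<^sup>2 \<le> (C * (?a * wt l x * (1 + sqrt (moment m))))\<^sup>2"
    by (metis abs_ge_zero power2_abs power_mono)
  also have "\<dots> = C\<^sup>2 * ?a\<^sup>2 * (wt l x)\<^sup>2 * (1 + sqrt (moment m))\<^sup>2"
    by (simp add: power_mult_distrib)
  also have "\<dots> \<le> C\<^sup>2 * ?a\<^sup>2 * (wt l x)\<^sup>2 * (2 * (1 + moment m))"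
  proof (intro mult_left_mono)
    have "2 * sqrt (moment m) \<le> 1 + moment m"
      using sum_squares_bound[of 1 "sqrt (moment m)"] moment_nonneg[of m] by simp
    then show "(1 + sqrt (moment m))\<^sup>2 \<le> 2 * (1 + moment m)"
      using moment_nonneg[of m] by (simp add: power2_sum)
  qed auto
  finally have 2: "(V m x - V m\<^sub>0 x)\<^sup>2 \<le> sq_const * (wt l x)\<^sup>2 * (1 + moment m)"
    by (simp add: sq_const_def algebra_simps)
  from 1 2 show ?thesis by (auto simp: min_def)
qed

end

section \<open>Martingale sums along an i.i.d. sequence\<close>

locale iid_sequence = prob_space M for M :: "'w measure" +
  fixes \<zeta> :: "nat \<Rightarrow> 'w \<Rightarrow> 'a::euclidean_space" and m\<^sub>0 :: "'a measure"
  assumes indep: "indep_vars (\<lambda>_. borel) \<zeta> UNIV"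
    and distr_eq: "\<And>i. distr M borel (\<zeta> i) = m\<^sub>0"
begin

abbreviation path :: "'w \<Rightarrow> nat \<Rightarrow> 'a" where
  "path \<omega> \<equiv> \<lambda>i. \<zeta> i \<omega>"

abbreviation hist :: "nat \<Rightarrow> 'w \<Rightarrow> nat \<Rightarrow> 'a" where
  "hist i \<omega> \<equiv> restrict (path \<omega>) {..<i}"

abbreviation hist_space :: "nat \<Rightarrow> (nat \<Rightarrow> 'a) measure" where
  "hist_space i \<equiv> \<Pi>\<^sub>M j\<in>{..<i}. borel"

lemma rv [measurable]: "\<zeta> i \<in> M \<rightarrow>\<^sub>M borel"
  using indep by (auto simp: indep_vars_def)

lemma sets_law [measurable_cong]: "sets m\<^sub>0 = sets borel"
  using distr_eq[of 0] by (metis sets_distr)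

lemma prob_space_law: "prob_space m\<^sub>0"
  using distr_eq[of 0] prob_space_distr[OF rv[of 0]] by simp

lemma hist_measurable [measurable]: "hist i \<in> M \<rightarrow>\<^sub>M hist_space i"
  by (rule measurable_restrict) simp

text \<open>Independence is available for restrictions of the path to disjoint index sets.
  Evaluation at \<open>i\<close> then converts the restriction to \<open>{i}\<close> into the point
  itself.\<close>

lemma distr_hist: "distr M (hist_space i \<Otimes>\<^sub>M borel) (\<lambda>\<omega>. (hist i \<omega>, \<zeta> i \<omega>))
    = distr M (hist_space i) (hist i) \<Otimes>\<^sub>M m\<^sub>0"
proof -
  let ?T = "\<Pi>\<^sub>M j\<in>{i}. borel" and ?Y = "\<lambda>\<omega>. restrict (path \<omega>) {i}"
  let ?A = "distr M (hist_space i) (hist i)"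
  have Y[measurable]: "?Y \<in> M \<rightarrow>\<^sub>M ?T"
    by (rule measurable_restrict) simp
  have [measurable]: "(\<lambda>f. f i) \<in> ?T \<rightarrow>\<^sub>M borel"
    by (rule measurable_component_singleton) simp
  have "distr (distr M ?T ?Y) borel (\<lambda>f. f i) = distr M borel ((\<lambda>f. f i) \<circ> ?Y)"
    by (rule distr_distr) measurable
  then have law: "distr (distr M ?T ?Y) borel (\<lambda>f. f i) = m\<^sub>0"
    by (simp add: comp_def distr_eq)
  have "indep_var (hist_space i) (hist i) ?T ?Y"
    by (rule indep_var_restrict[OF indep]) auto
  then have joint: "?A \<Otimes>\<^sub>M distr M ?T ?Y = distr M (hist_space i \<Otimes>\<^sub>M ?T) (\<lambda>\<omega>. (hist i \<omega>, ?Y \<omega>))"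
    by (simp add: indep_var_distribution_eq)
  have "?A \<Otimes>\<^sub>M m\<^sub>0
      = distr ?A (hist_space i) (\<lambda>z. z) \<Otimes>\<^sub>M distr (distr M ?T ?Y) borel (\<lambda>f. f i)"
    unfolding law by (subst distr_id2) simp_all
  also have "\<dots> = distr (?A \<Otimes>\<^sub>M distr M ?T ?Y) (hist_space i \<Otimes>\<^sub>M borel) (\<lambda>(z, f). (z, f i))"
    by (rule pair_measure_distr)
      (simp_all add: law prob_space_imp_sigma_finite[OF prob_space_law])
  also have "\<dots> = distr M (hist_space i \<Otimes>\<^sub>M borel) ((\<lambda>(z, f). (z, f i)) \<circ> (\<lambda>\<omega>. (hist i \<omega>, ?Y \<omega>)))"
    unfolding joint by (rule distr_distr) measurable
  finally show ?thesis
    by (simp add: comp_def)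
qed

text \<open>Conditioning on the first \<open>i\<close> points in the form of Fubini's theorem: the
  next point is integrated out under its law with the past frozen.\<close>

lemma nn_integral_hist:
  assumes [measurable]: "(\<lambda>(z, x). F z x) \<in> borel_measurable (hist_space i \<Otimes>\<^sub>M borel)"
  shows "(\<integral>\<^sup>+\<omega>. F (hist i \<omega>) (\<zeta> i \<omega>) \<partial>M) = (\<integral>\<^sup>+\<omega>. \<integral>\<^sup>+x. F (hist i \<omega>) x \<partial>m\<^sub>0 \<partial>M)"
proof -
  interpret law: prob_space m\<^sub>0 by (rule prob_space_law)
  have "(\<integral>\<^sup>+\<omega>. F (hist i \<omega>) (\<zeta> i \<omega>) \<partial>M)
      = (\<integral>\<^sup>+p. (case p of (z, x) \<Rightarrow> F z x) \<partial>distr M (hist_space i \<Otimes>\<^sub>M borel) (\<lambda>\<omega>. (hist i \<omega>, \<zeta> i \<omega>)))"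
    by (subst nn_integral_distr) simp_all
  also have "\<dots> = (\<integral>\<^sup>+z. \<integral>\<^sup>+x. F z x \<partial>m\<^sub>0 \<partial>distr M (hist_space i) (hist i))"
    unfolding distr_hist by (subst law.nn_integral_fst[symmetric]) simp_all
  also have "\<dots> = (\<integral>\<^sup>+\<omega>. \<integral>\<^sup>+x. F (hist i \<omega>) x \<partial>m\<^sub>0 \<partial>M)"
    by (subst nn_integral_distr) simp_all
  finally show ?thesis .
qed

lemma integral_hist:
  fixes F :: "(nat \<Rightarrow> 'a) \<Rightarrow> 'a \<Rightarrow> real"
  assumes [measurable]: "(\<lambda>(z, x). F z x) \<in> borel_measurable (hist_space i \<Otimes>\<^sub>M borel)"
    and int: "integrable M (\<lambda>\<omega>. F (hist i \<omega>) (\<zeta> i \<omega>))"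
  shows "(\<integral>\<omega>. F (hist i \<omega>) (\<zeta> i \<omega>) \<partial>M) = (\<integral>\<omega>. \<integral>x. F (hist i \<omega>) x \<partial>m\<^sub>0 \<partial>M)"
proof -
  interpret law: prob_space m\<^sub>0 by (rule prob_space_law)
  interpret h: prob_space "distr M (hist_space i) (hist i)"
    by (rule prob_space_distr) simp
  interpret pair_prob_space "distr M (hist_space i) (hist i)" m\<^sub>0 ..
  have "integrable (distr M (hist_space i \<Otimes>\<^sub>M borel) (\<lambda>\<omega>. (hist i \<omega>, \<zeta> i \<omega>))) (\<lambda>(z, x). F z x)"
    using int by (subst integrable_distr_eq) (simp_all add: split_beta')
  then have i: "integrable (distr M (hist_space i) (hist i) \<Otimes>\<^sub>M m\<^sub>0) (\<lambda>(z, x). F z x)"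
    unfolding distr_hist .
  have "(\<integral>\<omega>. F (hist i \<omega>) (\<zeta> i \<omega>) \<partial>M)
      = (\<integral>p. (case p of (z, x) \<Rightarrow> F z x) \<partial>distr M (hist_space i \<Otimes>\<^sub>M borel) (\<lambda>\<omega>. (hist i \<omega>, \<zeta> i \<omega>)))"
    by (subst integral_distr) simp_all
  also have "\<dots> = (\<integral>z. \<integral>x. F z x \<partial>m\<^sub>0 \<partial>distr M (hist_space i) (hist i))"
    unfolding distr_hist using integral_fst'[OF i] by simp
  also have "\<dots> = (\<integral>\<omega>. \<integral>x. F (hist i \<omega>) x \<partial>m\<^sub>0 \<partial>M)"
    by (subst integral_distr) simp_all
  finally show ?thesis .
qed

lemma integrable_iid_iff:
  fixes \<phi> :: "'a \<Rightarrow> real"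
  assumes "\<phi> \<in> borel_measurable borel"
  shows "integrable M (\<lambda>\<omega>. \<phi> (\<zeta> i \<omega>)) \<longleftrightarrow> integrable m\<^sub>0 \<phi>"
  using integrable_distr_eq[OF rv[of i] assms] by (simp add: distr_eq)

lemma expectation_iid:
  fixes \<phi> :: "'a \<Rightarrow> real"
  assumes "\<phi> \<in> borel_measurable borel"
  shows "(\<integral>\<omega>. \<phi> (\<zeta> i \<omega>) \<partial>M) = integral\<^sup>L m\<^sub>0 \<phi>"
  using integral_distr[OF rv[of i] assms] by (simp add: distr_eq)

text \<open>Orthogonality of martingale differences. Stating it with
  \<open>has_bochner_integral\<close> carries integrability of the squared partial sum through the
  induction, where it is needed for the mixed term.\<close>

lemma expectation_martingale_sum_sq:
  fixes g :: "nat \<Rightarrow> (nat \<Rightarrow> 'a) \<Rightarrow> 'a \<Rightarrow> real"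
  assumes meas: "\<And>i. i < n \<Longrightarrow> (\<lambda>(z, x). g i z x) \<in> borel_measurable (hist_space i \<Otimes>\<^sub>M borel)"
    and adapted: "\<And>i z x. i < n \<Longrightarrow> g i (restrict z {..<i}) x = g i z x"
    and mean: "\<And>i z. i < n \<Longrightarrow> (\<integral>x. g i z x \<partial>m\<^sub>0) = 0"
    and sq: "\<And>i. i < n \<Longrightarrow> integrable M (\<lambda>\<omega>. (g i (path \<omega>) (\<zeta> i \<omega>))\<^sup>2)"
    and "k \<le> n"
  shows "has_bochner_integral M (\<lambda>\<omega>. (\<Sum>i<k. g i (path \<omega>) (\<zeta> i \<omega>))\<^sup>2)
    (\<Sum>i<k. \<integral>\<omega>. (g i (path \<omega>) (\<zeta> i \<omega>))\<^sup>2 \<partial>M)"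
  using \<open>k \<le> n\<close>
proof (induction k)
  case 0
  then show ?case by (simp add: has_bochner_integral_zero)
next
  case (Suc k)
  then have k: "k < n" by simp
  let ?s = "\<lambda>z. \<Sum>i<k. g i z (z i)"
  let ?S = "\<lambda>\<omega>. \<Sum>i<k. g i (path \<omega>) (\<zeta> i \<omega>)" and ?X = "\<lambda>\<omega>. g k (path \<omega>) (\<zeta> k \<omega>)"
  have summand: "(\<lambda>z. g i z (z i)) \<in> borel_measurable (hist_space k)" if "i < k" for i
  proof -
    have "(\<lambda>z. (restrict z {..<i}, z i)) \<in> hist_space k \<rightarrow>\<^sub>M hist_space i \<Otimes>\<^sub>M borel"
      using that by (intro measurable_Pair measurable_restrict_subset measurable_component_singleton) auto
    from measurable_compose[OF this meas[of i]] adapted[of i] show ?thesis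
      using that k by simp
  qed
  have s[measurable]: "?s \<in> borel_measurable (hist_space k)"
    using summand by simp
  note [measurable] = meas[OF k]
  have s_hist: "?s (hist k \<omega>) = ?S \<omega>" for \<omega>
  proof (intro sum.cong refl)
    fix i assume i: "i \<in> {..<k}"
    have "i < n" using i k by simp
    note ad = adapted[OF this]
    have 1: "g i (restrict (hist k \<omega>) {..<i}) (\<zeta> i \<omega>) = g i (hist k \<omega>) (\<zeta> i \<omega>)"
      "g i (hist i \<omega>) (\<zeta> i \<omega>) = g i (path \<omega>) (\<zeta> i \<omega>)"
      by (rule ad)+
    have 2: "restrict (hist k \<omega>) {..<i} = hist i \<omega>" using i by (auto simp: fun_eq_iff)
    have 3: "hist k \<omega> i = \<zeta> i \<omega>" using i by simp
    show "g i (hist k \<omega>) (hist k \<omega> i) = g i (path \<omega>) (\<zeta> i \<omega>)"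
      by (simp only: 3) (simp only: 1[symmetric] 2)
  qed
  have X_hist: "g k (hist k \<omega>) x = g k (path \<omega>) x" for \<omega> x
    by (rule adapted[OF k])
  have [measurable]: "?S \<in> borel_measurable M"
    unfolding s_hist[symmetric] by (rule measurable_compose[OF hist_measurable s])
  have [measurable]: "?X \<in> borel_measurable M"
    unfolding X_hist[symmetric]
    using measurable_compose[OF measurable_Pair[OF hist_measurable rv] meas[OF k]] by simp
  have S2: "has_bochner_integral M (\<lambda>\<omega>. (?S \<omega>)\<^sup>2) (\<Sum>i<k. \<integral>\<omega>. (g i (path \<omega>) (\<zeta> i \<omega>))\<^sup>2 \<partial>M)"
    using Suc by simp
  have SX: "integrable M (\<lambda>\<omega>. ?S \<omega> * ?X \<omega>)"
  proof (rule Bochner_Integration.integrable_bound)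
    show "integrable M (\<lambda>\<omega>. (?S \<omega>)\<^sup>2 + (?X \<omega>)\<^sup>2)"
      using S2 sq[OF k] by (intro Bochner_Integration.integrable_add) (auto simp: has_bochner_integral_iff)
    show "AE \<omega> in M. norm (?S \<omega> * ?X \<omega>) \<le> norm ((?S \<omega>)\<^sup>2 + (?X \<omega>)\<^sup>2)"
    proof (rule AE_I2)
      fix \<omega>
      have "2 * (\<bar>?S \<omega>\<bar> * \<bar>?X \<omega>\<bar>) \<le> (?S \<omega>)\<^sup>2 + (?X \<omega>)\<^sup>2"
        using sum_squares_bound[of "\<bar>?S \<omega>\<bar>" "\<bar>?X \<omega>\<bar>"] by simp
      moreover have "0 \<le> \<bar>?S \<omega>\<bar> * \<bar>?X \<omega>\<bar>" by simp
      ultimately have "\<bar>?S \<omega>\<bar> * \<bar>?X \<omega>\<bar> \<le> (?S \<omega>)\<^sup>2 + (?X \<omega>)\<^sup>2" by linarith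
      then show "norm (?S \<omega> * ?X \<omega>) \<le> norm ((?S \<omega>)\<^sup>2 + (?X \<omega>)\<^sup>2)" by (simp add: abs_mult)
    qed
  qed simp
  \<comment> \<open>The partial sum is a function of the first \<open>k\<close> points, so
    integrating out the new point first annihilates the mixed term.\<close>
  have "(\<integral>\<omega>. ?S \<omega> * ?X \<omega> \<partial>M) = (\<integral>\<omega>. ?s (hist k \<omega>) * g k (hist k \<omega>) (\<zeta> k \<omega>) \<partial>M)"
    by (simp only: s_hist X_hist)
  also have "\<dots> = (\<integral>\<omega>. \<integral>x. ?s (hist k \<omega>) * g k (hist k \<omega>) x \<partial>m\<^sub>0 \<partial>M)"
    by (rule integral_hist[of "\<lambda>z x. ?s z * g k z x"]) (use SX in \<open>simp_all only: s_hist X_hist, measurable\<close>)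
  also have "\<dots> = 0"
    using mean[OF k] by simp
  finally have "has_bochner_integral M (\<lambda>\<omega>. (?S \<omega>)\<^sup>2 + 2 * (?S \<omega> * ?X \<omega>) + (?X \<omega>)\<^sup>2)
      ((\<Sum>i<k. \<integral>\<omega>. (g i (path \<omega>) (\<zeta> i \<omega>))\<^sup>2 \<partial>M) + 2 * 0 + (\<integral>\<omega>. (?X \<omega>)\<^sup>2 \<partial>M))"
    using S2 SX sq[OF k]
    by (intro has_bochner_integral_add has_bochner_integral_mult_right) (auto simp: has_bochner_integral_iff)
  then show ?case
    by (simp add: power2_sum algebra_simps)
qed

end

text \<open>From \<open>2 * v * |X|\<close> being at most the sum of the squares of \<open>v\<close>
  and \<open>X\<close>; this yields integrability and the bound at once.\<close>

lemma (in prob_space) expectation_abs_le_sqrt: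
  fixes X :: "'a \<Rightarrow> real"
  assumes [measurable]: "X \<in> borel_measurable M" and X2: "integrable M (\<lambda>\<omega>. (X \<omega>)\<^sup>2)"
    and v: "(\<integral>\<omega>. (X \<omega>)\<^sup>2 \<partial>M) \<le> v\<^sup>2" "0 < v"
  shows "integrable M X" "(\<integral>\<omega>. \<bar>X \<omega>\<bar> \<partial>M) \<le> v"
proof -
  have le: "\<bar>X \<omega>\<bar> \<le> (v + (X \<omega>)\<^sup>2 / v) / 2" for \<omega>
  proof -
    have "2 * (v * \<bar>X \<omega>\<bar>) \<le> v * v + (X \<omega>)\<^sup>2"
      using sum_squares_bound[of v "\<bar>X \<omega>\<bar>"] by (simp add: power2_eq_square)
    then show ?thesis using v by (simp add: field_simps power2_eq_square)
  qed
  have i: "integrable M (\<lambda>\<omega>. (v + (X \<omega>)\<^sup>2 / v) / 2)" using X2 by simp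
  show X: "integrable M X"
    by (rule Bochner_Integration.integrable_bound[OF i]) (use le order_trans[OF le abs_ge_self] in auto)
  have "(\<integral>\<omega>. \<bar>X \<omega>\<bar> \<partial>M) \<le> (\<integral>\<omega>. (v + (X \<omega>)\<^sup>2 / v) / 2 \<partial>M)"
    using X i le by (intro integral_mono) auto
  also have "\<dots> = (v + (\<integral>\<omega>. (X \<omega>)\<^sup>2 \<partial>M) / v) / 2"
    using X2 by (simp add: prob_space)
  also have "\<dots> \<le> (v + v\<^sup>2 / v) / 2"
    using v by (intro divide_right_mono add_left_mono) auto
  finally show "(\<integral>\<omega>. \<bar>X \<omega>\<bar> \<partial>M) \<le> v" using v by (simp add: power2_eq_square)
qed

section \<open>Linearisation along an i.i.d. sample\<close>

locale hoelder_iid = hoelder_functional l \<alpha> C m\<^sub>0 U V + iid_sequence M \<zeta> m\<^sub>0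
  for l \<alpha> C :: real and m\<^sub>0 :: "'a::euclidean_space measure"
    and U :: "'a measure \<Rightarrow> real" and V :: "'a measure \<Rightarrow> 'a \<Rightarrow> real"
    and M :: "'w measure" and \<zeta> :: "nat \<Rightarrow> 'w \<Rightarrow> 'a"
begin

sublocale law: prob_space m\<^sub>0
  by (rule prob_m0)

lemma emp_hist: "i \<le> k \<Longrightarrow> emp N i (hist k \<omega>) = emp N i (path \<omega>)"
  by (rule partial_empirical_cong) simp

lemma expectation_integral_emp:
  fixes \<phi> :: "'a \<Rightarrow> real"
  assumes N: "0 < N" "i \<le> N" and \<phi>: "\<phi> \<in> borel_measurable borel" "integrable m\<^sub>0 \<phi>"
  shows "has_bochner_integral M (\<lambda>\<omega>. integral\<^sup>L (emp N i (path \<omega>)) \<phi>) (integral\<^sup>L m\<^sub>0 \<phi>)"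
proof -
  have "integrable M (\<lambda>\<omega>. \<phi> (\<zeta> j \<omega>))" for j
    using integrable_iid_iff \<phi> by simp
  then show ?thesis
    using expectation_iid[OF \<phi>(1)] by (simp add: integral_emp[OF N \<phi>] has_bochner_integral_iff prob_space)
qed

text \<open>The quantisation error under the random measure has the same mean as under
  \<open>m\<^sub>0\<close>. Each cell frequency is an average of centred independent terms with
  variance at most 1, which gives \<open>1 / sqrt N\<close>. For fixed \<open>q\<close> there are
  finitely many cells, so only the quantisation error survives in the limit.\<close>

lemma expectation_quantised_dist:
  fixes q :: "'a \<Rightarrow> 'a"
  assumes N: "0 < N" "i \<le> N" and q: "simple_function borel q" "\<And>y. norm (q y) \<le> 2 * norm y"
  shows "integrable M (\<lambda>\<omega>. quantised_dist q m\<^sub>0 (emp N i (path \<omega>)))"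
    and "(\<integral>\<omega>. quantised_dist q m\<^sub>0 (emp N i (path \<omega>)) \<partial>M) \<le>
      2 * (\<integral>y. hcost l \<alpha> y (q y) \<partial>m\<^sub>0) + (\<Sum>f\<in>range q. hcost l \<alpha> f 0) / sqrt (real N)"
proof -
  have fin: "finite (range q)" using q(1) by (simp add: simple_function_def)
  have qm[measurable]: "q \<in> borel_measurable borel"
    by (rule borel_measurable_simple_function[OF q(1)])
  let ?c = "\<lambda>y. hcost l \<alpha> y (q y)"
  have c: "has_bochner_integral M (\<lambda>\<omega>. integral\<^sup>L (emp N i (path \<omega>)) ?c) (integral\<^sup>L m\<^sub>0 ?c)"
    using integrable_hcost_map[OF m0 qm q(2)] by (intro expectation_integral_emp N) measurable
  define d where "d f \<omega> = \<bar>(\<integral>y. of_bool (q y = f) \<partial>emp N i (path \<omega>)) - (\<integral>y. of_bool (q y = f) \<partial>m\<^sub>0) :: real\<bar>"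
    for f \<omega>
  have d: "integrable M (d f)" "(\<integral>\<omega>. d f \<omega> \<partial>M) \<le> 1 / sqrt (real N)" for f
  proof -
    define h :: "'a \<Rightarrow> real" where "h y = of_bool (q y = f)" for y
    define p where "p = integral\<^sup>L m\<^sub>0 h"
    have h[measurable]: "h \<in> borel_measurable borel" unfolding h_def by measurable
    have hi: "integrable m\<^sub>0 h"
      by (rule law.integrable_const_bound[of _ 1]) (auto simp: h_def)
    have p: "0 \<le> p" "p \<le> 1"
      using hi law.prob_space by (auto simp: p_def h_def intro!: Bochner_Integration.integral_nonneg law.integral_le_const)
    have le1: "(h y - p)\<^sup>2 \<le> 1" for y
      using p by (intro abs_square_le_1[THEN iffD2]) (auto simp: h_def)
    let ?S = "\<lambda>\<omega>. \<Sum>j<i. h (\<zeta> j \<omega>) - p"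
    have sqi: "integrable M (\<lambda>\<omega>. (h (\<zeta> j \<omega>) - p)\<^sup>2)" for j
      using le1 by (intro integrable_const_bound[of _ 1]) auto
    have S2: "has_bochner_integral M (\<lambda>\<omega>. (?S \<omega>)\<^sup>2) (\<Sum>j<i. \<integral>\<omega>. (h (\<zeta> j \<omega>) - p)\<^sup>2 \<partial>M)"
      using sqi hi law.prob_space
      by (intro expectation_martingale_sum_sq[where n=i and g="\<lambda>_ _ x. h x - p"]) (auto simp: p_def)
    have "(\<Sum>j<i. \<integral>\<omega>. (h (\<zeta> j \<omega>) - p)\<^sup>2 \<partial>M) \<le> (\<Sum>j<i. 1)"
      using sqi le1 by (intro sum_mono integral_le_const) auto
    also have "\<dots> \<le> (sqrt (real N))\<^sup>2" using N by simp
    finally have v: "(\<integral>\<omega>. (?S \<omega>)\<^sup>2 \<partial>M) \<le> (sqrt (real N))\<^sup>2"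
      using S2 by (simp add: has_bochner_integral_iff)
    have S: "integrable M ?S" "(\<integral>\<omega>. \<bar>?S \<omega>\<bar> \<partial>M) \<le> sqrt (real N)"
      using expectation_abs_le_sqrt[OF _ _ v] S2 N by (auto simp: has_bochner_integral_iff)
    have deq: "d f = (\<lambda>\<omega>. \<bar>?S \<omega>\<bar> / real N)"
    proof
      fix \<omega>
      have "d f \<omega> = \<bar>integral\<^sup>L (emp N i (path \<omega>)) h - p\<bar>"
        by (simp add: d_def p_def h_def[abs_def])
      also have "integral\<^sup>L (emp N i (path \<omega>)) h = p + ?S \<omega> / real N"
        unfolding p_def by (rule integral_emp[OF N h hi])
      finally show "d f \<omega> = \<bar>?S \<omega>\<bar> / real N" by (simp add: abs_divide)
    qed
    show "integrable M (d f)" unfolding deq using S by simp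
    have "(\<integral>\<omega>. d f \<omega> \<partial>M) = (\<integral>\<omega>. \<bar>?S \<omega>\<bar> \<partial>M) / real N" by (simp add: deq)
    also have "\<dots> \<le> sqrt (real N) / real N" using S by (intro divide_right_mono) auto
    also have "\<dots> = 1 / sqrt (real N)" using N by (simp add: field_simps)
    finally show "(\<integral>\<omega>. d f \<omega> \<partial>M) \<le> 1 / sqrt (real N)" .
  qed
  have eq: "quantised_dist q m\<^sub>0 (emp N i (path \<omega>))
      = integral\<^sup>L (emp N i (path \<omega>)) ?c + integral\<^sup>L m\<^sub>0 ?c + (\<Sum>f\<in>range q. hcost l \<alpha> f 0 * d f \<omega>)" for \<omega>
    by (simp add: quantised_dist_def d_def)
  show "integrable M (\<lambda>\<omega>. quantised_dist q m\<^sub>0 (emp N i (path \<omega>)))"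
    unfolding eq using c d(1) by (auto simp: has_bochner_integral_iff)
  have "(\<integral>\<omega>. quantised_dist q m\<^sub>0 (emp N i (path \<omega>)) \<partial>M)
      = 2 * integral\<^sup>L m\<^sub>0 ?c + (\<Sum>f\<in>range q. hcost l \<alpha> f 0 * (\<integral>\<omega>. d f \<omega> \<partial>M))"
    unfolding eq using c d(1) by (simp add: has_bochner_integral_iff prob_space)
  also have "\<dots> \<le> 2 * integral\<^sup>L m\<^sub>0 ?c + (\<Sum>f\<in>range q. hcost l \<alpha> f 0 * (1 / sqrt (real N)))"
    using d(2) by (intro add_left_mono sum_mono mult_left_mono) auto
  finally show "(\<integral>\<omega>. quantised_dist q m\<^sub>0 (emp N i (path \<omega>)) \<partial>M)
      \<le> 2 * integral\<^sup>L m\<^sub>0 ?c + (\<Sum>f\<in>range q. hcost l \<alpha> f 0) / sqrt (real N)"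
    by (simp add: sum_divide_distrib)
qed

section \<open>The martingale part: derivative at the interpolating measure against derivative at
  the law\<close>

definition drift :: "nat \<Rightarrow> nat \<Rightarrow> (nat \<Rightarrow> 'a) \<Rightarrow> 'a \<Rightarrow> real" where
  "drift N i z x = lin (emp N i z) x - lin m\<^sub>0 x"

lemma V_emp_hist_measurable [measurable]:
  assumes "0 < N" "i \<le> N"
  shows "(\<lambda>(z, x). V (emp N i z) x) \<in> borel_measurable (hist_space i \<Otimes>\<^sub>M borel)"
proof -
  have "(\<lambda>p. V (emp N i (\<lambda>j. fst p j)) (snd p)) \<in> borel_measurable (hist_space i \<Otimes>\<^sub>M borel)"
    by (rule V_emp_measurable[OF assms])
      (auto intro: measurable_compose[OF measurable_fst measurable_component_singleton])
  then show ?thesis by (simp add: split_beta')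
qed

lemma lin_emp_hist_measurable:
  assumes N: "0 < N" "i \<le> N"
  shows "(\<lambda>(z, x). lin (emp N i z) x) \<in> borel_measurable (hist_space i \<Otimes>\<^sub>M borel)"
proof -
  note [measurable] = V_emp_hist_measurable[OF N]
  have [measurable]: "(\<lambda>z. integral\<^sup>L m\<^sub>0 (V (emp N i z))) \<in> borel_measurable (hist_space i)"
    by (rule law.borel_measurable_lebesgue_integral) measurable
  show ?thesis by measurable
qed

lemma drift_measurable:
  assumes N: "0 < N" "i \<le> N"
  shows "(\<lambda>(z, x). drift N i z x) \<in> borel_measurable (hist_space i \<Otimes>\<^sub>M borel)"
proof -
  note [measurable] = lin_emp_hist_measurable[OF N] V_measurable[OF m0]
  show ?thesis unfolding drift_def by measurable
qed

lemma drift_mean: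
  assumes N: "0 < N" "i \<le> N"
  shows "(\<integral>x. drift N i z x \<partial>m\<^sub>0) = 0"
  unfolding drift_def
  using V_integrable[OF emp_in[OF N] m0] V_integrable[OF m0 m0] by (simp add: law.prob_space)

text \<open>The drift is the centred version of a difference of derivatives, so its variance is at
  most the second moment of that difference. Truncation at \<open>s\<close> makes the bound linear
  in the quantised distance.\<close>

lemma drift_variance_bound:
  fixes q :: "'a \<Rightarrow> 'a"
  assumes N: "0 < N" "i \<le> N" and q: "simple_function borel q" "\<And>y. norm (q y) \<le> 2 * norm y"
    and s: "0 \<le> s"
  shows "(\<integral>\<^sup>+x. ennreal ((drift N i z x)\<^sup>2) \<partial>m\<^sub>0) \<le> ennreal (sq_const * (\<integral>x. (wt l x)\<^sup>2 \<partial>m\<^sub>0) *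
    (s * quantised_dist q m\<^sub>0 (emp N i z) + (\<integral>y. max 0 (1 + npow l y - s\<^sup>2) \<partial>emp N i z)))"
proof -
  let ?m = "emp N i z"
  let ?W = "quantised_dist q m\<^sub>0 ?m"
  have m: "?m \<in> prob_moment l" by (rule emp_in[OF N])
  note pm = prob_momentD[OF m]
  have close: "hcost_close l \<alpha> ?W m\<^sub>0 ?m" by (rule hcost_close_quantised[OF m0 m q])
  have W: "0 \<le> ?W" by (rule hcost_close_nonneg[OF close])
  define B where "B = s * ?W + (\<integral>y. max 0 (1 + npow l y - s\<^sup>2) \<partial>?m)"
  \<comment> \<open>Jensen's inequality: with the positive part inside the integral the bound is
    linear in the random measure, and its expectation is the same integral under
    \<open>m\<^sub>0\<close>.\<close>
  have tail: "max 0 (1 + moment ?m - s\<^sup>2) \<le> (\<integral>y. max 0 (1 + npow l y - s\<^sup>2) \<partial>?m)"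
  proof -
    interpret emp: prob_space ?m by (rule pm)
    have "(\<integral>y. 1 + npow l y - s\<^sup>2 \<partial>?m) \<le> (\<integral>y. max 0 (1 + npow l y - s\<^sup>2) \<partial>?m)"
      using pm(4) by (intro integral_mono) auto
    moreover have "(\<integral>y. 1 + npow l y - s\<^sup>2 \<partial>?m) = 1 + moment ?m - s\<^sup>2"
      using pm(4) by (simp add: emp.prob_space)
    moreover have "0 \<le> (\<integral>y. max 0 (1 + npow l y - s\<^sup>2) \<partial>?m)"
      by (rule Bochner_Integration.integral_nonneg) simp
    ultimately show ?thesis by simp
  qed
  define f where "f x = V ?m x - V m\<^sub>0 x" for x
  have fi: "integrable m\<^sub>0 f"
    unfolding f_def using V_integrable[OF m m0] V_integrable[OF m0 m0] by simp
  have wi: "integrable m\<^sub>0 (\<lambda>x. (wt l x)\<^sup>2)" by (rule wt_integrable(1)[OF l m0])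
  have sc: "0 \<le> sq_const" by (simp add: sq_const_def)
  have f2: "(f x)\<^sup>2 \<le> sq_const * B * (wt l x)\<^sup>2" for x
  proof -
    have "(f x)\<^sup>2 \<le> sq_const * (wt l x)\<^sup>2 * min (?W\<^sup>2) (1 + moment ?m)"
      unfolding f_def by (rule V_diff_sq_bound[OF m close])
    also have "\<dots> \<le> sq_const * (wt l x)\<^sup>2 * B"
    proof (intro mult_left_mono)
      show "min (?W\<^sup>2) (1 + moment ?m) \<le> B"
        using min_sq_le_truncation[OF W s, of "1 + moment ?m"] tail unfolding B_def by linarith
    qed (use sc in auto)
    finally show ?thesis by (simp only: ac_simps)
  qed
  have [measurable]: "f \<in> borel_measurable m\<^sub>0" using fi by simp
  have f2i: "integrable m\<^sub>0 (\<lambda>x. (f x)\<^sup>2)"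
  proof (rule Bochner_Integration.integrable_bound)
    show "integrable m\<^sub>0 (\<lambda>x. sq_const * B * (wt l x)\<^sup>2)" using wi by simp
    show "AE x in m\<^sub>0. norm ((f x)\<^sup>2) \<le> norm (sq_const * B * (wt l x)\<^sup>2)"
    proof (rule AE_I2)
      fix x show "norm ((f x)\<^sup>2) \<le> norm (sq_const * B * (wt l x)\<^sup>2)"
        using f2[of x] by simp
    qed
  qed simp
  have d: "drift N i z x = f x - law.expectation f" for x
    using V_integrable[OF m m0] V_integrable[OF m0 m0] unfolding drift_def f_def by simp
  have vi: "integrable m\<^sub>0 (\<lambda>x. (f x - law.expectation f)\<^sup>2)"
    using fi f2i by (simp add: power2_diff)
  have nn: "(\<integral>\<^sup>+x. ennreal ((drift N i z x)\<^sup>2) \<partial>m\<^sub>0) = ennreal (law.variance f)"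
    unfolding d using vi by (intro nn_integral_eq_integral) auto
  have "law.variance f \<le> (\<integral>x. (f x)\<^sup>2 \<partial>m\<^sub>0)"
    using law.variance_eq[OF fi f2i] by simp
  moreover have "(\<integral>x. (f x)\<^sup>2 \<partial>m\<^sub>0) \<le> (\<integral>x. sq_const * B * (wt l x)\<^sup>2 \<partial>m\<^sub>0)"
    using f2 f2i wi by (intro integral_mono) auto
  moreover have "(\<integral>x. sq_const * B * (wt l x)\<^sup>2 \<partial>m\<^sub>0) = sq_const * (\<integral>x. (wt l x)\<^sup>2 \<partial>m\<^sub>0) * B"
    by simp
  ultimately have "law.variance f \<le> sq_const * (\<integral>x. (wt l x)\<^sup>2 \<partial>m\<^sub>0) * B"
    by linarith
  with nn show ?thesis
    unfolding B_def[symmetric] by (simp only: ennreal_leI)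
qed

lemma drift_second_moment:
  fixes q :: "'a \<Rightarrow> 'a"
  assumes N: "i < N" and q: "simple_function borel q" "\<And>y. norm (q y) \<le> 2 * norm y"
    and s: "0 \<le> s"
  shows "integrable M (\<lambda>\<omega>. (drift N i (path \<omega>) (\<zeta> i \<omega>))\<^sup>2)"
    and "(\<integral>\<omega>. (drift N i (path \<omega>) (\<zeta> i \<omega>))\<^sup>2 \<partial>M) \<le> sq_const * (\<integral>x. (wt l x)\<^sup>2 \<partial>m\<^sub>0) *
      (s * (2 * (\<integral>y. hcost l \<alpha> y (q y) \<partial>m\<^sub>0) + (\<Sum>f\<in>range q. hcost l \<alpha> f 0) / sqrt (real N)) +
       (\<integral>y. max 0 (1 + npow l y - s\<^sup>2) \<partial>m\<^sub>0))"
proof -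
  have N': "0 < N" "i \<le> N" using N by auto
  let ?D = "\<lambda>\<omega>. drift N i (path \<omega>) (\<zeta> i \<omega>)"
  let ?K = "sq_const * (\<integral>x. (wt l x)\<^sup>2 \<partial>m\<^sub>0)"
  let ?\<phi> = "\<lambda>y. max 0 (1 + npow l y - s\<^sup>2)"
  let ?W = "\<lambda>\<omega>. quantised_dist q m\<^sub>0 (emp N i (path \<omega>))"
  let ?R = "\<lambda>\<omega>. ?K * (s * ?W \<omega> + integral\<^sup>L (emp N i (path \<omega>)) ?\<phi>)"
  have K: "0 \<le> ?K"
    by (intro mult_nonneg_nonneg Bochner_Integration.integral_nonneg) (auto simp: sq_const_def)
  have \<phi>: "integrable m\<^sub>0 ?\<phi>"
    using prob_momentD(4)[OF m0] by simp
  have W: "integrable M ?W" by (rule expectation_quantised_dist[OF N' q])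
  have E: "has_bochner_integral M (\<lambda>\<omega>. integral\<^sup>L (emp N i (path \<omega>)) ?\<phi>) (integral\<^sup>L m\<^sub>0 ?\<phi>)"
    using \<phi> by (intro expectation_integral_emp N') measurable
  have R: "integrable M ?R"
    using W E by (auto simp: has_bochner_integral_iff)
  have "0 \<le> ?W \<omega>" for \<omega>
    by (rule hcost_close_nonneg[OF hcost_close_quantised[OF m0 emp_in[OF N'] q]])
  then have R0: "0 \<le> ?R \<omega>" for \<omega>
    by (intro mult_nonneg_nonneg[OF K] add_nonneg_nonneg mult_nonneg_nonneg[OF s]
        Bochner_Integration.integral_nonneg) auto
  note [measurable] = drift_measurable[OF N']
  have dh: "drift N i (hist i \<omega>) x = drift N i (path \<omega>) x" for \<omega> x
    by (simp only: drift_def emp_hist[OF order_refl])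
  have "(\<integral>\<^sup>+\<omega>. ennreal ((drift N i (hist i \<omega>) (\<zeta> i \<omega>))\<^sup>2) \<partial>M)
      = (\<integral>\<^sup>+\<omega>. \<integral>\<^sup>+x. ennreal ((drift N i (hist i \<omega>) x)\<^sup>2) \<partial>m\<^sub>0 \<partial>M)"
    by (rule nn_integral_hist) measurable
  also have "\<dots> \<le> (\<integral>\<^sup>+\<omega>. ennreal (?R \<omega>) \<partial>M)"
    unfolding dh by (intro nn_integral_mono drift_variance_bound N' q s)
  also have "\<dots> = ennreal (integral\<^sup>L M ?R)"
    using R R0 by (intro nn_integral_eq_integral) auto
  finally have bd: "(\<integral>\<^sup>+\<omega>. ennreal ((?D \<omega>)\<^sup>2) \<partial>M) \<le> ennreal (integral\<^sup>L M ?R)"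
    unfolding dh .
  have [measurable]: "?D \<in> borel_measurable M"
    unfolding dh[symmetric]
    using measurable_compose[OF measurable_Pair[OF hist_measurable rv] drift_measurable[OF N']] by simp
  show "integrable M (\<lambda>\<omega>. (?D \<omega>)\<^sup>2)"
    using bd by (intro integrableI_bounded) (auto simp: less_top[symmetric] top_unique intro: le_less_trans)
  have "(\<integral>\<omega>. (?D \<omega>)\<^sup>2 \<partial>M) \<le> integral\<^sup>L M ?R"
    using bd R0 by (intro integral_real_bounded Bochner_Integration.integral_nonneg) auto
  also have "\<dots> = ?K * (s * integral\<^sup>L M ?W + integral\<^sup>L m\<^sub>0 ?\<phi>)"
    using W E by (simp add: has_bochner_integral_iff)
  also have "\<dots> \<le> ?K * (s * (2 * (\<integral>y. hcost l \<alpha> y (q y) \<partial>m\<^sub>0) +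
      (\<Sum>f\<in>range q. hcost l \<alpha> f 0) / sqrt (real N)) + integral\<^sup>L m\<^sub>0 ?\<phi>)"
    using expectation_quantised_dist(2)[OF N' q] K s by (intro mult_left_mono add_right_mono) auto
  finally show "(\<integral>\<omega>. (?D \<omega>)\<^sup>2 \<partial>M) \<le> \<dots>" .
qed

lemma tail_tendsto_0: "(\<lambda>n. \<integral>y. max 0 (1 + npow l y - (real n)\<^sup>2) \<partial>m\<^sub>0) \<longlonglongrightarrow> 0"
proof -
  have "(\<lambda>n. \<integral>y. max 0 (1 + npow l y - (real n)\<^sup>2) \<partial>m\<^sub>0) \<longlonglongrightarrow> (\<integral>y. 0 \<partial>m\<^sub>0)"
  proof (rule integral_dominated_convergence)
    show "integrable m\<^sub>0 (\<lambda>y. 1 + npow l y)" using prob_momentD(4)[OF m0] by simp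
    show "AE y in m\<^sub>0. (\<lambda>n. max 0 (1 + npow l y - (real n)\<^sup>2)) \<longlonglongrightarrow> 0"
    proof (rule AE_I2)
      fix y :: 'a
      have "filterlim (\<lambda>n. (real n)\<^sup>2) at_top sequentially"
        by (rule filterlim_pow_at_top[OF _ filterlim_real_sequentially]) simp
      then have "\<forall>\<^sub>F n in sequentially. 1 + npow l y \<le> (real n)\<^sup>2"
        by (simp add: filterlim_at_top)
      then show "(\<lambda>n. max 0 (1 + npow l y - (real n)\<^sup>2)) \<longlonglongrightarrow> 0"
        by (intro tendsto_eventually) (auto elim!: eventually_mono)
    qed
    show "AE y in m\<^sub>0. norm (max 0 (1 + npow l y - (real n)\<^sup>2)) \<le> 1 + npow l y" for n
      by (rule AE_I2) auto
  qed measurable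
  then show ?thesis by simp
qed

lemma inverse_sqrt_tendsto_0: "(\<lambda>N. c / sqrt (real N)) \<longlonglongrightarrow> 0"
  by (intro tendsto_divide_0[OF tendsto_const] filterlim_at_top_imp_at_infinity
      filterlim_compose[OF sqrt_at_top filterlim_real_sequentially])

text \<open>The order of choices matters: first the truncation level \<open>n\<close> makes the tail
  small, then \<open>q\<close> is chosen fine enough to beat the factor \<open>n\<close>, and only
  then does \<open>N\<close> grow, with the number of cells fixed.\<close>

lemma drift_second_moment_small:
  assumes "0 < \<epsilon>"
  shows "\<forall>\<^sub>F N in sequentially. \<forall>i<N. (\<integral>\<omega>. (drift N i (path \<omega>) (\<zeta> i \<omega>))\<^sup>2 \<partial>M) < \<epsilon>"
proof -
  let ?K = "sq_const * (\<integral>x. (wt l x)\<^sup>2 \<partial>m\<^sub>0)"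
  have K: "0 \<le> ?K"
    by (intro mult_nonneg_nonneg Bochner_Integration.integral_nonneg) (auto simp: sq_const_def)
  \<comment> \<open>Tail and quantisation error contribute at most \<open>\<delta>\<close> each; the
    summand 1 covers \<open>?K = 0\<close>.\<close>
  define \<delta> where "\<delta> = \<epsilon> / (3 * (?K + 1))"
  have \<delta>: "0 < \<delta>" using assms K by (simp add: \<delta>_def)
  obtain n where n: "(\<integral>y. max 0 (1 + npow l y - (real n)\<^sup>2) \<partial>m\<^sub>0) < \<delta>"
    using order_tendstoD(2)[OF tail_tendsto_0 \<delta>] by (auto simp: eventually_sequentially)
  obtain q :: "'a \<Rightarrow> 'a" where q: "simple_function borel q" "\<And>y. norm (q y) \<le> 2 * norm y"
    and h: "(\<integral>y. hcost l \<alpha> y (q y) \<partial>m\<^sub>0) < \<delta> / (2 * (real n + 1))"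
    using exists_quantisation[of "\<delta> / (2 * (real n + 1))"] \<delta> by auto
  let ?h = "\<integral>y. hcost l \<alpha> y (q y) \<partial>m\<^sub>0" and ?t = "\<integral>y. max 0 (1 + npow l y - (real n)\<^sup>2) \<partial>m\<^sub>0"
  let ?B = "\<Sum>f\<in>range q. hcost l \<alpha> f 0"
  have h0: "0 \<le> ?h" by (rule Bochner_Integration.integral_nonneg) simp
  have "(\<lambda>N. ?K * (real n * (2 * ?h + ?B / sqrt (real N)) + ?t)) \<longlonglongrightarrow> ?K * (real n * (2 * ?h + 0) + ?t)"
    by (intro tendsto_intros inverse_sqrt_tendsto_0)
  moreover have "?K * (real n * (2 * ?h + 0) + ?t) < \<epsilon>"
  proof -
    have "real n * (2 * ?h) \<le> (real n + 1) * (2 * ?h)"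
      using h0 by (intro mult_right_mono) auto
    also have "\<dots> \<le> \<delta>"
      using h by (simp add: field_simps)
    finally have "?K * (real n * (2 * ?h + 0) + ?t) \<le> ?K * (2 * \<delta>)"
      using n by (intro mult_left_mono K) auto
    also have "\<dots> < 3 * (?K + 1) * \<delta>"
    proof -
      have "0 \<le> ?K * \<delta>" using \<delta> by (intro mult_nonneg_nonneg K) auto
      moreover have "?K * (2 * \<delta>) = 2 * (?K * \<delta>)" "3 * (?K + 1) * \<delta> = 3 * (?K * \<delta>) + 3 * \<delta>"
        by (simp_all only: ring_distribs ac_simps mult_1_left)
      ultimately show ?thesis using \<delta> by linarith
    qed
    also have "\<dots> = \<epsilon>"
      using K by (simp add: \<delta>_def)
    finally show ?thesis .
  qed
  ultimately have "\<forall>\<^sub>F N in sequentially. ?K * (real n * (2 * ?h + ?B / sqrt (real N)) + ?t) < \<epsilon>"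
    by (rule order_tendstoD)
  then show ?thesis
  proof eventually_elim
    case (elim N)
    show ?case
    proof (intro allI impI)
      fix i assume "i < N"
      from drift_second_moment(2)[OF this q, of "real n"] elim
      show "(\<integral>\<omega>. (drift N i (path \<omega>) (\<zeta> i \<omega>))\<^sup>2 \<partial>M) < \<epsilon>" by linarith
    qed
  qed
qed

text \<open>By orthogonality the second moment of the sum is the sum of N uniformly small variances,
  hence of smaller order than N.\<close>

lemma drift_sum:
  shows "integrable M (\<lambda>\<omega>. \<Sum>i<N. drift N i (path \<omega>) (\<zeta> i \<omega>))" (is ?I)
    and "(\<lambda>N. (\<integral>\<omega>. \<bar>\<Sum>i<N. drift N i (path \<omega>) (\<zeta> i \<omega>)\<bar> \<partial>M) / sqrt (real N)) \<longlonglongrightarrow> 0" (is ?L)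
proof -
  let ?T = "\<lambda>N \<omega>. \<Sum>i<N. drift N i (path \<omega>) (\<zeta> i \<omega>)"
  have sqi: "integrable M (\<lambda>\<omega>. (drift N i (path \<omega>) (\<zeta> i \<omega>))\<^sup>2)" if "i < N" for N i
  proof -
    \<comment> \<open>Only integrability is wanted here, so any quantisation and truncation level 0
      will do.\<close>
    obtain q :: "'a \<Rightarrow> 'a" where "simple_function borel q" "\<And>y. norm (q y) \<le> 2 * norm y"
      using exists_quantisation[of 1] by auto
    from drift_second_moment(1)[OF that this order_refl] show ?thesis .
  qed
  have meas: "(\<lambda>\<omega>. drift N i (path \<omega>) (\<zeta> i \<omega>)) \<in> borel_measurable M" if "i < N" for N i
  proof -
    have N: "0 < N" "i \<le> N" using that by auto
    have "(\<lambda>\<omega>. drift N i (hist i \<omega>) (\<zeta> i \<omega>)) \<in> borel_measurable M"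
      using measurable_compose[OF measurable_Pair[OF hist_measurable rv] drift_measurable[OF N]] by simp
    then show ?thesis by (simp only: drift_def emp_hist[OF order_refl])
  qed
  have mT: "?T N \<in> borel_measurable M" for N
    using meas by (intro borel_measurable_sum) auto
  have T2: "has_bochner_integral M (\<lambda>\<omega>. (?T N \<omega>)\<^sup>2)
      (\<Sum>i<N. \<integral>\<omega>. (drift N i (path \<omega>) (\<zeta> i \<omega>))\<^sup>2 \<partial>M)" for N
  proof (rule expectation_martingale_sum_sq[where n=N])
    show "drift N i (restrict z {..<i}) x = drift N i z x" for i z x
      unfolding drift_def by (simp only: partial_empirical_cong[of i "restrict z {..<i}" z] restrict_apply
          lessThan_iff if_True)
    show "(\<lambda>(z, x). drift N i z x) \<in> borel_measurable (hist_space i \<Otimes>\<^sub>M borel)" if "i < N" for i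
      using that by (intro drift_measurable) auto
    show "(\<integral>x. drift N i z x \<partial>m\<^sub>0) = 0" if "i < N" for i z
      using that by (intro drift_mean) auto
  qed (use sqi in auto)
  show ?I
  proof -
    define v where "v = sqrt (1 + (\<integral>\<omega>. (?T N \<omega>)\<^sup>2 \<partial>M))"
    have nn: "0 \<le> (\<integral>\<omega>. (?T N \<omega>)\<^sup>2 \<partial>M)" by (rule Bochner_Integration.integral_nonneg) simp
    then have "(\<integral>\<omega>. (?T N \<omega>)\<^sup>2 \<partial>M) \<le> v\<^sup>2" "0 < v"
      using add_pos_nonneg[OF zero_less_one nn] by (simp_all add: v_def)
    from expectation_abs_le_sqrt(1)[OF mT _ this] T2 show ?I by (simp add: has_bochner_integral_iff)
  qed
  show ?L
  proof (rule tendstoI)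
    fix \<epsilon> :: real assume \<epsilon>: "0 < \<epsilon>"
    have "0 < (\<epsilon> / 2)\<^sup>2" using \<epsilon> by simp
    from drift_second_moment_small[OF this] eventually_gt_at_top[of 0]
    show "\<forall>\<^sub>F N in sequentially. dist ((\<integral>\<omega>. \<bar>?T N \<omega>\<bar> \<partial>M) / sqrt (real N)) 0 < \<epsilon>"
    proof eventually_elim
      case (elim N)
      have "(\<integral>\<omega>. (?T N \<omega>)\<^sup>2 \<partial>M) = (\<Sum>i<N. \<integral>\<omega>. (drift N i (path \<omega>) (\<zeta> i \<omega>))\<^sup>2 \<partial>M)"
        using T2[of N] by (simp only: has_bochner_integral_iff)
      also have "\<dots> \<le> (\<Sum>i<N. (\<epsilon> / 2)\<^sup>2)"
        using elim by (intro sum_mono less_imp_le) auto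
      also have "\<dots> = (sqrt (real N) * (\<epsilon> / 2))\<^sup>2"
        by (simp add: power_mult_distrib power_divide)
      finally have "(\<integral>\<omega>. \<bar>?T N \<omega>\<bar> \<partial>M) \<le> sqrt (real N) * (\<epsilon> / 2)"
        using T2[of N] elim \<epsilon>
        by (intro expectation_abs_le_sqrt(2)[OF mT]) (auto simp: has_bochner_integral_iff)
      then have "(\<integral>\<omega>. \<bar>?T N \<omega>\<bar> \<partial>M) / sqrt (real N) \<le> \<epsilon> / 2"
        using elim by (simp add: field_simps)
      moreover have "0 \<le> (\<integral>\<omega>. \<bar>?T N \<omega>\<bar> \<partial>M) / sqrt (real N)"
        by (intro divide_nonneg_nonneg Bochner_Integration.integral_nonneg) auto
      ultimately show ?case using \<epsilon> unfolding dist_real_def by linarith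
    qed
  qed
qed

section \<open>The sum of the remainders and the total linearisation error\<close>

lemma borel_measurable_trunc [measurable]: "trunc N \<in> borel_measurable borel"
  unfolding trunc_def[abs_def] by measurable

lemma trunc_bounds: "0 \<le> trunc N x" "trunc N x \<le> (wt l x)\<^sup>2"
proof -
  have "0 \<le> min (wt l x / sqrt (real N)) 1" using wt_pos[of l x] by simp
  moreover have "(wt l x)\<^sup>2 * min (wt l x / sqrt (real N)) 1 \<le> (wt l x)\<^sup>2 * 1"
    by (intro mult_left_mono) auto
  ultimately show "0 \<le> trunc N x" "trunc N x \<le> (wt l x)\<^sup>2" by (auto simp: trunc_def)
qed

lemma trunc_integrable: "integrable m\<^sub>0 (trunc N)"
proof (rule Bochner_Integration.integrable_bound[OF wt_integrable(1)[OF l m0]])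
  show "AE x in m\<^sub>0. norm (trunc N x) \<le> norm ((wt l x)\<^sup>2)"
    using trunc_bounds[of N] by (intro AE_I2) auto
qed measurable

lemma trunc_tendsto_0: "(\<lambda>N. integral\<^sup>L m\<^sub>0 (trunc N)) \<longlonglongrightarrow> 0"
proof -
  have "(\<lambda>N. integral\<^sup>L m\<^sub>0 (trunc N)) \<longlonglongrightarrow> (\<integral>x. 0 \<partial>m\<^sub>0)"
  proof (rule integral_dominated_convergence)
    show "integrable m\<^sub>0 (\<lambda>x. (wt l x)\<^sup>2)" by (rule wt_integrable(1)[OF l m0])
    show "AE x in m\<^sub>0. (\<lambda>N. trunc N x) \<longlonglongrightarrow> 0"
    proof (rule AE_I2)
      fix x :: 'a
      have "(\<lambda>N. (wt l x)\<^sup>2 * min (wt l x / sqrt (real N)) 1) \<longlonglongrightarrow> (wt l x)\<^sup>2 * min 0 1"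
        by (intro tendsto_intros inverse_sqrt_tendsto_0)
      then show "(\<lambda>N. trunc N x) \<longlonglongrightarrow> 0" by (simp add: trunc_def)
    qed
    show "AE x in m\<^sub>0. norm (trunc N x) \<le> (wt l x)\<^sup>2" for N
      using trunc_bounds[of N] by (intro AE_I2) auto
  qed measurable
  then show ?thesis by simp
qed

text \<open>The moment factor in \<open>remainder_bound\<close> depends on the past and
  \<open>trunc\<close> on the new point, so the expectation factorises.\<close>

lemma remainder_expectation:
  assumes iN: "i < N"
  defines "R \<equiv> \<lambda>\<omega>. real N * (U (emp N (Suc i) (path \<omega>)) - U (emp N i (path \<omega>))) - lin (emp N i (path \<omega>)) (\<zeta> i \<omega>)"
  shows "integrable M R"
    and "(\<integral>\<omega>. \<bar>R \<omega>\<bar> \<partial>M) \<le> rem_const * (2 + moment m\<^sub>0) * integral\<^sup>L m\<^sub>0 (trunc N) / sqrt (real N)"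
proof -
  have N: "0 < N" "i \<le> N" "Suc i \<le> N" using iN by auto
  have [measurable]: "(\<lambda>\<omega>. U (emp N k (path \<omega>))) \<in> borel_measurable M" if "k \<le> N" for k
    using N that by (intro U_emp_measurable) auto
  have "(\<lambda>\<omega>. lin (emp N i (hist i \<omega>)) (\<zeta> i \<omega>)) \<in> borel_measurable M"
    using measurable_compose[OF measurable_Pair[OF hist_measurable rv] lin_emp_hist_measurable[OF N(1,2)]] by simp
  then have [measurable]: "(\<lambda>\<omega>. lin (emp N i (path \<omega>)) (\<zeta> i \<omega>)) \<in> borel_measurable M"
    by (simp only: emp_hist[OF order_refl])
  have mR[measurable]: "R \<in> borel_measurable M"
    unfolding R_def using N by measurable
  define c where "c = rem_const * integral\<^sup>L m\<^sub>0 (trunc N) / sqrt (real N)"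
  have c: "0 \<le> c"
    unfolding c_def using rem_const_nonneg trunc_bounds(1)
    by (intro divide_nonneg_nonneg mult_nonneg_nonneg Bochner_Integration.integral_nonneg) auto
  let ?F = "\<lambda>z x. rem_const * (2 + moment (emp N i z)) * trunc N x / sqrt (real N)"
  have F0: "0 \<le> ?F z x" for z x
    using rem_const_nonneg trunc_bounds(1)[of N x] moment_nonneg[of "emp N i z"]
    by (intro divide_nonneg_nonneg mult_nonneg_nonneg add_nonneg_nonneg) auto
  have "\<bar>R \<omega>\<bar> \<le> ?F (path \<omega>) (\<zeta> i \<omega>)" for \<omega>
  proof -
    let ?A = "moment (emp N i (path \<omega>))"
    \<comment> \<open>The root is traded for a linear expression, because the expected moment of the
      random measure is exactly that of \<open>m\<^sub>0\<close>.\<close>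
    have "sqrt ?A \<le> 1 + ?A"
      using moment_nonneg[of "emp N i (path \<omega>)"] by (intro real_le_lsqrt) (auto simp: power2_sum)
    then have "rem_const * (1 + sqrt ?A) * trunc N (\<zeta> i \<omega>) / sqrt (real N) \<le> ?F (path \<omega>) (\<zeta> i \<omega>)"
      using rem_const_nonneg trunc_bounds(1)[of N "\<zeta> i \<omega>"]
      by (intro divide_right_mono mult_right_mono mult_left_mono) auto
    with remainder_bound[OF iN, of "path \<omega>"] show ?thesis by (simp add: R_def)
  qed
  then have "(\<integral>\<^sup>+\<omega>. ennreal \<bar>R \<omega>\<bar> \<partial>M) \<le> (\<integral>\<^sup>+\<omega>. ennreal (?F (hist i \<omega>) (\<zeta> i \<omega>)) \<partial>M)"
    unfolding emp_hist[OF order_refl] by (intro nn_integral_mono ennreal_leI)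
  also have "\<dots> = (\<integral>\<^sup>+\<omega>. \<integral>\<^sup>+x. ennreal (?F (hist i \<omega>) x) \<partial>m\<^sub>0 \<partial>M)"
  proof (rule nn_integral_hist)
    have [measurable]: "(\<lambda>z. moment (emp N i z)) \<in> borel_measurable (hist_space i)"
      using prob_momentD(4)[OF m0] by (subst integral_emp[OF N(1,2)]) measurable
    show "(\<lambda>(z, x). ennreal (?F z x)) \<in> borel_measurable (hist_space i \<Otimes>\<^sub>M borel)"
      by measurable
  qed
  also have "\<dots> = (\<integral>\<^sup>+\<omega>. ennreal (c * (2 + moment (emp N i (path \<omega>)))) \<partial>M)"
  proof (rule nn_integral_cong)
    fix \<omega>
    have "(\<integral>\<^sup>+x. ennreal (?F (hist i \<omega>) x) \<partial>m\<^sub>0) = ennreal (\<integral>x. ?F (hist i \<omega>) x \<partial>m\<^sub>0)"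
      using trunc_integrable F0 by (intro nn_integral_eq_integral) auto
    also have "(\<integral>x. ?F (hist i \<omega>) x \<partial>m\<^sub>0) = c * (2 + moment (emp N i (path \<omega>)))"
      unfolding emp_hist[OF order_refl] by (simp add: c_def)
    finally show "(\<integral>\<^sup>+x. ennreal (?F (hist i \<omega>) x) \<partial>m\<^sub>0) = ennreal (c * (2 + moment (emp N i (path \<omega>))))" .
  qed
  also have "\<dots> = ennreal (c * (2 + moment m\<^sub>0))"
  proof -
    have E: "has_bochner_integral M (\<lambda>\<omega>. moment (emp N i (path \<omega>))) (moment m\<^sub>0)"
      using prob_momentD(4)[OF m0] by (intro expectation_integral_emp N) auto
    have "(\<integral>\<^sup>+\<omega>. ennreal (c * (2 + moment (emp N i (path \<omega>)))) \<partial>M)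
        = ennreal (\<integral>\<omega>. c * (2 + moment (emp N i (path \<omega>))) \<partial>M)"
      using E c moment_nonneg
      by (intro nn_integral_eq_integral) (auto simp: has_bochner_integral_iff intro!: mult_nonneg_nonneg add_nonneg_nonneg)
    also have "(\<integral>\<omega>. c * (2 + moment (emp N i (path \<omega>))) \<partial>M) = c * (2 + moment m\<^sub>0)"
      using E by (simp add: has_bochner_integral_iff prob_space)
    finally show ?thesis .
  qed
  finally have bd: "(\<integral>\<^sup>+\<omega>. ennreal \<bar>R \<omega>\<bar> \<partial>M) \<le> ennreal (c * (2 + moment m\<^sub>0))" .
  show "integrable M R"
    using bd mR by (intro integrableI_bounded) (auto intro: le_less_trans)
  have "(\<integral>\<omega>. \<bar>R \<omega>\<bar> \<partial>M) \<le> c * (2 + moment m\<^sub>0)"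
    using bd c moment_nonneg by (intro integral_real_bounded mult_nonneg_nonneg add_nonneg_nonneg) auto
  then show "(\<integral>\<omega>. \<bar>R \<omega>\<bar> \<partial>M) \<le> rem_const * (2 + moment m\<^sub>0) * integral\<^sup>L m\<^sub>0 (trunc N) / sqrt (real N)"
    by (simp add: c_def ac_simps)
qed

definition lin_error :: "nat \<Rightarrow> 'w \<Rightarrow> real" where
  "lin_error N \<omega> = real N * (U (empirical_measure N (path \<omega>)) - U m\<^sub>0) - (\<Sum>i<N. lin m\<^sub>0 (\<zeta> i \<omega>))"

text \<open>The increments of \<open>U\<close> telescope from \<open>m\<^sub>0\<close> to the
  empirical measure, so the error is the drift sum plus the N remainders. Each remainder is of order
  \<open>integral\<^sup>L m\<^sub>0 (trunc N) / sqrt N\<close>; their sum over \<open>sqrt N\<close>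
  is of the order of that integral, which tends to 0.\<close>

lemma lin_error:
  shows "integrable M (lin_error N)" (is ?I)
    and "(\<lambda>N. (\<integral>\<omega>. \<bar>lin_error N \<omega>\<bar> \<partial>M) / sqrt (real N)) \<longlonglongrightarrow> 0" (is ?L)
proof -
  define R where "R N i \<omega> = real N * (U (emp N (Suc i) (path \<omega>)) - U (emp N i (path \<omega>))) -
    lin (emp N i (path \<omega>)) (\<zeta> i \<omega>)" for N i \<omega>
  let ?T = "\<lambda>N \<omega>. \<Sum>i<N. drift N i (path \<omega>) (\<zeta> i \<omega>)"
  have eq: "lin_error N \<omega> = ?T N \<omega> + (\<Sum>i<N. R N i \<omega>)" for N \<omega>
  proof (cases "N = 0")
    case True
    then show ?thesis by (simp add: lin_error_def)
  next
    case False
    have "?T N \<omega> + (\<Sum>i<N. R N i \<omega>)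
        = (\<Sum>i<N. real N * (U (emp N (Suc i) (path \<omega>)) - U (emp N i (path \<omega>))) - lin m\<^sub>0 (\<zeta> i \<omega>))"
      unfolding sum.distrib[symmetric] drift_def R_def by (intro sum.cong) auto
    also have "\<dots> = real N * (\<Sum>i<N. U (emp N (Suc i) (path \<omega>)) - U (emp N i (path \<omega>)))
        - (\<Sum>i<N. lin m\<^sub>0 (\<zeta> i \<omega>))"
      by (simp only: sum_subtractf[of "\<lambda>i. real N * _ i"] sum_distrib_left)
    also have "(\<Sum>i<N. U (emp N (Suc i) (path \<omega>)) - U (emp N i (path \<omega>)))
        = U (emp N N (path \<omega>)) - U (emp N 0 (path \<omega>))"
      by (rule sum_lessThan_telescope)
    finally show ?thesis
      using False by (simp add: lin_error_def partial_empirical_0[OF prob_m0 sets_m0]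
          partial_empirical_full[OF prob_m0 sets_m0])
  qed
  have Ri: "integrable M (R N i)"
    and Rb: "(\<integral>\<omega>. \<bar>R N i \<omega>\<bar> \<partial>M) \<le> rem_const * (2 + moment m\<^sub>0) * integral\<^sup>L m\<^sub>0 (trunc N) / sqrt (real N)"
    if "i < N" for N i
    using remainder_expectation[OF that] by (simp_all add: R_def[abs_def])
  have I: "integrable M (lin_error N)" for N
    unfolding eq[abs_def]
    by (intro Bochner_Integration.integrable_add Bochner_Integration.integrable_sum drift_sum(1) Ri) simp
  then show ?I .
  let ?b = "\<lambda>N. (\<integral>\<omega>. \<bar>?T N \<omega>\<bar> \<partial>M) / sqrt (real N) + rem_const * (2 + moment m\<^sub>0) * integral\<^sup>L m\<^sub>0 (trunc N)"
  have bound: "norm ((\<integral>\<omega>. \<bar>lin_error N \<omega>\<bar> \<partial>M) / sqrt (real N)) \<le> ?b N" if N: "0 < N" for N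
  proof -
    have IT: "integrable M (\<lambda>\<omega>. \<bar>?T N \<omega>\<bar>)"
      by (intro integrable_abs drift_sum(1))
    have IR: "integrable M (\<lambda>\<omega>. \<bar>R N i \<omega>\<bar>)" if "i \<in> {..<N}" for i
      using that by (intro integrable_abs Ri) simp
    have sumR: "(\<integral>\<omega>. (\<Sum>i<N. \<bar>R N i \<omega>\<bar>) \<partial>M) = (\<Sum>i<N. \<integral>\<omega>. \<bar>R N i \<omega>\<bar> \<partial>M)"
      by (rule Bochner_Integration.integral_sum[OF IR])
    note IRs = Bochner_Integration.integrable_sum[of "{..<N}", OF IR]
    have "(\<integral>\<omega>. \<bar>lin_error N \<omega>\<bar> \<partial>M) \<le> (\<integral>\<omega>. \<bar>?T N \<omega>\<bar> + (\<Sum>i<N. \<bar>R N i \<omega>\<bar>) \<partial>M)"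
    proof (rule integral_mono)
      show "integrable M (\<lambda>\<omega>. \<bar>?T N \<omega>\<bar> + (\<Sum>i<N. \<bar>R N i \<omega>\<bar>))"
        by (intro Bochner_Integration.integrable_add IT IRs)
      show "\<bar>lin_error N \<omega>\<bar> \<le> \<bar>?T N \<omega>\<bar> + (\<Sum>i<N. \<bar>R N i \<omega>\<bar>)" for \<omega>
        unfolding eq by (intro order_trans[OF abs_triangle_ineq] add_left_mono sum_abs)
    qed (use I in auto)
    also have "\<dots> = (\<integral>\<omega>. \<bar>?T N \<omega>\<bar> \<partial>M) + (\<Sum>i<N. \<integral>\<omega>. \<bar>R N i \<omega>\<bar> \<partial>M)"
      by (simp only: Bochner_Integration.integral_add[OF IT IRs] sumR)
    also have "\<dots> \<le> (\<integral>\<omega>. \<bar>?T N \<omega>\<bar> \<partial>M) +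
        (\<Sum>i<N. rem_const * (2 + moment m\<^sub>0) * integral\<^sup>L m\<^sub>0 (trunc N) / sqrt (real N))"
      using Rb by (intro add_left_mono sum_mono) auto
    also have "\<dots> = (\<integral>\<omega>. \<bar>?T N \<omega>\<bar> \<partial>M) + real N / sqrt (real N) * (rem_const * (2 + moment m\<^sub>0) * integral\<^sup>L m\<^sub>0 (trunc N))"
      by simp
    also have "\<dots> = ?b N * sqrt (real N)"
      using N by (simp add: real_div_sqrt field_simps)
    finally have "(\<integral>\<omega>. \<bar>lin_error N \<omega>\<bar> \<partial>M) / sqrt (real N) \<le> ?b N"
      using N by (simp add: pos_divide_le_eq)
    moreover have "0 \<le> (\<integral>\<omega>. \<bar>lin_error N \<omega>\<bar> \<partial>M) / sqrt (real N)"
      by (intro divide_nonneg_nonneg Bochner_Integration.integral_nonneg) auto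
    ultimately show ?thesis by simp
  qed
  have "?b \<longlonglongrightarrow> 0 + rem_const * (2 + moment m\<^sub>0) * 0"
    by (intro tendsto_intros drift_sum(2) trunc_tendsto_0)
  then have b: "?b \<longlonglongrightarrow> 0" by simp
  show ?L
    by (rule Lim_null_comparison[OF eventually_mono[OF eventually_gt_at_top[of 0] bound] b])
qed

end

section \<open>The central limit theorem\<close>

lemma norm_iexp_diff_le: "cmod (iexp a - iexp b) \<le> \<bar>a - b\<bar>"
proof -
  have "iexp a - iexp b = iexp b * (iexp (a - b) - 1)"
    by (simp add: algebra_simps exp_diff exp_minus_inverse)
  then have "cmod (iexp a - iexp b) = cmod (iexp (a - b) - 1)"
    by (simp add: norm_mult)
  then show ?thesis
    using iexp_approx1[of "a - b" 0] by simp
qed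

lemma (in prob_space) char_distr:
  assumes [measurable]: "X \<in> borel_measurable M"
  shows "char (distr M borel X) t = (CLINT \<omega>|M. iexp (t * X \<omega>))"
  unfolding char_def by (subst integral_distr) simp_all

text \<open>In the role of Slutsky's lemma: an error vanishing in mean does not alter the limiting
  characteristic function.\<close>

lemma (in prob_space) char_distr_diff_le:
  fixes X Y :: "'a \<Rightarrow> real"
  assumes [measurable]: "X \<in> borel_measurable M" "Y \<in> borel_measurable M"
    and i: "integrable M (\<lambda>\<omega>. X \<omega> - Y \<omega>)"
  shows "cmod (char (distr M borel X) t - char (distr M borel Y) t) \<le> \<bar>t\<bar> * (\<integral>\<omega>. \<bar>X \<omega> - Y \<omega>\<bar> \<partial>M)"
proof -
  have e: "integrable M (\<lambda>\<omega>. iexp (t * Z \<omega>))" if [measurable]: "Z \<in> borel_measurable M" for Z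
    by (rule integrable_const_bound[of _ 1]) auto
  have "char (distr M borel X) t - char (distr M borel Y) t
      = (CLINT \<omega>|M. iexp (t * X \<omega>) - iexp (t * Y \<omega>))"
    using e by (simp add: char_distr)
  also have "cmod \<dots> \<le> (\<integral>\<omega>. \<bar>t\<bar> * \<bar>X \<omega> - Y \<omega>\<bar> \<partial>M)"
  proof (intro order_trans[OF integral_norm_bound] integral_mono)
    show "cmod (iexp (t * X \<omega>) - iexp (t * Y \<omega>)) \<le> \<bar>t\<bar> * \<bar>X \<omega> - Y \<omega>\<bar>" for \<omega>
      using norm_iexp_diff_le[of "t * X \<omega>" "t * Y \<omega>"]
      by (simp add: right_diff_distrib[symmetric] abs_mult del: of_real_mult)
  qed (use e i in auto)
  finally show ?thesis by simp
qed

lemma real_distribution_centred_normal: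
  assumes "0 \<le> v"
  shows "real_distribution (centred_normal v)"
proof (cases "v = 0")
  case True
  then show ?thesis
    by (auto simp: centred_normal_def real_distribution_def real_distribution_axioms_def
        intro!: prob_space_return)
next
  case False
  then show ?thesis
    using assms
    by (auto simp: centred_normal_def real_distribution_def real_distribution_axioms_def
        intro!: prob_space_normal_density)
qed

lemma char_centred_normal:
  assumes "0 \<le> v"
  shows "char (centred_normal v) t = char std_normal_distribution (sqrt v * t)"
proof (cases "v = 0")
  case True
  then show ?thesis
    using real_distribution.char_zero[OF real_dist_normal_dist]
    by (simp add: centred_normal_def char_def integral_return)
next
  case False
  interpret std: real_distribution std_normal_distribution by (rule real_dist_normal_dist)
  have "distributed std_normal_distribution lborel (\<lambda>x. x) (normal_density 0 1)"
    unfolding distributed_def by (auto simp: distr_id2)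
  from std.normal_density_affine[OF this, of "sqrt v" 0] assms False
  have "distributed std_normal_distribution lborel (\<lambda>x. sqrt v * x) (normal_density 0 (sqrt v))"
    by simp
  then have d: "distr std_normal_distribution lborel (\<lambda>x. sqrt v * x) = centred_normal v"
    using False by (simp add: centred_normal_def distributed_def)
  show ?thesis
    unfolding d[symmetric] char_def by (subst integral_distr) (simp_all add: ac_simps)
qed

section \<open>The limit law and the uniform bound in mean\<close>

context hoelder_iid
begin

abbreviation asym_var :: real where
  "asym_var \<equiv> \<integral>x. (lin m\<^sub>0 x)\<^sup>2 \<partial>m\<^sub>0"

abbreviation lin_sum :: "nat \<Rightarrow> 'w \<Rightarrow> real" where
  "lin_sum N \<omega> \<equiv> \<Sum>i<N. lin m\<^sub>0 (\<zeta> i \<omega>)"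

lemma lin_measurable [measurable]: "lin m\<^sub>0 \<in> borel_measurable borel"
  using V_measurable[OF m0] by measurable

lemma lin_mean: "integral\<^sup>L m\<^sub>0 (lin m\<^sub>0) = 0"
  using V_integrable[OF m0 m0] by (simp add: law.prob_space)

lemma asym_var_nonneg: "0 \<le> asym_var"
  by (rule Bochner_Integration.integral_nonneg) simp

text \<open>Growth of order \<open>l / 2\<close> bounds the derivative at \<open>m\<^sub>0\<close>
  by a multiple of the weight, whose square is integrable.\<close>

lemma lin_square_integrable: "integrable m\<^sub>0 (\<lambda>x. (lin m\<^sub>0 x)\<^sup>2)"
proof -
  note [measurable] = V_measurable[OF m0]
  let ?c = "C * (1 + sqrt (moment m\<^sub>0))"
  have c: "0 \<le> ?c" using C_nonneg moment_nonneg[of m\<^sub>0] by simp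
  have "integrable m\<^sub>0 (\<lambda>x. (V m\<^sub>0 x)\<^sup>2)"
  proof (rule Bochner_Integration.integrable_bound)
    show "integrable m\<^sub>0 (\<lambda>x. ?c\<^sup>2 * (wt l x)\<^sup>2)"
      using wt_integrable(1)[OF l m0] by simp
    show "AE x in m\<^sub>0. norm ((V m\<^sub>0 x)\<^sup>2) \<le> norm (?c\<^sup>2 * (wt l x)\<^sup>2)"
    proof (rule AE_I2)
      fix x :: 'a
      have "1 * sqrt (moment m\<^sub>0) \<le> wt l x * sqrt (moment m\<^sub>0)"
        using wt_ge_1[of l x] moment_nonneg[of m\<^sub>0] by (intro mult_right_mono) auto
      then have "C * (wt l x + sqrt (moment m\<^sub>0)) \<le> C * ((1 + sqrt (moment m\<^sub>0)) * wt l x)"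
        by (intro mult_left_mono C_nonneg) (simp add: algebra_simps)
      then have "\<bar>V m\<^sub>0 x\<bar> \<le> ?c * wt l x"
        using V_growth[OF m0, of x] by (simp add: mult.assoc)
      then have "\<bar>V m\<^sub>0 x\<bar>\<^sup>2 \<le> (?c * wt l x)\<^sup>2" by (intro power_mono) auto
      then show "norm ((V m\<^sub>0 x)\<^sup>2) \<le> norm (?c\<^sup>2 * (wt l x)\<^sup>2)"
        by (simp add: power_mult_distrib)
    qed
  qed measurable
  then show ?thesis
    using V_integrable[OF m0 m0] by (simp add: power2_diff)
qed

lemma lin_sum_measurable [measurable]: "lin_sum N \<in> borel_measurable M"
  by (intro borel_measurable_sum measurable_compose[OF rv lin_measurable])

lemma lin_sum_second_moment:
  "has_bochner_integral M (\<lambda>\<omega>. (lin_sum N \<omega>)\<^sup>2) (real N * asym_var)"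
proof -
  have "has_bochner_integral M (\<lambda>\<omega>. (lin_sum N \<omega>)\<^sup>2) (\<Sum>i<N. \<integral>\<omega>. (lin m\<^sub>0 (\<zeta> i \<omega>))\<^sup>2 \<partial>M)"
  proof (rule expectation_martingale_sum_sq[where n=N and g="\<lambda>_ _ x. lin m\<^sub>0 x"])
    show "integrable M (\<lambda>\<omega>. (lin m\<^sub>0 (\<zeta> i \<omega>))\<^sup>2)" for i
      using integrable_iid_iff[of "\<lambda>x. (lin m\<^sub>0 x)\<^sup>2"] lin_square_integrable by simp
    show "(\<lambda>(z, x). lin m\<^sub>0 x) \<in> borel_measurable (hist_space i \<Otimes>\<^sub>M borel)" for i
      using measurable_compose[OF measurable_snd lin_measurable] by (simp add: split_beta')
  qed (simp_all only: lin_mean order_refl)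
  moreover have "(\<integral>\<omega>. (lin m\<^sub>0 (\<zeta> i \<omega>))\<^sup>2 \<partial>M) = asym_var" for i
    by (rule expectation_iid[of "\<lambda>x. (lin m\<^sub>0 x)\<^sup>2"]) measurable
  ultimately show ?thesis by simp
qed

text \<open>The classical theorem requires positive variance. If the variance is 0, the sums vanish
  almost surely and both characteristic functions equal 1.\<close>

lemma lin_sum_char_tendsto:
  "(\<lambda>N. char (distr M borel (\<lambda>\<omega>. lin_sum N \<omega> / sqrt (real N))) t)
    \<longlonglongrightarrow> char (centred_normal asym_var) t"
proof (cases "asym_var = 0")
  case True
  have "char (distr M borel (\<lambda>\<omega>. lin_sum N \<omega> / sqrt (real N))) t = 1" for N
  proof -
    have "AE \<omega> in M. (lin_sum N \<omega>)\<^sup>2 = 0"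
      using lin_sum_second_moment[of N] True
      by (subst integral_nonneg_eq_0_iff_AE[symmetric]) (auto simp: has_bochner_integral_iff)
    then have ae: "AE \<omega> in M. iexp (t * (lin_sum N \<omega> / sqrt (real N))) = 1"
    proof eventually_elim
      case (elim \<omega>)
      then have "lin_sum N \<omega> = 0" by (rule zero_eq_power2[THEN iffD1])
      then show ?case by (simp only: div_0 mult_zero_right of_real_0 exp_zero)
    qed
    have meas: "(\<lambda>\<omega>. lin_sum N \<omega> / sqrt (real N)) \<in> borel_measurable M"
      by measurable
    have "(CLINT \<omega>|M. iexp (t * (lin_sum N \<omega> / sqrt (real N)))) = (CLINT \<omega>|M. 1)"
      by (rule integral_cong_AE[OF _ _ ae]) (use meas in measurable)
    also have "\<dots> = 1" by (simp add: prob_space)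
    finally show ?thesis by (simp only: char_distr[OF meas])
  qed
  then show ?thesis
    using True real_distribution.char_zero[OF real_dist_normal_dist]
    by (simp add: char_centred_normal)
next
  case False
  define \<sigma> where "\<sigma> = sqrt asym_var"
  have \<sigma>: "0 < \<sigma>" "\<sigma>\<^sup>2 = asym_var"
  proof -
    have "0 < asym_var" using False asym_var_nonneg by linarith
    then show "0 < \<sigma>" "\<sigma>\<^sup>2 = asym_var" by (auto simp: \<sigma>_def)
  qed
  have "weak_conv_m (\<lambda>N. distr M borel (\<lambda>\<omega>. lin_sum N \<omega> / sqrt (real N * \<sigma>\<^sup>2))) std_normal_distribution"
  proof (rule central_limit_theorem_zero_mean)
    show "indep_vars (\<lambda>_. borel) (\<lambda>i \<omega>. lin m\<^sub>0 (\<zeta> i \<omega>)) UNIV"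
      by (rule indep_vars_compose2[OF indep]) (rule lin_measurable)
    show mean: "expectation (\<lambda>\<omega>. lin m\<^sub>0 (\<zeta> i \<omega>)) = 0" for i
      using expectation_iid[OF lin_measurable] lin_mean by simp
    show "0 < \<sigma>" by (rule \<sigma>)
    show "integrable M (\<lambda>\<omega>. (lin m\<^sub>0 (\<zeta> i \<omega>))\<^sup>2)" for i
      using integrable_iid_iff[of "\<lambda>x. (lin m\<^sub>0 x)\<^sup>2"] lin_square_integrable by simp
    show "variance (\<lambda>\<omega>. lin m\<^sub>0 (\<zeta> i \<omega>)) = \<sigma>\<^sup>2" for i
      unfolding mean \<sigma> diff_0_right by (rule expectation_iid[of "\<lambda>x. (lin m\<^sub>0 x)\<^sup>2"]) measurable
    show "distr M borel (\<lambda>\<omega>. lin m\<^sub>0 (\<zeta> i \<omega>)) = distr m\<^sub>0 borel (lin m\<^sub>0)" for i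
      using distr_distr[OF lin_measurable rv[of i]] by (simp add: distr_eq comp_def)
  qed
  \<comment> \<open>Evaluation at \<open>\<sigma> * t\<close> undoes the normalisation by
    \<open>\<sigma>\<close>.\<close>
  from levy_continuity1[OF _ real_dist_normal_dist this, of "\<sigma> * t"]
  have "(\<lambda>N. char (distr M borel (\<lambda>\<omega>. lin_sum N \<omega> / sqrt (real N * \<sigma>\<^sup>2))) (\<sigma> * t))
      \<longlonglongrightarrow> char std_normal_distribution (\<sigma> * t)"
    by (auto intro!: real_distribution_distr)
  also have "char std_normal_distribution (\<sigma> * t) = char (centred_normal asym_var) t"
    by (simp add: char_centred_normal[OF asym_var_nonneg] \<sigma>_def)
  also have "(\<lambda>N. char (distr M borel (\<lambda>\<omega>. lin_sum N \<omega> / sqrt (real N * \<sigma>\<^sup>2))) (\<sigma> * t))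
      = (\<lambda>N. char (distr M borel (\<lambda>\<omega>. lin_sum N \<omega> / sqrt (real N))) t)"
    using \<sigma>(1) by (intro ext) (simp add: char_distr real_sqrt_mult mult.commute)
  finally show ?thesis .
qed

abbreviation gap :: "nat \<Rightarrow> 'w \<Rightarrow> real" where
  "gap N \<omega> \<equiv> U (empirical_measure N (path \<omega>)) - U m\<^sub>0"

lemma U_empirical_measurable:
  assumes "1 \<le> N"
  shows "(\<lambda>\<omega>. U (empirical_measure N (path \<omega>))) \<in> borel_measurable M"
proof -
  have N: "0 < N" using assms by simp
  have "(\<lambda>\<omega>. U (emp N N (path \<omega>))) \<in> borel_measurable M"
    by (rule U_emp_measurable[OF N order_refl rv])
  then show ?thesis by (simp add: partial_empirical_full[OF prob_m0 sets_m0 N])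
qed

lemma scaled_gap: "sqrt (real N) * gap N \<omega> = lin_sum N \<omega> / sqrt (real N) + lin_error N \<omega> / sqrt (real N)"
proof (cases "N = 0")
  case False
  then have "real N = sqrt (real N) * sqrt (real N)" by simp
  then show ?thesis
    using False by (simp add: lin_error_def add_divide_distrib[symmetric]) (simp add: field_simps)
qed simp

lemma scaled_gap_measurable: "(\<lambda>\<omega>. sqrt (real N) * gap N \<omega>) \<in> borel_measurable M"
  unfolding scaled_gap using lin_error(1)[of N] by measurable

lemma scaled_gap_weak_conv:
  "weak_conv_m (\<lambda>N. distr M borel (\<lambda>\<omega>. sqrt (real N) * gap N \<omega>)) (centred_normal asym_var)"
proof (rule levy_continuity)
  show "real_distribution (distr M borel (\<lambda>\<omega>. sqrt (real N) * gap N \<omega>))" for N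
    by (rule real_distribution_distr[OF scaled_gap_measurable])
  show "real_distribution (centred_normal asym_var)"
    by (rule real_distribution_centred_normal[OF asym_var_nonneg])
  fix t
  let ?X = "\<lambda>N. distr M borel (\<lambda>\<omega>. sqrt (real N) * gap N \<omega>)"
  let ?Y = "\<lambda>N. distr M borel (\<lambda>\<omega>. lin_sum N \<omega> / sqrt (real N))"
  have bound: "cmod (char (?X N) t - char (?Y N) t)
      \<le> \<bar>t\<bar> * ((\<integral>\<omega>. \<bar>lin_error N \<omega>\<bar> \<partial>M) / sqrt (real N))" for N
  proof -
    have diff: "sqrt (real N) * gap N \<omega> - lin_sum N \<omega> / sqrt (real N) = lin_error N \<omega> / sqrt (real N)" for \<omega>
      unfolding scaled_gap by simp
    have "cmod (char (?X N) t - char (?Y N) t)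
        \<le> \<bar>t\<bar> * (\<integral>\<omega>. \<bar>sqrt (real N) * gap N \<omega> - lin_sum N \<omega> / sqrt (real N)\<bar> \<partial>M)"
    proof (rule char_distr_diff_le[OF scaled_gap_measurable])
      show "integrable M (\<lambda>\<omega>. sqrt (real N) * gap N \<omega> - lin_sum N \<omega> / sqrt (real N))"
        unfolding diff using lin_error(1)[of N] by simp
    qed measurable
    then show ?thesis unfolding diff by (simp add: abs_divide)
  qed
  have "(\<lambda>N. \<bar>t\<bar> * ((\<integral>\<omega>. \<bar>lin_error N \<omega>\<bar> \<partial>M) / sqrt (real N))) \<longlonglongrightarrow> \<bar>t\<bar> * 0"
    by (intro tendsto_intros lin_error(2))
  then have "(\<lambda>N. \<bar>t\<bar> * ((\<integral>\<omega>. \<bar>lin_error N \<omega>\<bar> \<partial>M) / sqrt (real N))) \<longlonglongrightarrow> 0"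
    by (simp only: mult_zero_right)
  then have "(\<lambda>N. char (?X N) t - char (?Y N) t) \<longlonglongrightarrow> 0"
    by (rule Lim_null_comparison[OF always_eventually[OF allI[OF bound]]])
  from tendsto_add[OF this lin_sum_char_tendsto[of t]]
  show "(\<lambda>N. char (?X N) t) \<longlonglongrightarrow> char (centred_normal asym_var) t" by simp
qed

text \<open>The linear part is bounded in mean by its second moment, and the normalised error
  because it converges.\<close>

lemma scaled_gap_L1_bound:
  "(SUP N\<in>{1..}. ennreal (sqrt (real N)) * (\<integral>\<^sup>+\<omega>. ennreal \<bar>gap N \<omega>\<bar> \<partial>M)) < \<infinity>"
proof -
  have "Bseq (\<lambda>N. (\<integral>\<omega>. \<bar>lin_error N \<omega>\<bar> \<partial>M) / sqrt (real N))"
    using lin_error(2) by (intro convergent_imp_Bseq convergentI)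
  then obtain K where K: "\<And>N. (\<integral>\<omega>. \<bar>lin_error N \<omega>\<bar> \<partial>M) / sqrt (real N) \<le> K"
    unfolding Bseq_def by (metis abs_le_D1 real_norm_def)
  \<comment> \<open>The summand 1 keeps the bound positive when the asymptotic variance is 0, as
    \<open>expectation_abs_le_sqrt\<close> demands.\<close>
  define B where "B = sqrt (1 + asym_var) + K"
  have "ennreal (sqrt (real N)) * (\<integral>\<^sup>+\<omega>. ennreal \<bar>gap N \<omega>\<bar> \<partial>M) \<le> ennreal B" if "N \<in> {1..}" for N
  proof -
    have N: "0 < N" "1 \<le> N" using that by auto
    note [measurable] = U_empirical_measurable[OF N(2)]
    have v: "real N * asym_var \<le> (sqrt (real N) * sqrt (1 + asym_var))\<^sup>2" "0 < sqrt (real N) * sqrt (1 + asym_var)"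
      using N asym_var_nonneg add_pos_nonneg[OF zero_less_one asym_var_nonneg]
      by (simp_all add: power_mult_distrib)
    have S: "integrable M (lin_sum N)"
      "(\<integral>\<omega>. \<bar>lin_sum N \<omega>\<bar> \<partial>M) \<le> sqrt (real N) * sqrt (1 + asym_var)"
      using expectation_abs_le_sqrt[OF lin_sum_measurable _ _ v(2)] lin_sum_second_moment[of N] v(1)
      by (simp_all add: has_bochner_integral_iff)
    have iR: "integrable M (\<lambda>\<omega>. \<bar>lin_sum N \<omega>\<bar> / sqrt (real N) + \<bar>lin_error N \<omega>\<bar> / sqrt (real N))"
      using S(1) lin_error(1)[of N] by simp
    have "ennreal (sqrt (real N)) * (\<integral>\<^sup>+\<omega>. ennreal \<bar>gap N \<omega>\<bar> \<partial>M)
        = (\<integral>\<^sup>+\<omega>. ennreal \<bar>sqrt (real N) * gap N \<omega>\<bar> \<partial>M)"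
      by (subst nn_integral_cmult[symmetric]) (simp_all add: ennreal_mult[symmetric] abs_mult)
    also have "\<dots> \<le> (\<integral>\<^sup>+\<omega>. ennreal (\<bar>lin_sum N \<omega>\<bar> / sqrt (real N) + \<bar>lin_error N \<omega>\<bar> / sqrt (real N)) \<partial>M)"
      unfolding scaled_gap
      by (intro nn_integral_mono ennreal_leI order_trans[OF abs_triangle_ineq]) (simp add: abs_divide)
    also have "\<dots> = ennreal (\<integral>\<omega>. \<bar>lin_sum N \<omega>\<bar> / sqrt (real N) + \<bar>lin_error N \<omega>\<bar> / sqrt (real N) \<partial>M)"
      using iR by (intro nn_integral_eq_integral) auto
    also have "\<dots> \<le> ennreal B"
    proof (rule ennreal_leI)
      have "(\<integral>\<omega>. \<bar>lin_sum N \<omega>\<bar> / sqrt (real N) + \<bar>lin_error N \<omega>\<bar> / sqrt (real N) \<partial>M)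
          = (\<integral>\<omega>. \<bar>lin_sum N \<omega>\<bar> \<partial>M) / sqrt (real N) + (\<integral>\<omega>. \<bar>lin_error N \<omega>\<bar> \<partial>M) / sqrt (real N)"
        using S(1) lin_error(1)[of N] by simp
      also have "\<dots> \<le> B"
        unfolding B_def using S(2) N K[of N] by (intro add_mono) (simp_all add: field_simps)
      finally show "(\<integral>\<omega>. \<bar>lin_sum N \<omega>\<bar> / sqrt (real N) + \<bar>lin_error N \<omega>\<bar> / sqrt (real N) \<partial>M) \<le> B" .
    qed
    finally show ?thesis .
  qed
  then have "(SUP N\<in>{1..}. ennreal (sqrt (real N)) * (\<integral>\<^sup>+\<omega>. ennreal \<bar>gap N \<omega>\<bar> \<partial>M)) \<le> ennreal B"
    by (rule SUP_least)
  also have "\<dots> < \<infinity>" by simp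
  finally show ?thesis .
qed

end

theorem corollary3p3:
  fixes l \<alpha> :: real
    and m\<^sub>0 :: "'a::euclidean_space measure"
    and M :: "'w measure"
    and \<zeta> :: "nat \<Rightarrow> 'w \<Rightarrow> 'a"
    and U :: "'a measure \<Rightarrow> real"
  assumes "l \<ge> 0"
    and "m\<^sub>0 \<in> prob_moment l"
    and "prob_space M"
    and "prob_space.indep_vars M (\<lambda>_. borel) \<zeta> UNIV"
    and "\<And>i. distr M borel (\<zeta> i) = m\<^sub>0"
    and "U \<in> class_S l 1 (l / 2) \<inter> class_S l 2 l"
    and "0 < \<alpha>" and "\<alpha> \<le> (if l = 0 then 1 else 0) + min l 1"
    and "\<exists>C. \<forall>\<mu>\<in>prob_moment l. \<forall>x y y'.
           \<bar>lfd l 2 U \<mu> [x, y] / (1 + npow (l / 2) x) -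
             lfd l 2 U \<mu> [x, y'] / (1 + npow (l / 2) x)\<bar> \<le> C * norm (y - y') powr \<alpha>"
  shows "(\<forall>N\<ge>1. (\<lambda>\<omega>. U (empirical_measure N (\<lambda>i. \<zeta> i \<omega>))) \<in> borel_measurable M) \<and>
    weak_conv_m
      (\<lambda>N. distr M borel
         (\<lambda>\<omega>. sqrt (real N) * (U (empirical_measure N (\<lambda>i. \<zeta> i \<omega>)) - U m\<^sub>0)))
      (centred_normal (prob_space.variance M (\<lambda>\<omega>. lfd l 1 U m\<^sub>0 [\<zeta> 0 \<omega>]))) \<and>
    (SUP N\<in>{1..}. ennreal (sqrt (real N)) *
       (\<integral>\<^sup>+\<omega>. ennreal \<bar>U (empirical_measure N (\<lambda>i. \<zeta> i \<omega>)) - U m\<^sub>0\<bar> \<partial>M)) < \<infinity>"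
proof -
  obtain C where "hoelder_functional l \<alpha> C m\<^sub>0 U (\<lambda>m x. lfd l 1 U m [x])"
    using class_S_imp_hoelder_functional[OF assms(1,2,6-9)] by blast
  moreover have "iid_sequence M \<zeta> m\<^sub>0"
    using assms(3-5) by (simp add: iid_sequence_def iid_sequence_axioms_def)
  ultimately interpret hoelder_iid l \<alpha> C m\<^sub>0 U "\<lambda>m x. lfd l 1 U m [x]" M \<zeta>
    by (simp add: hoelder_iid_def)
  let ?V = "\<lambda>x. lfd l 1 U m\<^sub>0 [x]"
  have V: "?V \<in> borel_measurable borel" by (rule V_measurable[OF m0])
  have "variance (\<lambda>\<omega>. ?V (\<zeta> 0 \<omega>)) = expectation (\<lambda>\<omega>. (lin m\<^sub>0 (\<zeta> 0 \<omega>))\<^sup>2)"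
    by (simp only: expectation_iid[OF V])
  also have "\<dots> = asym_var"
    using lin_measurable by (intro expectation_iid[of "\<lambda>x. (lin m\<^sub>0 x)\<^sup>2"]) measurable
  finally show ?thesis
    using U_empirical_measurable scaled_gap_weak_conv scaled_gap_L1_bound by simp
qed

end
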